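(* The function $\lambda:(0,|\xi|_c)\to(0,\infty)$, $|\xi|\mapsto\lambda(|\xi|)$, is bounded, continuous, and satisfies $$\lim_{|\xi|\to0}\lambda(|\xi|)=\lim_{|\xi|\to|\xi|_c}\lambda(|\xi|)=0.$$
   Context: Parameters and steady state. Fix $g>0$, $\sigma\ge 0$, $m,\ell>0$. Let $P_\pm\in C^\infty((0,\infty))$ be positive and strictly increasing with $1/P_\pm'\in L^\infty_{loc}((0,\infty))$; let $\varepsilon_\pm,\delta_\pm\in C^\infty((0,\infty))$ with $\varepsilon_\pm>0$, $\delta_\pm\ge0$. Put $h_\pm(z)=\int_1^z P_\pm'(r)/r\,dr$. Assume $Z=\{z>0: P_-(z)>P_+(z),\ P_-(z)\in P_+((0,\infty))\}$ is nonempty, fix $\rho_0^-\in Z$ and set $\rho_0^+=P_+^{-1}(P_-(\rho_0^-))$. Assume $h_-(\rho_0^-)+gm\in h_-((0,\infty))$ and $h_+(\rho_0^+)-g\ell\in h_+((0,\infty))$. Define $\rho_0(x_3)=h_-^{-1}(h_-(\rho_0^-)-gx_3)$ for $-m<x_3<0$ and $\rho_0(x_3)=h_+^{-1}(h_+(\rho_0^+)-gx_3)$ for $0<x_3<\ell$; then $\rho_0$ is smooth on each side, bounded above and below by positive constants, and $\frac{d}{dx_3}P(\rho_0)=-g\rho_0$ on each side. Notation. $P'(\rho_0)$, $\varepsilon_0=\varepsilon(\rho_0)$, $\delta_0=\delta(\rho_0)$ mean the $+$ functions of $\rho_0$ for $x_3>0$ and the $-$ functions for $x_3<0$. $[[\rho_0]]=\rho_0^+-\rho_0^->0$.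 $|\xi|_c=\sqrt{g[[\rho_0]]/\sigma}$ ($=+\infty$ if $\sigma=0$). Variational quantities. For $|\xi|>0$ and $s>0$, with $\tilde\varepsilon=s\varepsilon_0$, $\tilde\delta=s\delta_0$ and real $\varphi,\psi\in H^1_0((-m,\ell))$, let $$E(\varphi,\psi)=\frac{\sigma|\xi|^2}{2}\psi(0)^2+\frac12\int_{-m}^\ell(\tilde\delta+P'(\rho_0)\rho_0)(\psi'+|\xi|\varphi)^2-2g\rho_0|\xi|\varphi\psi+\frac12\int_{-m}^\ell\tilde\varepsilon\left((\varphi'-|\xi|\psi)^2+(\psi'-|\xi|\varphi)^2+\tfrac13(\psi'+|\xi|\varphi)^2\right),$$ $J(\varphi,\psi)=\frac12\int_{-m}^\ell\rho_0(\varphi^2+\psi^2)$, $\mathcal A=\{(\varphi,\psi)\in H_0^1((-m,\ell))^2: J(\varphi,\psi)=1\}$, and $\mu(|\xi|,s)=\inf_{\mathcal A}E$. For $0<|\xi|<|\xi|_c$ there is a unique $s>0$ with $\mu(|\xi|,s)<0$ and $s=\sqrt{-\mu(|\xi|,s)}$; this $s$ is denoted $\lambda(|\xi|)$. *)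

theory Defs
  imports "HOL-Analysis.Analysis"
begin

definition smooth_on :: "real set \<Rightarrow> (real \<Rightarrow> real) \<Rightarrow> bool" where
  "smooth_on S f \<longleftrightarrow> (\<forall>n. \<forall>x\<in>S. (deriv ^^ n) f differentiable (at x))"

definition Linfty_loc :: "real set \<Rightarrow> (real \<Rightarrow> real) \<Rightarrow> bool" where
  "Linfty_loc S f \<longleftrightarrow> set_borel_measurable lborel S f \<and>
     (\<forall>K. compact K \<and> K \<subseteq> S \<longrightarrow> (\<exists>C. AE x in lborel. x \<in> K \<longrightarrow> \<bar>f x\<bar> \<le> C))"

definition test_function :: "real \<Rightarrow> real \<Rightarrow> (real \<Rightarrow> real) \<Rightarrow> bool" where
  "test_function a b \<eta> \<longleftrightarrow> smooth_on UNIV \<eta> \<and>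
     (\<exists>K. compact K \<and> K \<subseteq> {a<..<b} \<and> (\<forall>x. x \<notin> K \<longrightarrow> \<eta> x = 0))"

definition square_integrable :: "real \<Rightarrow> real \<Rightarrow> (real \<Rightarrow> real) \<Rightarrow> bool" where
  "square_integrable a b f \<longleftrightarrow> set_borel_measurable lborel {a<..<b} f \<and>
     set_integrable lborel {a<..<b} (\<lambda>x. (f x)\<^sup>2)"

definition has_weak_deriv :: "real \<Rightarrow> real \<Rightarrow> (real \<Rightarrow> real) \<Rightarrow> (real \<Rightarrow> real) \<Rightarrow> bool" where
  "has_weak_deriv a b f d \<longleftrightarrow> square_integrable a b f \<and> square_integrable a b d \<and>
     (\<forall>\<eta>. test_function a b \<eta> \<longrightarrow>
        (LBINT x:{a<..<b}. f x * deriv \<eta> x) = - (LBINT x:{a<..<b}. d x * \<eta> x))"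

text \<open>Weak derivatives are unique up to null sets, so the choice below is immaterial
  under integrals.\<close>

definition weak_deriv :: "real \<Rightarrow> real \<Rightarrow> (real \<Rightarrow> real) \<Rightarrow> real \<Rightarrow> real" where
  "weak_deriv a b f = (SOME d. has_weak_deriv a b f d)"

definition H1 :: "real \<Rightarrow> real \<Rightarrow> (real \<Rightarrow> real) set" where
  "H1 a b = {f. \<exists>d. has_weak_deriv a b f d}"

text \<open>\<open>H01 a b\<close> is the closure of the test functions in the \<open>H1\<close> norm. Each class is given
  by its representative that is continuous on \<open>{a..b}\<close>, which is what the point value
  of \<open>\<psi>\<close> at the interface in the energy refers to. Values outside \<open>{a..b}\<close> are irrelevant.\<close>

definition H01 :: "real \<Rightarrow> real \<Rightarrow> (real \<Rightarrow> real) set" where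
  "H01 a b = {f \<in> H1 a b. continuous_on {a..b} f \<and>
     (\<exists>\<eta>. (\<forall>n. test_function a b (\<eta> n)) \<and>
        (\<lambda>n::nat. (LBINT x:{a<..<b}. (\<eta> n x - f x)\<^sup>2) +
             (LBINT x:{a<..<b}. (deriv (\<eta> n) x - weak_deriv a b f x)\<^sup>2)) \<longlonglongrightarrow> 0)}"

definition enthalpy :: "(real \<Rightarrow> real) \<Rightarrow> real \<Rightarrow> real" where
  "enthalpy P z = (LBINT r=1..z. deriv P r / r)"

text \<open>Since \<open>1 / 0 = 0\<close> in HOL, membership of \<open>1 / P'\<close> in \<open>Linfty_loc\<close> is accompanied by the
  requirement that \<open>P'\<close> be nonzero almost everywhere.\<close>

definition pressure_law :: "(real \<Rightarrow> real) \<Rightarrow> bool" where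
  "pressure_law P \<longleftrightarrow> smooth_on {0<..} P \<and> (\<forall>z>0. P z > 0) \<and> strict_mono_on {0<..} P \<and>
     (AE z in lborel. z > 0 \<longrightarrow> deriv P z \<noteq> 0) \<and> Linfty_loc {0<..} (\<lambda>z. 1 / deriv P z)"

text \<open>Suffixes \<open>p\<close> and \<open>m\<close> mark the upper (\<open>+\<close>) and lower (\<open>-\<close>) fluid; \<open>\<rho>m\<close> is the density
  of the lower fluid at the interface.\<close>

locale compressible_RT =
  fixes g \<sigma> m l :: real
    and Pp Pm \<epsilon>p \<epsilon>m \<delta>p \<delta>m :: "real \<Rightarrow> real"
    and \<rho>m :: real
  assumes g_pos: "g > 0" and sigma_nonneg: "\<sigma> \<ge> 0" and m_pos: "m > 0" and l_pos: "l > 0"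
    and pressure: "pressure_law Pp" "pressure_law Pm"
    and viscosity_smooth:
      "smooth_on {0<..} \<epsilon>p" "smooth_on {0<..} \<epsilon>m" "smooth_on {0<..} \<delta>p" "smooth_on {0<..} \<delta>m"
    and viscosity_sign:
      "\<And>z. z > 0 \<Longrightarrow> \<epsilon>p z > 0" "\<And>z. z > 0 \<Longrightarrow> \<epsilon>m z > 0"
      "\<And>z. z > 0 \<Longrightarrow> \<delta>p z \<ge> 0" "\<And>z. z > 0 \<Longrightarrow> \<delta>m z \<ge> 0"
    and rho_m_in_Z: "\<rho>m \<in> {z. z > 0 \<and> Pm z > Pp z \<and> Pm z \<in> Pp ` {0<..}}"
    and enthalpy_range_m: "enthalpy Pm \<rho>m + g * m \<in> enthalpy Pm ` {0<..}"
    and enthalpy_range_p: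
      "enthalpy Pp (inv_into {0<..} Pp (Pm \<rho>m)) - g * l \<in> enthalpy Pp ` {0<..}"
begin

definition \<rho>p :: real where
  "\<rho>p = inv_into {0<..} Pp (Pm \<rho>m)"

definition jump :: real where
  "jump = \<rho>p - \<rho>m"

text \<open>The value assigned to the steady state at the interface \<open>x = 0\<close> is arbitrary; the
  density enters below only under integrals.\<close>

definition \<rho>0 :: "real \<Rightarrow> real" where
  "\<rho>0 x = (if x < 0 then inv_into {0<..} (enthalpy Pm) (enthalpy Pm \<rho>m - g * x)
           else inv_into {0<..} (enthalpy Pp) (enthalpy Pp \<rho>p - g * x))"

definition at_steady :: "(real \<Rightarrow> real) \<Rightarrow> (real \<Rightarrow> real) \<Rightarrow> real \<Rightarrow> real" where
  "at_steady fp fm x = (if x < 0 then fm (\<rho>0 x) else fp (\<rho>0 x))"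

definition dP0 :: "real \<Rightarrow> real" where "dP0 = at_steady (deriv Pp) (deriv Pm)"
definition \<epsilon>0 :: "real \<Rightarrow> real" where "\<epsilon>0 = at_steady \<epsilon>p \<epsilon>m"
definition \<delta>0 :: "real \<Rightarrow> real" where "\<delta>0 = at_steady \<delta>p \<delta>m"

definition critical_freq :: ereal where
  "critical_freq = (if \<sigma> = 0 then \<infinity> else ereal (sqrt (g * jump / \<sigma>)))"

text \<open>The real parameter \<open>\<xi>\<close> stands for the modulus of the horizontal frequency.\<close>

abbreviation D :: "(real \<Rightarrow> real) \<Rightarrow> real \<Rightarrow> real" where
  "D \<equiv> weak_deriv (- m) l"

definition energy :: "real \<Rightarrow> real \<Rightarrow> (real \<Rightarrow> real) \<Rightarrow> (real \<Rightarrow> real) \<Rightarrow> real" where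
  "energy \<xi> s \<phi> \<psi> =
     \<sigma> * \<xi>\<^sup>2 / 2 * (\<psi> 0)\<^sup>2
     + 1/2 * (LBINT x:{-m<..<l}.
         (s * \<delta>0 x + dP0 x * \<rho>0 x) * (D \<psi> x + \<xi> * \<phi> x)\<^sup>2 - 2 * g * \<rho>0 x * \<xi> * \<phi> x * \<psi> x)
     + 1/2 * (LBINT x:{-m<..<l}.
         s * \<epsilon>0 x * ((D \<phi> x - \<xi> * \<psi> x)\<^sup>2 + (D \<psi> x - \<xi> * \<phi> x)\<^sup>2 + 1/3 * (D \<psi> x + \<xi> * \<phi> x)\<^sup>2))"

definition J :: "(real \<Rightarrow> real) \<Rightarrow> (real \<Rightarrow> real) \<Rightarrow> real" where
  "J \<phi> \<psi> = 1/2 * (LBINT x:{-m<..<l}. \<rho>0 x * ((\<phi> x)\<^sup>2 + (\<psi> x)\<^sup>2))"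

definition admissible :: "((real \<Rightarrow> real) \<times> (real \<Rightarrow> real)) set" where
  "admissible = {(\<phi>, \<psi>). \<phi> \<in> H01 (- m) l \<and> \<psi> \<in> H01 (- m) l \<and> J \<phi> \<psi> = 1}"

definition \<mu> :: "real \<Rightarrow> real \<Rightarrow> real" where
  "\<mu> \<xi> s = (INF (\<phi>, \<psi>)\<in>admissible. energy \<xi> s \<phi> \<psi>)"

definition growth_rate :: "real \<Rightarrow> real" where
  "growth_rate \<xi> = (THE s. s > 0 \<and> \<mu> \<xi> s < 0 \<and> s = sqrt (- \<mu> \<xi> s))"

end

end

theory Submission
  imports Defs
begin

text \<open>
  Split the energy as \<open>E = E\<^sub>0 + s V\<close>, where \<open>V \<ge> 0\<close> is the viscous
  dissipation. Then \<open>\<mu>(\<xi>, s)\<close> is nondecreasing in \<open>s\<close>, so that \<open>\<mu>(\<xi>, s) + s\<^sup>2\<close> is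
  strictly increasing, and the growth rate \<open>\<lambda>(\<xi>)\<close> is its zero. Everything is
  read off from the sign of \<open>\<mu>(\<xi>, s) + s\<^sup>2\<close>: it is negative exactly for \<open>s < \<lambda>(\<xi>)\<close>.

  The zero exists because \<open>E\<^sub>0\<close> takes a negative value below the critical
  frequency. Integrating by parts in each layer and using the hydrostatic balance
  \<open>P'(\<rho>\<^sub>0) \<rho>\<^sub>0' = - g \<rho>\<^sub>0\<close>, gravity becomes a complete square plus a boundary term at the
  interface (\<open>energy_completed_square\<close>):
  \<open>E\<^sub>0 = (\<sigma> \<xi>\<^sup>2 - g [[\<rho>\<^sub>0]]) / 2 \<cdot> \<psi>(0)\<^sup>2 + 1/2 \<integral> P'(\<rho>\<^sub>0) \<rho>\<^sub>0 (\<psi>' + \<xi> \<phi> - g \<psi> / P'(\<rho>\<^sub>0))\<^sup>2\<close>.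
  The first factor is negative precisely for \<open>\<xi> < |\<xi>|\<^sub>c\<close>. Since \<open>E\<^sub>0\<close> contains no
  derivative of \<open>\<phi>\<close>, the square can be made as small as desired by taking \<open>\<phi>\<close> close
  in \<open>L\<^sup>2\<close> to the function that makes it vanish (\<open>negative_energy\<close>).

  Three upper bounds for \<open>\<lambda>\<close> give boundedness and both limits.
  \<^item> \<open>E\<^sub>0 \<ge> - g \<xi> J\<close>, hence \<open>\<lambda>\<^sup>2 \<le> g \<xi>\<close>. This is the limit at zero.
  \<^item> \<open>V \<ge> c \<xi>\<^sup>2 J\<close>, hence \<open>\<lambda> \<le> C / \<xi>\<close>. This is the limit at infinity in the case
    \<open>\<sigma> = 0\<close>, and together with the first bound it bounds \<open>\<lambda>\<close>.
  \<^item> \<open>E\<^sub>0 \<ge> - (g [[\<rho>\<^sub>0]] - \<sigma> \<xi>\<^sup>2) / 2 \<cdot> \<psi>(0)\<^sup>2\<close> by the identity above, while \<open>V\<close> controls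
    \<open>\<psi>(0)\<^sup>2\<close>, hence \<open>\<lambda> \<le> C (g [[\<rho>\<^sub>0]] - \<sigma> \<xi>\<^sup>2)\<close>. This is the limit at a finite \<open>|\<xi>|\<^sub>c\<close>.

  The estimates for \<open>V\<close> rest on \<open>dissipation_coercive\<close>: \<open>V\<close> dominates the full norm
  of \<open>H\<^sup>1\<close>. By the same coercivity, moving the frequency by \<open>h\<close> raises the energy by at
  most \<open>h (A E + B)\<close>, uniformly over all competitors (\<open>energy_frequency_comparison\<close>), and
  this gives continuity.

  The space of competitors is the closure of the test functions. Integration by parts
  is therefore done for test functions and carried over by convergence in \<open>L\<^sup>2\<close> of
  the functions and their derivatives, which also forces convergence at the
  interface. Two facts about test functions are needed besides: they are dense in
  \<open>L\<^sup>2\<close>, and weak derivatives are unique up to null sets.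
\<close>

section \<open>Smooth compactly supported functions\<close>

text \<open>The powers in the denominator make the family closed under differentiation up to
  linear combinations; \<open>flat 0\<close> is the classical smooth function that is flat at zero.\<close>

definition flat :: "nat \<Rightarrow> real \<Rightarrow> real" where
  "flat k t = (if t > 0 then exp (- (1 / t)) / t ^ k else 0)"

lemma flat_le_0 [simp]: "t \<le> 0 \<Longrightarrow> flat k t = 0"
  by (simp add: flat_def)

lemma flat_0_bounds: "0 \<le> flat 0 t" "flat 0 t \<le> 1"
  by (auto simp: flat_def)

lemma flat_div_tendsto_0: "((\<lambda>h. flat k h / h) \<longlongrightarrow> 0) (at 0)"
proof -
  have "((\<lambda>t::real. inverse t ^ Suc k / exp (inverse t)) \<longlongrightarrow> 0) (at_right 0)"
    by (rule filterlim_compose[OF tendsto_power_div_exp_0 filterlim_inverse_at_top_right])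
  moreover have "eventually (\<lambda>t::real. inverse t ^ Suc k / exp (inverse t) = flat k t / t) (at_right 0)"
    by (auto simp: eventually_at_filter flat_def exp_minus field_simps power_inverse intro!: always_eventually)
  ultimately have r: "((\<lambda>h. flat k h / h) \<longlongrightarrow> 0) (at_right 0)"
    by (rule Lim_transform_eventually)
  have "eventually (\<lambda>t::real. 0 = flat k t / t) (at_left 0)"
    by (auto simp: eventually_at_filter)
  then have "((\<lambda>h. flat k h / h) \<longlongrightarrow> 0) (at_left 0)"
    by (rule Lim_transform_eventually[OF tendsto_const])
  with r show ?thesis
    by (simp add: filterlim_split_at)
qed

lemma flat_has_derivative:
  "(flat k has_real_derivative flat (k + 2) t - real k * flat (k + 1) t) (at t)"
proof -
  consider "t > 0" | "t < 0" | "t = 0" by linarith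
  then show ?thesis
  proof cases
    case 1
    have "((\<lambda>t. exp (- (1 / t)) / t ^ k) has_real_derivative
            flat (k + 2) t - real k * flat (k + 1) t) (at t)"
    proof (cases k)
      case 0
      then show ?thesis using 1
        by (auto intro!: derivative_eq_intros simp: flat_def power2_eq_square)
    next
      case (Suc j)
      then show ?thesis using 1 power_eq_if[of t j]
        by (auto intro!: derivative_eq_intros simp: flat_def power2_eq_square field_simps split: if_splits)
    qed
    then show ?thesis
      by (rule has_field_derivative_transform_within_open[where S = "{0<..}"])
         (use 1 in \<open>auto simp: flat_def\<close>)
  next
    case 2
    have "((\<lambda>t. 0) has_real_derivative flat (k + 2) t - real k * flat (k + 1) t) (at t)"
      using 2 by simp
    then show ?thesis
      by (rule has_field_derivative_transform_within_open[where S = "{..<0}"])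
         (use 2 in auto)
  next
    case 3
    then show ?thesis
      using flat_div_tendsto_0[of k] by (simp add: has_field_derivative_iff)
  qed
qed

text \<open>For a polynomial \<open>q\<close>, this set is closed under differentiation. That is the whole
  smoothness argument: no formula for iterated derivatives is needed.\<close>

inductive_set flat_span :: "(real \<Rightarrow> real) \<Rightarrow> (real \<Rightarrow> real) set" for q where
  base: "real_polynomial_function r \<Longrightarrow> (\<lambda>x. r x * flat k (q x)) \<in> flat_span q"
| add: "f \<in> flat_span q \<Longrightarrow> f' \<in> flat_span q \<Longrightarrow> (\<lambda>x. f x + f' x) \<in> flat_span q"

lemma flat_span_has_derivative:
  assumes "f \<in> flat_span q" and q: "real_polynomial_function q"
  shows "\<exists>f'\<in>flat_span q. \<forall>x. (f has_real_derivative f' x) (at x)"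
  using assms(1)
proof induction
  case (base r k)
  obtain r' where r': "real_polynomial_function r'" "\<And>x. (r has_real_derivative r' x) (at x)"
    using has_real_derivative_polynomial_function[OF base] by blast
  obtain q' where q': "real_polynomial_function q'" "\<And>x. (q has_real_derivative q' x) (at x)"
    using has_real_derivative_polynomial_function[OF q] by blast
  let ?f' = "\<lambda>x. r' x * flat k (q x) +
    ((r x * q' x) * flat (k + 2) (q x) + (- real k * (r x * q' x)) * flat (k + 1) (q x))"
  have "?f' \<in> flat_span q"
    by (intro flat_span.intros real_polynomial_function.intros r' q' base)
  moreover have "((\<lambda>x. r x * flat k (q x)) has_real_derivative ?f' x) (at x)" for x
    by (rule derivative_eq_intros r' DERIV_chain'[OF q'(2) flat_has_derivative])+
       (simp add: algebra_simps)
  ultimately show ?case by (intro bexI[where x = ?f'] allI)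
next
  case (add f g)
  then obtain f' g' where "f' \<in> flat_span q" "\<And>x. (f has_real_derivative f' x) (at x)"
    "g' \<in> flat_span q" "\<And>x. (g has_real_derivative g' x) (at x)" by blast
  then show ?case
    by (intro bexI[where x = "\<lambda>x. f' x + g' x"]) (auto intro: flat_span.add DERIV_add)
qed

lemma flat_span_smooth:
  assumes "f \<in> flat_span q" "real_polynomial_function q"
  shows "smooth_on UNIV f"
proof -
  have deriv: "deriv h \<in> flat_span q" "h differentiable (at x)" if "h \<in> flat_span q" for h x
  proof -
    obtain h' where h': "h' \<in> flat_span q" "\<And>x. (h has_real_derivative h' x) (at x)"
      using flat_span_has_derivative[OF \<open>h \<in> flat_span q\<close> assms(2)] by blast
    moreover have "deriv h = h'" using h' by (auto intro: DERIV_imp_deriv)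
    ultimately show "deriv h \<in> flat_span q" "h differentiable (at x)"
      by (auto simp: real_differentiable_def)
  qed
  have "(deriv ^^ n) f \<in> flat_span q" for n
    by (induction n) (auto intro: deriv assms)
  then show ?thesis unfolding smooth_on_def by (auto intro: deriv)
qed

lemma smooth_on_UNIV_D:
  assumes "smooth_on UNIV f"
  shows "(f has_real_derivative deriv f x) (at x)" "isCont f x" "isCont (deriv f) x"
proof -
  have "f differentiable (at x)" for x using assms unfolding smooth_on_def
    by (metis UNIV_I funpow_0)
  then show "(f has_real_derivative deriv f x) (at x)" "isCont f x"
    by (auto simp: DERIV_deriv_iff_real_differentiable differentiable_imp_continuous_within)
  have "deriv f differentiable (at x)" using assms unfolding smooth_on_def
    by (metis UNIV_I funpow_0 funpow_simps_right(2) comp_apply)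
  then show "isCont (deriv f) x" by (simp add: differentiable_imp_continuous_within)
qed

lemma smooth_on_UNIV_lincomb:
  assumes "smooth_on UNIV f" "smooth_on UNIV h"
  shows "smooth_on UNIV (\<lambda>x. \<alpha> * f x + \<beta> * h x)"
proof -
  have D: "((deriv ^^ n) f has_real_derivative (deriv ^^ Suc n) f x) (at x)"
    if "smooth_on UNIV f" for n f x
    using that by (simp add: DERIV_deriv_iff_real_differentiable smooth_on_def)
  have "(deriv ^^ n) (\<lambda>x. \<alpha> * f x + \<beta> * h x) = (\<lambda>x. \<alpha> * (deriv ^^ n) f x + \<beta> * (deriv ^^ n) h x)" for n
  proof (induction n)
    case (Suc n)
    have "deriv (\<lambda>x. \<alpha> * (deriv ^^ n) f x + \<beta> * (deriv ^^ n) h x) x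
        = \<alpha> * (deriv ^^ Suc n) f x + \<beta> * (deriv ^^ Suc n) h x" for x
      by (intro DERIV_imp_deriv) (rule derivative_eq_intros D assms | simp)+
    then show ?case using Suc by auto
  qed simp
  then show ?thesis using assms unfolding smooth_on_def by (auto intro!: derivative_intros)
qed

text \<open>The argument of \<open>flat 0\<close> is nonnegative only where \<open>(x - c) (d - x) \<ge> 1 / n\<close>. These are
  compact subsets of \<open>{c<..<d}\<close> that exhaust it as \<open>n\<close> grows, and the values there
  increase to 1. Being a composition with a polynomial, a bump stays in a \<open>flat_span\<close>
  when it is multiplied by a polynomial.\<close>

definition bump :: "real \<Rightarrow> real \<Rightarrow> nat \<Rightarrow> real \<Rightarrow> real" where
  "bump c d n x = flat 0 (real n * ((x - c) * (d - x)) - 1)"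

lemma bump_bounds: "0 \<le> bump c d n x" "bump c d n x \<le> 1"
  by (simp_all add: bump_def flat_0_bounds)

lemma bump_eq_0:
  assumes "c \<le> d" "x \<le> c \<or> d \<le> x" shows "bump c d n x = 0"
proof -
  have "(x - c) * (d - x) \<le> 0" using assms by (auto simp: mult_le_0_iff)
  then have "real n * ((x - c) * (d - x)) \<le> 0" by (simp add: mult_nonneg_nonpos)
  then show ?thesis by (simp add: bump_def)
qed

lemma continuous_bump: "continuous_on A (bump c d n)"
proof -
  have "continuous_on UNIV (flat 0)"
    using flat_has_derivative DERIV_isCont continuous_at_imp_continuous_on by blast
  then show ?thesis unfolding bump_def
    by (rule continuous_on_compose2) (auto intro!: continuous_intros)
qed

lemma bump_tendsto_1:
  assumes "c < x" "x < d" shows "(\<lambda>n. bump c d n x) \<longlonglongrightarrow> 1"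
proof -
  let ?q = "\<lambda>n::nat. real n * ((x - c) * (d - x)) - 1"
  have "filterlim (\<lambda>n. real n * ((x - c) * (d - x))) at_top sequentially"
    using assms filterlim_at_top_mult_tendsto_pos[OF tendsto_const _ filterlim_real_sequentially, of "(x - c) * (d - x)"]
    by simp
  then have q: "filterlim ?q at_top sequentially"
    using filterlim_tendsto_add_at_top[OF tendsto_const[of "- 1"], of "\<lambda>n. real n * ((x - c) * (d - x))"] by simp
  have "(\<lambda>n. exp (- inverse (?q n))) \<longlonglongrightarrow> exp (- 0)"
    by (intro tendsto_intros tendsto_inverse_0_at_top q)
  moreover have "eventually (\<lambda>n. exp (- inverse (?q n)) = bump c d n x) sequentially"
    using eventually_gt_at_top[of 0] q
    by (auto simp: bump_def flat_def filterlim_at_top_dense inverse_eq_divide elim!: eventually_mono dest!: spec[of _ 0])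
  ultimately show ?thesis by (simp add: Lim_transform_eventually)
qed

lemma test_function_bump:
  assumes "a \<le> c" "c < d" "d \<le> b" "real_polynomial_function r"
  shows "test_function a b (\<lambda>x. r x * bump c d n x)"
proof -
  let ?q = "\<lambda>x. real n * ((x - c) * (d - x)) - 1"
  have q: "real_polynomial_function ?q"
    by (intro real_polynomial_function_diff real_polynomial_function.intros bounded_linear_ident)
  have smooth: "smooth_on UNIV (\<lambda>x. r x * bump c d n x)"
    unfolding bump_def by (rule flat_span_smooth[OF flat_span.base q]) fact
  let ?K = "{c..d} \<inter> ?q -` {0..}"
  have "closed (?q -` {0..})"
    by (intro closed_vimage closed_atLeast continuous_intros)
  then have "compact ?K" by (intro compact_Int_closed) auto
  moreover have "?K \<subseteq> {a<..<b}"
  proof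
    fix x assume x: "x \<in> ?K"
    then have "x \<noteq> c \<and> x \<noteq> d" by auto
    then show "x \<in> {a<..<b}" using x assms by auto
  qed
  moreover have "r x * bump c d n x = 0" if "x \<notin> ?K" for x
  proof (cases "x \<in> {c..d}")
    case False
    then show ?thesis using bump_eq_0[of c d x n] assms by auto
  qed (use that in \<open>auto simp: bump_def\<close>)
  ultimately show ?thesis using smooth unfolding test_function_def by blast
qed

lemma test_function_lincomb:
  assumes "test_function a b f" "test_function a b h"
  shows "test_function a b (\<lambda>x. \<alpha> * f x + \<beta> * h x)"
proof -
  obtain K L where "compact K" "K \<subseteq> {a<..<b}" "\<forall>x. x \<notin> K \<longrightarrow> f x = 0"
    "compact L" "L \<subseteq> {a<..<b}" "\<forall>x. x \<notin> L \<longrightarrow> h x = 0"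
    using assms unfolding test_function_def by blast
  then have "compact (K \<union> L)" "K \<union> L \<subseteq> {a<..<b}"
    "\<forall>x. x \<notin> K \<union> L \<longrightarrow> \<alpha> * f x + \<beta> * h x = 0" by auto
  then show ?thesis
    using assms smooth_on_UNIV_lincomb unfolding test_function_def by blast
qed

lemma test_functionD:
  assumes "test_function a b \<eta>"
  shows "(\<eta> has_real_derivative deriv \<eta> x) (at x)" "isCont \<eta> x" "isCont (deriv \<eta>) x"
    "x \<le> a \<or> b \<le> x \<Longrightarrow> \<eta> x = 0"
  using assms smooth_on_UNIV_D[of \<eta> x] unfolding test_function_def by (auto simp: subset_iff) 


section \<open>Square-integrable functions\<close>

definition L2 :: "'a measure \<Rightarrow> ('a \<Rightarrow> real) \<Rightarrow> bool" where
  "L2 M f \<longleftrightarrow> f \<in> borel_measurable M \<and> integrable M (\<lambda>x. (f x)\<^sup>2)"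

lemma L2_integrable_square: "L2 M f \<Longrightarrow> integrable M (\<lambda>x. (f x)\<^sup>2)"
  by (simp add: L2_def)

lemma L2_integrable_mult:
  assumes "L2 M f" "L2 M h" shows "integrable M (\<lambda>x. f x * h x)"
proof (rule Bochner_Integration.integrable_bound)
  show "integrable M (\<lambda>x. (f x)\<^sup>2 + (h x)\<^sup>2)"
    using assms by (simp add: L2_def)
  show "(\<lambda>x. f x * h x) \<in> borel_measurable M"
    using assms by (auto simp: L2_def)
  have "\<bar>x * y\<bar> \<le> x\<^sup>2 + y\<^sup>2" for x y :: real
    using sum_squares_bound[of "\<bar>x\<bar>" "\<bar>y\<bar>"] mult_nonneg_nonneg[of "\<bar>x\<bar>" "\<bar>y\<bar>"]
    unfolding abs_mult power2_abs by linarith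
  then show "AE x in M. norm (f x * h x) \<le> norm ((f x)\<^sup>2 + (h x)\<^sup>2)"
    by simp
qed

lemma L2_add:
  assumes "L2 M f" "L2 M h" shows "L2 M (\<lambda>x. f x + h x)"
  using assms L2_integrable_mult[OF assms]
  by (auto simp: L2_def power2_sum mult.assoc)

lemma L2_mult_bounded:
  assumes "L2 M f" "w \<in> borel_measurable M" "\<And>x. x \<in> space M \<Longrightarrow> \<bar>w x\<bar> \<le> C"
  shows "L2 M (\<lambda>x. w x * f x)"
  unfolding L2_def
proof
  show "(\<lambda>x. w x * f x) \<in> borel_measurable M"
    using assms by (auto simp: L2_def)
  show "integrable M (\<lambda>x. (w x * f x)\<^sup>2)"
  proof (rule Bochner_Integration.integrable_bound)
    show "integrable M (\<lambda>x. C\<^sup>2 * (f x)\<^sup>2)" using assms by (simp add: L2_def)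
    show "(\<lambda>x. (w x * f x)\<^sup>2) \<in> borel_measurable M" using assms by (auto simp: L2_def)
    have "(w x)\<^sup>2 \<le> C\<^sup>2" if "x \<in> space M" for x
      using power_mono[OF assms(3)[OF that], of 2] by simp
    then show "AE x in M. norm ((w x * f x)\<^sup>2) \<le> norm (C\<^sup>2 * (f x)\<^sup>2)"
      by (auto simp: power_mult_distrib intro!: AE_I2 mult_right_mono)
  qed
qed

lemma L2_cmult: "L2 M f \<Longrightarrow> L2 M (\<lambda>x. c * f x)"
  by (rule L2_mult_bounded) auto

lemma L2_diff:
  assumes "L2 M f" "L2 M h" shows "L2 M (\<lambda>x. f x - h x)"
  using L2_add[OF assms(1) L2_cmult[OF assms(2), of "- 1"]] by simp

lemma (in finite_measure) L2_bounded:
  assumes "f \<in> borel_measurable M" "\<And>x. x \<in> space M \<Longrightarrow> \<bar>f x\<bar> \<le> C"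
  shows "L2 M f"
  using L2_mult_bounded[of M "\<lambda>_. 1" f C] assms by (simp add: L2_def)

lemma (in finite_measure) L2_integrable:
  assumes "L2 M f" shows "integrable M f"
  using L2_integrable_mult[OF assms L2_bounded[of "\<lambda>_. 1" 1]] by simp

text \<open>The polynomial \<open>t \<mapsto> \<integral> (f - t h)\<^sup>2\<close> is nonnegative. If its leading coefficient
  vanishes then so does the linear one; otherwise its value at the minimum is the claim.\<close>

lemma Cauchy_Schwarz_L2:
  assumes "L2 M f" "L2 M h"
  shows "(\<integral>x. f x * h x \<partial>M)\<^sup>2 \<le> (\<integral>x. (f x)\<^sup>2 \<partial>M) * (\<integral>x. (h x)\<^sup>2 \<partial>M)"
proof -
  define F G P where "F = (\<integral>x. (f x)\<^sup>2 \<partial>M)" and "G = (\<integral>x. (h x)\<^sup>2 \<partial>M)"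
    and "P = (\<integral>x. f x * h x \<partial>M)"
  have q: "0 \<le> F - 2 * t * P + t\<^sup>2 * G" for t
  proof -
    have "0 \<le> (\<integral>x. (f x - t * h x)\<^sup>2 \<partial>M)" by simp
    also have "\<dots> = (\<integral>x. (f x)\<^sup>2 - 2 * t * (f x * h x) + t\<^sup>2 * (h x)\<^sup>2 \<partial>M)"
      by (intro Bochner_Integration.integral_cong) (auto simp: power2_diff power_mult_distrib)
    also have "\<dots> = F - 2 * t * P + t\<^sup>2 * G"
      using assms L2_integrable_mult[OF assms] unfolding F_def G_def P_def
      by (simp add: L2_def)
    finally show ?thesis .
  qed
  have "G \<ge> 0" by (simp add: G_def)
  have "P\<^sup>2 \<le> F * G"
  proof (cases "G = 0")
    case True
    have "P = 0"
    proof (rule ccontr)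
      assume "P \<noteq> 0"
      \<comment> \<open>At this value of \<open>t\<close> the polynomial, now affine, equals \<open>- 1\<close>.\<close>
      then show False using q[of "(F + 1) / (2 * P)"] True by simp
    qed
    with True show ?thesis by simp
  next
    case False
    then have "G > 0" using \<open>G \<ge> 0\<close> by simp
    have "0 \<le> F - 2 * (P / G) * P + (P / G)\<^sup>2 * G" by (rule q)
    also have "\<dots> = F - P\<^sup>2 / G" using \<open>G > 0\<close> by (simp add: field_simps power2_eq_square)
    finally show ?thesis using \<open>G > 0\<close> by (simp add: field_simps)
  qed
  then show ?thesis by (simp add: F_def G_def P_def)
qed

definition L2_tendsto :: "'a measure \<Rightarrow> (nat \<Rightarrow> 'a \<Rightarrow> real) \<Rightarrow> ('a \<Rightarrow> real) \<Rightarrow> bool" where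
  "L2_tendsto M u v \<longleftrightarrow> (\<forall>n. L2 M (u n)) \<and> L2 M v \<and> (\<lambda>n. \<integral>x. (u n x - v x)\<^sup>2 \<partial>M) \<longlonglongrightarrow> 0"

lemma L2_tendsto_const: "L2 M v \<Longrightarrow> L2_tendsto M (\<lambda>_. v) v"
  by (simp add: L2_tendsto_def)

lemma L2_tendsto_mult_bounded:
  assumes "L2_tendsto M u v" "w \<in> borel_measurable M" "\<And>x. x \<in> space M \<Longrightarrow> \<bar>w x\<bar> \<le> C"
  shows "L2_tendsto M (\<lambda>n x. w x * u n x) (\<lambda>x. w x * v x)"
  unfolding L2_tendsto_def
proof (intro conjI allI)
  note L2 = assms(1)[unfolded L2_tendsto_def]
  show wL2: "L2 M (\<lambda>x. w x * u n x)" "L2 M (\<lambda>x. w x * v x)" for n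
    using L2 L2_mult_bounded[OF _ assms(2,3)] by auto
  have le: "(\<integral>x. (w x * u n x - w x * v x)\<^sup>2 \<partial>M) \<le> C\<^sup>2 * (\<integral>x. (u n x - v x)\<^sup>2 \<partial>M)" for n
  proof -
    have "(\<integral>x. (w x * u n x - w x * v x)\<^sup>2 \<partial>M) \<le> (\<integral>x. C\<^sup>2 * (u n x - v x)\<^sup>2 \<partial>M)"
    proof (rule integral_mono)
      show "integrable M (\<lambda>x. (w x * u n x - w x * v x)\<^sup>2)"
        by (intro L2_integrable_square L2_diff wL2)
      show "integrable M (\<lambda>x. C\<^sup>2 * (u n x - v x)\<^sup>2)"
        using L2_diff L2 by (auto simp: L2_def)
      fix x assume x: "x \<in> space M"
      have "(w x)\<^sup>2 \<le> C\<^sup>2"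
        using power_mono[OF assms(3)[OF x], of 2] by simp
      then show "(w x * u n x - w x * v x)\<^sup>2 \<le> C\<^sup>2 * (u n x - v x)\<^sup>2"
        by (simp add: right_diff_distrib[symmetric] power_mult_distrib mult_right_mono)
    qed
    then show ?thesis by simp
  qed
  have nonneg: "0 \<le> (\<integral>x. (w x * u n x - w x * v x)\<^sup>2 \<partial>M)" for n
    by (rule Bochner_Integration.integral_nonneg) simp
  have "(\<lambda>n. C\<^sup>2 * (\<integral>x. (u n x - v x)\<^sup>2 \<partial>M)) \<longlonglongrightarrow> 0"
    using L2 by (intro tendsto_mult_right_zero) blast
  then show "(\<lambda>n. \<integral>x. (w x * u n x - w x * v x)\<^sup>2 \<partial>M) \<longlonglongrightarrow> 0"
    by (rule Lim_null_comparison[rotated])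
       (simp only: real_norm_def abs_of_nonneg[OF nonneg] le eventually_True)
qed

text \<open>The difference of the products is \<open>(u - u') (v - v') + u' (v - v') + (u - u') v'\<close>, and
  Cauchy-Schwarz controls each term by factors that tend to zero.\<close>

lemma L2_tendsto_inner:
  assumes "L2_tendsto M u u'" "L2_tendsto M v v'"
  shows "(\<lambda>n. \<integral>x. u n x * v n x \<partial>M) \<longlonglongrightarrow> (\<integral>x. u' x * v' x \<partial>M)"
proof -
  note A = assms[unfolded L2_tendsto_def]
  define a where "a n = (\<integral>x. (u n x - u' x)\<^sup>2 \<partial>M)" for n
  define b where "b n = (\<integral>x. (v n x - v' x)\<^sup>2 \<partial>M)" for n
  define p where "p = (\<integral>x. (u' x)\<^sup>2 \<partial>M)"
  define q where "q = (\<integral>x. (v' x)\<^sup>2 \<partial>M)"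
  have CS: "\<bar>\<integral>x. f x * h x \<partial>M\<bar> \<le> sqrt (\<integral>x. (f x)\<^sup>2 \<partial>M) * sqrt (\<integral>x. (h x)\<^sup>2 \<partial>M)"
    if "L2 M f" "L2 M h" for f h
    using Cauchy_Schwarz_L2[OF that] real_sqrt_le_mono by (fastforce simp: real_sqrt_mult)
  have "\<bar>(\<integral>x. u n x * v n x \<partial>M) - (\<integral>x. u' x * v' x \<partial>M)\<bar>
      \<le> sqrt (a n) * sqrt (b n) + sqrt p * sqrt (b n) + sqrt (a n) * sqrt q" for n
  proof -
    have L: "L2 M (u n)" "L2 M (v n)" "L2 M u'" "L2 M v'" using A by auto
    note L' = L L2_diff[OF L(1,3)] L2_diff[OF L(2,4)]
    have "(\<integral>x. u n x * v n x \<partial>M) - (\<integral>x. u' x * v' x \<partial>M)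
       = (\<integral>x. u n x * v n x - u' x * v' x \<partial>M)"
      by (intro Bochner_Integration.integral_diff[symmetric] L2_integrable_mult L)
    also have "\<dots> = (\<integral>x. (u n x - u' x) * (v n x - v' x) + u' x * (v n x - v' x)
          + (u n x - u' x) * v' x \<partial>M)"
      by (intro Bochner_Integration.integral_cong) (auto simp: algebra_simps)
    also have "\<dots> = (\<integral>x. (u n x - u' x) * (v n x - v' x) \<partial>M) + (\<integral>x. u' x * (v n x - v' x) \<partial>M)
          + (\<integral>x. (u n x - u' x) * v' x \<partial>M)"
      using L2_integrable_mult[OF L'(5,6)] L2_integrable_mult[OF L'(3,6)] L2_integrable_mult[OF L'(5,4)]
      by simp
    finally show ?thesis
      using CS[OF L'(5,6)] CS[OF L'(3,6)] CS[OF L'(5,4)] by (simp add: a_def b_def p_def q_def)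
  qed
  note bound = this
  have "a \<longlonglongrightarrow> 0" "b \<longlonglongrightarrow> 0" using A unfolding a_def b_def by auto
  then have ab: "(\<lambda>n. sqrt (a n)) \<longlonglongrightarrow> 0" "(\<lambda>n. sqrt (b n)) \<longlonglongrightarrow> 0"
    using tendsto_real_sqrt[of a 0 sequentially] tendsto_real_sqrt[of b 0 sequentially] by simp_all
  have "(\<lambda>n. sqrt (a n) * sqrt (b n) + sqrt p * sqrt (b n) + sqrt (a n) * sqrt q) \<longlonglongrightarrow> 0"
    by (intro tendsto_add_zero tendsto_mult_zero tendsto_mult_left_zero tendsto_mult_right_zero ab)
  then have "(\<lambda>n. (\<integral>x. u n x * v n x \<partial>M) - (\<integral>x. u' x * v' x \<partial>M)) \<longlonglongrightarrow> 0"
    by (rule Lim_null_comparison[rotated]) (simp add: bound)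
  then show ?thesis by (simp add: LIM_zero_iff)
qed

section \<open>Lebesgue measure on an open interval\<close>

text \<open>A measure of its own, rather than integrals over a set, makes the calculus of square
  integrable functions available on the interval.\<close>

definition ivl :: "real \<Rightarrow> real \<Rightarrow> real measure" where
  "ivl a b = restrict_space lborel {a<..<b}"

lemma space_ivl [simp]: "space (ivl a b) = {a<..<b}"
  by (simp add: ivl_def space_restrict_space)

lemma finite_measure_ivl: "finite_measure (ivl a b)"
proof (rule finite_measureI)
  have "emeasure (ivl a b) (space (ivl a b)) = emeasure lborel {a<..<b}"
    unfolding space_ivl unfolding ivl_def by (subst emeasure_restrict_space) simp_all
  then show "emeasure (ivl a b) (space (ivl a b)) \<noteq> \<infinity>"
    using emeasure_lborel_Ioo[of a b] by (cases "a \<le> b") auto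
qed

lemma measurable_ivl: "f \<in> borel_measurable borel \<Longrightarrow> f \<in> borel_measurable (ivl a b)"
  unfolding ivl_def by (rule measurable_restrict_space1) simp

lemma borel_measurable_ivl_continuous:
  "continuous_on {a<..<b} f \<Longrightarrow> f \<in> borel_measurable (ivl a b)" for f :: "real \<Rightarrow> real"
proof -
  assume "continuous_on {a<..<b} f"
  then have "f \<in> borel_measurable (restrict_space borel {a<..<b})"
    by (rule borel_measurable_continuous_on_restrict)
  moreover have "sets (ivl a b) = sets (restrict_space borel {a<..<b})"
    by (simp add: ivl_def sets_restrict_space)
  ultimately show ?thesis using measurable_cong_sets by blast
qed

lemma set_integral_ivl: "(LBINT x:{a<..<b}. f x) = (\<integral>x. f x \<partial>ivl a b)" for f :: "real \<Rightarrow> real"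
  unfolding ivl_def set_lebesgue_integral_def by (subst integral_restrict_space) simp_all

lemma square_integrable_ivl: "square_integrable a b f \<longleftrightarrow> L2 (ivl a b) f"
proof -
  have "{a<..<b} \<inter> space lborel \<in> sets lborel" by simp
  then show ?thesis
    unfolding square_integrable_def L2_def ivl_def set_borel_measurable_def set_integrable_def
    by (simp only: integrable_restrict_space borel_measurable_restrict_space_iff)
qed

lemma AE_ivl: "(AE x in ivl a b. P x) \<longleftrightarrow> (AE x in lborel. x \<in> {a<..<b} \<longrightarrow> P x)"
  unfolding ivl_def by (subst AE_restrict_space_iff) auto

lemma AE_ivl_neq: "AE x in ivl a b. x \<noteq> c"
  unfolding AE_ivl using AE_lborel_singleton[of c] by (rule eventually_mono) simp

lemma L2_ivl_bounded:
  "f \<in> borel_measurable (ivl a b) \<Longrightarrow> (\<And>x. a < x \<Longrightarrow> x < b \<Longrightarrow> \<bar>f x\<bar> \<le> C) \<Longrightarrow> L2 (ivl a b) f"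
  by (rule finite_measure.L2_bounded[OF finite_measure_ivl, where C = C]) simp_all

lemma L2_ivl_continuous:
  fixes f :: "real \<Rightarrow> real"
  assumes "continuous_on {a..b} f" shows "L2 (ivl a b) f"
proof -
  have "bounded (f ` {a..b})" 
    using assms by (intro compact_imp_bounded compact_continuous_image) auto
  then obtain C where "\<forall>x\<in>{a..b}. \<bar>f x\<bar> \<le> C" by (auto simp: bounded_iff)
  then show ?thesis
    by (intro L2_ivl_bounded[where C = C] borel_measurable_ivl_continuous continuous_on_subset[OF assms]) auto
qed

lemma L2_ivl_integrable: "L2 (ivl a b) f \<Longrightarrow> integrable (ivl a b) f"
  by (rule finite_measure.L2_integrable[OF finite_measure_ivl])

lemma integral_ivl_HK:
  fixes f :: "real \<Rightarrow> real"
  assumes "integrable (ivl a b) f"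
  shows "f integrable_on {a..b}" "(\<integral>x. f x \<partial>ivl a b) = integral {a..b} f"
proof -
  have "set_integrable lborel {a<..<b} f"
    using assms by (simp add: ivl_def integrable_restrict_space set_integrable_def)
  note this' = set_borel_integral_eq_integral[OF this]
  then show "f integrable_on {a..b}" by (simp add: integrable_on_Icc_iff_Ioo)
  show "(\<integral>x. f x \<partial>ivl a b) = integral {a..b} f"
    using this'(2) by (simp add: set_integral_ivl integral_open_interval_real)
qed

text \<open>Differentiability is required only in the interior: the steady density is merely
  continuous at the ends of each layer.\<close>

lemma integral_ivl_FTC:
  fixes F f :: "real \<Rightarrow> real"
  assumes "a \<le> b" "continuous_on {a..b} F" "integrable (ivl a b) f"
    and "\<And>x. a < x \<Longrightarrow> x < b \<Longrightarrow> (F has_real_derivative f x) (at x)"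
  shows "(\<integral>x. f x \<partial>ivl a b) = F b - F a"
proof -
  have "(f has_integral (F b - F a)) {a..b}"
    using assms by (intro fundamental_theorem_of_calculus_interior)
      (auto simp: has_real_derivative_iff_has_vector_derivative)
  then show ?thesis by (simp add: integral_ivl_HK(2)[OF assms(3)] integral_unique)
qed

lemma ivl_subinterval:
  assumes "a \<le> c" "d \<le> b"
  shows "ivl c d = restrict_space (ivl a b) {c<..<d}" "{c<..<d} \<in> sets (ivl a b)"
proof -
  have "{a<..<b} \<inter> {c<..<d} = {c<..<d}" using assms by auto
  then show "ivl c d = restrict_space (ivl a b) {c<..<d}"
    by (simp add: ivl_def restrict_restrict_space)
  show "{c<..<d} \<in> sets (ivl a b)"
    using assms by (auto simp: ivl_def sets_restrict_space_iff)
qed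

lemma integrable_ivl_subinterval:
  fixes f :: "real \<Rightarrow> real"
  assumes "integrable (ivl a b) f" "a \<le> c" "d \<le> b"
  shows "integrable (ivl c d) f"
proof -
  note S = ivl_subinterval[OF assms(2,3)]
  have S': "{c<..<d} \<inter> space (ivl a b) \<in> sets (ivl a b)"
    using S(2) by (simp del: space_ivl)
  show ?thesis
    unfolding S(1) integrable_restrict_space[OF S']
    by (rule integrable_mult_indicator[OF S(2) assms(1)])
qed

lemma L2_ivl_subinterval:
  assumes "L2 (ivl a b) f" "a \<le> c" "d \<le> b"
  shows "L2 (ivl c d) f"
proof -
  have "f \<in> borel_measurable (ivl c d)"
    unfolding ivl_subinterval(1)[OF assms(2,3)] using assms(1)
    by (auto simp: L2_def intro: measurable_restrict_space1)
  moreover have "integrable (ivl c d) (\<lambda>x. (f x)\<^sup>2)"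
    using integrable_ivl_subinterval[OF L2_integrable_square[OF assms(1)] assms(2,3)] .
  ultimately show ?thesis by (simp add: L2_def)
qed

lemma integral_ivl_split:
  fixes f :: "real \<Rightarrow> real"
  assumes "integrable (ivl a b) f" "a \<le> c" "c \<le> b"
  shows "(\<integral>x. f x \<partial>ivl a b) = (\<integral>x. f x \<partial>ivl a c) + (\<integral>x. f x \<partial>ivl c b)"
  using Henstock_Kurzweil_Integration.integral_combine[OF assms(2,3) integral_ivl_HK(1)[OF assms(1)]]
  by (simp add: integral_ivl_HK(2)[OF assms(1)] integral_ivl_HK(2)[OF integrable_ivl_subinterval[OF assms(1)]] assms)

lemma integral_ivl_indicator:
  fixes f :: "real \<Rightarrow> real"
  assumes "a \<le> c" "d \<le> b"
  shows "(\<integral>x. indicator {c<..<d} x * f x \<partial>ivl a b) = (\<integral>x. f x \<partial>ivl c d)"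
proof -
  note S = ivl_subinterval[OF assms]
  have S': "{c<..<d} \<inter> space (ivl a b) \<in> sets (ivl a b)"
    using S(2) by (simp del: space_ivl)
  show ?thesis unfolding S(1) integral_restrict_space[OF S'] by simp
qed


section \<open>Density of test functions and uniqueness of weak derivatives\<close>

text \<open>The sets over which the extension of \<open>f\<close> by zero has vanishing integral contain the open
  intervals and are closed under complements and disjoint countable unions, so they
  include all Borel sets.\<close>

lemma AE_zero_ivl:
  fixes f :: "real \<Rightarrow> real"
  assumes int: "integrable (ivl a b) f"
    and zero: "\<And>c d. a \<le> c \<Longrightarrow> c < d \<Longrightarrow> d \<le> b \<Longrightarrow> (\<integral>x. f x \<partial>ivl c d) = 0"
  shows "AE x in ivl a b. f x = 0"
proof -
  define h where "h x = indicator {a<..<b} x * f x" for x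
  have int_h: "integrable lborel h"
    using int unfolding h_def ivl_def by (subst (asm) integrable_restrict_space) simp_all
  have box: "(LINT x:{c<..<d}|lborel. h x) = 0" for c d
  proof -
    have "(LINT x:{c<..<d}|lborel. h x) = (LINT x:{max a c<..<min b d}|lborel. f x)"
      unfolding set_lebesgue_integral_def h_def
      by (intro Bochner_Integration.integral_cong) (auto simp: indicator_def)
    also have "\<dots> = 0"
    proof (cases "max a c < min b d")
      case True
      then show ?thesis unfolding set_integral_ivl by (intro zero) auto
    next
      case False
      then have "{max a c<..<min b d} = {}" by (simp only: greaterThanLessThan_empty_iff not_less)
      then show ?thesis by (simp only: set_lebesgue_integral_def) simp
    qed
    finally show ?thesis .
  qed
  have set_int: "set_integrable lborel A h" if "A \<in> sets borel" for A
    using integrable_mult_indicator[OF _ int_h, of A] that by (simp add: set_integrable_def)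
  have "(LINT x|lborel. h x) = (LINT x:{a<..<b}|lborel. h x)"
    unfolding set_lebesgue_integral_def
    by (intro Bochner_Integration.integral_cong) (auto simp: h_def indicator_def)
  then have UNIV: "(LINT x:UNIV|lborel. h x) = 0"
    using box[of a b] by (simp add: set_lebesgue_integral_def)
  have sets: "(LINT x:A|lborel. h x) = 0" if "A \<in> sets borel" for A
  proof -
    let ?G = "range (\<lambda>(a, b). {a<..<b::real})"
    have borel: "sets borel = sigma_sets UNIV ?G"
      by (subst borel_eq_box[where 'a = real, unfolded box_real]) simp
    have "Int_stable ?G" by (auto simp: Int_stable_def)
    moreover have "?G \<subseteq> Pow UNIV" by simp
    moreover have "A \<in> sigma_sets UNIV ?G" using that borel by simp
    ultimately show ?thesis
    proof (induction rule: sigma_sets_induct_disjoint)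
      case (basic A)
      then show ?case using box by auto
    next
      case empty
      show ?case by (simp add: set_lebesgue_integral_def)
    next
      case (compl A)
      then have A: "A \<in> sets borel" using borel by simp
      have "(LINT x:A \<union> - A|lborel. h x) = (LINT x:A|lborel. h x) + (LINT x:- A|lborel. h x)"
        using A by (intro set_integral_Un set_int) auto
      then show ?case using UNIV compl.IH by (simp add: Compl_eq_Diff_UNIV)
    next
      case (union A)
      then have A: "A i \<in> sets borel" for i using borel by auto
      have "(LINT x:(\<Union>i. A i)|lborel. h x) = (\<Sum>i. (LINT x:(A i)|lborel. h x))"
        by (rule lebesgue_integral_countable_add)
           (use A union set_int in \<open>auto simp: disjoint_family_on_def\<close>)
      then show ?case using union.IH by simp
    qed
  qed
  have "AE x in lborel. h x = 0"
    by (rule density_unique_real[OF int_h]) (use sets in \<open>simp_all add: set_lebesgue_integral_def\<close>)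
  then show ?thesis
    unfolding AE_ivl by (rule eventually_mono) (auto simp: h_def)
qed

text \<open>Dominated convergence: the squared error is at most \<open>(p x)\<^sup>2\<close> and vanishes outside
  \<open>{c<..<d}\<close>.\<close>

lemma bump_L2_tendsto:
  assumes "a \<le> c" "c < d" "d \<le> b" and p: "continuous_on {a..b} p"
  shows "L2_tendsto (ivl a b) (\<lambda>n x. p x * bump c d n x) (\<lambda>x. indicator {c<..<d} x * p x)"
proof -
  have ind: "bump c d n x = indicator {c<..<d} x * bump c d n x" for n x
    using bump_eq_0[of c d x n] \<open>c < d\<close> by (cases "c < x \<and> x < d") (auto simp: indicator_def)
  have L1: "L2 (ivl a b) (\<lambda>x. p x * bump c d n x)" for n
    by (intro L2_ivl_continuous continuous_intros p continuous_bump)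
  have L2: "L2 (ivl a b) (\<lambda>x. indicator {c<..<d} x * p x)"
    by (rule L2_mult_bounded[where C = 1, OF L2_ivl_continuous[OF p]])
       (auto intro!: measurable_ivl simp: indicator_def)
  have "(\<lambda>n. \<integral>x. (p x * bump c d n x - indicator {c<..<d} x * p x)\<^sup>2 \<partial>ivl a b) \<longlonglongrightarrow> (\<integral>x. 0 \<partial>ivl a b)"
  proof (rule integral_dominated_convergence)
    show "integrable (ivl a b) (\<lambda>x. (p x)\<^sup>2)"
      by (rule L2_integrable_square[OF L2_ivl_continuous[OF p]])
    show "(\<lambda>x. (p x * bump c d n x - indicator {c<..<d} x * p x)\<^sup>2) \<in> borel_measurable (ivl a b)" for n
      using L2_diff[OF L1 L2, of n] by (auto simp: L2_def)
    have "(\<lambda>n. (p x * bump c d n x - indicator {c<..<d} x * p x)\<^sup>2) \<longlonglongrightarrow> 0" for x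
    proof (cases "x \<in> {c<..<d}")
      case True
      then have "(\<lambda>n. (p x * bump c d n x - p x)\<^sup>2) \<longlonglongrightarrow> (p x * 1 - p x)\<^sup>2"
        by (intro tendsto_power tendsto_diff tendsto_mult tendsto_const bump_tendsto_1) auto
      then show ?thesis using True by simp
    next
      case False
      then have "bump c d n x = 0" for n using ind[of n x] by simp
      then show ?thesis using False by simp
    qed
    then show "AE x in ivl a b. (\<lambda>n. (p x * bump c d n x - indicator {c<..<d} x * p x)\<^sup>2) \<longlonglongrightarrow> 0"
      by simp
    have "(p x * bump c d n x - indicator {c<..<d} x * p x)\<^sup>2 \<le> (p x)\<^sup>2" for n x
    proof -
      have "\<bar>bump c d n x - indicator {c<..<d} x\<bar> \<le> 1"
        using bump_bounds[of c d n x] by (auto simp: indicator_def)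
      then have "\<bar>p x\<bar> * \<bar>bump c d n x - indicator {c<..<d} x\<bar> \<le> \<bar>p x\<bar>"
        by (intro mult_left_le) auto
      then have "\<bar>p x * bump c d n x - indicator {c<..<d} x * p x\<bar> \<le> \<bar>p x\<bar>"
        by (simp add: abs_mult[symmetric] algebra_simps)
      then show ?thesis by (simp add: abs_le_square_iff)
    qed
    then show "AE x in ivl a b. norm ((p x * bump c d n x - indicator {c<..<d} x * p x)\<^sup>2) \<le> (p x)\<^sup>2" for n
      by simp
  qed simp
  then show ?thesis using L1 L2 by (simp add: L2_tendsto_def)
qed

text \<open>Testing with bumps and passing to the limit shows that \<open>f\<close> has integral zero over every
  subinterval.\<close>

lemma orthogonal_test_functions_AE_zero:
  assumes f: "L2 (ivl a b) f"
    and orth: "\<And>\<eta>. test_function a b \<eta> \<Longrightarrow> (\<integral>x. f x * \<eta> x \<partial>ivl a b) = 0"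
  shows "AE x in ivl a b. f x = 0"
proof (rule AE_zero_ivl[OF L2_ivl_integrable[OF f]])
  fix c d assume cd: "a \<le> c" "c < d" "d \<le> b"
  have "(\<lambda>n. \<integral>x. f x * (1 * bump c d n x) \<partial>ivl a b) \<longlonglongrightarrow> (\<integral>x. f x * (indicator {c<..<d} x * 1) \<partial>ivl a b)"
    by (intro L2_tendsto_inner L2_tendsto_const f bump_L2_tendsto cd continuous_intros)
  moreover have "(\<integral>x. f x * (1 * bump c d n x) \<partial>ivl a b) = 0" for n
    by (intro orth test_function_bump cd real_polynomial_function.intros)
  ultimately have "(\<lambda>n::nat. 0) \<longlonglongrightarrow> (\<integral>x. f x * (indicator {c<..<d} x * 1) \<partial>ivl a b)"
    by (simp only:)
  then have "(\<integral>x. f x * (indicator {c<..<d} x * 1) \<partial>ivl a b) = 0"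
    by (simp only: LIMSEQ_const_iff)
  then show "(\<integral>x. f x \<partial>ivl c d) = 0"
    using integral_ivl_indicator[OF cd(1,3), of f] by (simp add: mult.commute)
qed

lemma L2_ivl_indicator:
  assumes "L2 (ivl c d) f"
  shows "L2 (ivl a b) (\<lambda>x. indicator {c<..<d} x * f x)"
proof -
  have cd: "{c<..<d} \<inter> space lborel \<in> sets lborel" and ab: "{a<..<b} \<inter> space lborel \<in> sets lborel"
    by simp_all
  have meas: "(\<lambda>x. indicator {c<..<d} x * f x) \<in> borel_measurable borel"
    and int: "integrable lborel (\<lambda>x. indicator {c<..<d} x * (f x)\<^sup>2)"
    using assms unfolding L2_def ivl_def
    by (simp_all add: integrable_restrict_space[OF cd] borel_measurable_restrict_space_iff[OF cd])
  have "integrable (ivl a b) (\<lambda>x. indicator {c<..<d} x * (f x)\<^sup>2)"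
    unfolding ivl_def integrable_restrict_space[OF ab]
    by (rule integrable_mult_indicator[OF _ int]) simp
  moreover have "(indicator {c<..<d} x * f x)\<^sup>2 = indicator {c<..<d} x * (f x)\<^sup>2" for x
    by (simp add: indicator_def)
  ultimately show ?thesis using measurable_ivl[OF meas] by (simp add: L2_def)
qed

lemma integral_ivl_const: "a \<le> b \<Longrightarrow> (\<integral>x. k \<partial>ivl a b) = k * (b - a)" for k :: real
proof -
  assume ab: "a \<le> b"
  have "(\<integral>x. k \<partial>ivl a b) = k * b - k * a"
    by (rule integral_ivl_FTC[OF ab _ finite_measure.integrable_const[OF finite_measure_ivl]])
       (auto intro!: derivative_eq_intros continuous_intros)
  then show ?thesis by (simp add: right_diff_distrib del: lebesgue_integral_const)
qed

text \<open>By the Weierstrass theorem \<open>f\<close> is uniformly close on \<open>{c..d}\<close> to a polynomial, which bumps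
  cut off to a test function at small cost in \<open>L\<^sup>2\<close>.\<close>

lemma test_function_approximation:
  assumes cd: "a \<le> c" "c < d" "d \<le> b" and f: "continuous_on {c..d} f" and e: "e > 0"
  obtains \<phi> where "test_function a b \<phi>"
    "(\<integral>x. (\<phi> x - indicator {c<..<d} x * f x)\<^sup>2 \<partial>ivl a b) < e"
proof -
  \<comment> \<open>A uniform error \<open>e'\<close> contributes at most \<open>2 e'\<^sup>2 (b - a) = e / 4\<close> to the squared distance,
  and the cut-off contributes less than \<open>2 \<cdot> e / 4\<close>.\<close>
  define e' where "e' = sqrt (e / (8 * (b - a)))"
  have ab: "a < b" using cd by simp
  have "e'\<^sup>2 = e / (8 * (b - a))" using e ab by (simp add: e'_def)
  then have "4 * e'\<^sup>2 * (b - a) = e / 2" using ab by (simp add: field_simps)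
  moreover have "e' > 0" using e ab by (simp add: e'_def)
  ultimately have e': "e' > 0" "4 * e'\<^sup>2 * (b - a) < e" using e by simp_all
  obtain p where p: "real_polynomial_function p" "\<And>x. x \<in> {c..d} \<Longrightarrow> \<bar>f x - p x\<bar> < e'"
    using Stone_Weierstrass_real_polynomial_function[OF compact_Icc f e'(1)] by blast
  have cont: "continuous_on {a..b} p"
    using p(1) continuous_on_polymonial_function real_polynomial_function_eq by blast
  let ?F = "\<lambda>x. indicator {c<..<d} x * f x" and ?P = "\<lambda>x. indicator {c<..<d} x * p x"
  have lim: "L2_tendsto (ivl a b) (\<lambda>n x. p x * bump c d n x) ?P"
    by (rule bump_L2_tendsto[OF cd cont])
  have "(\<lambda>n. \<integral>x. (p x * bump c d n x - ?P x)\<^sup>2 \<partial>ivl a b) \<longlonglongrightarrow> 0"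
    using lim unfolding L2_tendsto_def by blast
  then have "eventually (\<lambda>n. (\<integral>x. (p x * bump c d n x - ?P x)\<^sup>2 \<partial>ivl a b) < e / 4) sequentially"
    by (rule order_tendstoD(2)) (use e in simp)
  then obtain n where n: "(\<integral>x. (p x * bump c d n x - ?P x)\<^sup>2 \<partial>ivl a b) < e / 4"
    using eventually_happens'[OF sequentially_bot] by blast
  have L: "L2 (ivl a b) (\<lambda>x. p x * bump c d n x)" "L2 (ivl a b) ?P" "L2 (ivl a b) ?F"
    using lim L2_ivl_indicator[OF L2_ivl_continuous[OF f]] by (auto simp: L2_tendsto_def)
  have "(\<integral>x. (p x * bump c d n x - ?F x)\<^sup>2 \<partial>ivl a b)
      \<le> (\<integral>x. 2 * (p x * bump c d n x - ?P x)\<^sup>2 + 2 * e'\<^sup>2 \<partial>ivl a b)"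
  proof (rule integral_mono)
    show "integrable (ivl a b) (\<lambda>x. (p x * bump c d n x - ?F x)\<^sup>2)"
      by (intro L2_integrable_square L2_diff L)
    show "integrable (ivl a b) (\<lambda>x. 2 * (p x * bump c d n x - ?P x)\<^sup>2 + 2 * e'\<^sup>2)"
      using L2_integrable_square[OF L2_diff[OF L(1,2)]] finite_measure.integrable_const[OF finite_measure_ivl]
      by (intro Bochner_Integration.integrable_add integrable_mult_right) auto
    fix x
    have "(?P x - ?F x)\<^sup>2 \<le> e'\<^sup>2"
      using p(2)[of x] e'(1) by (auto simp: indicator_def abs_le_square_iff[symmetric] abs_minus_commute)
    moreover have sq: "(u + v)\<^sup>2 \<le> 2 * u\<^sup>2 + 2 * v\<^sup>2" for u v :: real
      using sum_squares_bound[of u v] by (simp add: power2_sum)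
    have "(p x * bump c d n x - ?F x)\<^sup>2 \<le> 2 * (p x * bump c d n x - ?P x)\<^sup>2 + 2 * (?P x - ?F x)\<^sup>2"
      using sq[of "p x * bump c d n x - ?P x" "?P x - ?F x"] by simp
    ultimately show "(p x * bump c d n x - ?F x)\<^sup>2 \<le> 2 * (p x * bump c d n x - ?P x)\<^sup>2 + 2 * e'\<^sup>2"
      by simp
  qed
  also have "\<dots> = 2 * (\<integral>x. (p x * bump c d n x - ?P x)\<^sup>2 \<partial>ivl a b) + 2 * e'\<^sup>2 * (b - a)"
    using L2_integrable_square[OF L2_diff[OF L(1,2)]] finite_measure.integrable_const[OF finite_measure_ivl] ab
      integral_ivl_const[of a b "2 * e'\<^sup>2"]
    by (subst Bochner_Integration.integral_add) auto
  also have "\<dots> < e" using n e' by simp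
  finally show ?thesis
    using that[OF test_function_bump[OF cd p(1), of n]] by blast
qed

section \<open>The Sobolev space of functions vanishing at the end points\<close>

lemma test_function_L2:
  assumes "test_function a b \<eta>"
  shows "L2 (ivl a b) \<eta>" "L2 (ivl a b) (deriv \<eta>)"
  using assms by (auto intro!: L2_ivl_continuous continuous_at_imp_continuous_on dest: test_functionD)

lemma has_weak_derivD:
  assumes "has_weak_deriv a b f d"
  shows "L2 (ivl a b) f" "L2 (ivl a b) d"
    "test_function a b \<eta> \<Longrightarrow> (\<integral>x. f x * deriv \<eta> x \<partial>ivl a b) = - (\<integral>x. d x * \<eta> x \<partial>ivl a b)"
  using assms by (auto simp: has_weak_deriv_def square_integrable_ivl set_integral_ivl)

lemma test_function_has_weak_deriv:
  assumes "test_function a b f" "a < b"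
  shows "has_weak_deriv a b f (deriv f)"
proof -
  have "(\<integral>x. f x * deriv \<eta> x \<partial>ivl a b) = - (\<integral>x. deriv f x * \<eta> x \<partial>ivl a b)"
    if \<eta>: "test_function a b \<eta>" for \<eta>
  proof -
    note L = test_function_L2[OF assms(1)] test_function_L2[OF \<eta>]
    have int: "integrable (ivl a b) (\<lambda>x. f x * deriv \<eta> x)" "integrable (ivl a b) (\<lambda>x. deriv f x * \<eta> x)"
      by (intro L2_integrable_mult L)+
    have "(\<integral>x. f x * deriv \<eta> x + deriv f x * \<eta> x \<partial>ivl a b) = f b * \<eta> b - f a * \<eta> a"
    proof (rule integral_ivl_FTC)
      show "continuous_on {a..b} (\<lambda>x. f x * \<eta> x)"
        using test_functionD(2)[OF assms(1)] test_functionD(2)[OF \<eta>]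
        by (intro continuous_at_imp_continuous_on) auto
      show "((\<lambda>x. f x * \<eta> x) has_real_derivative f x * deriv \<eta> x + deriv f x * \<eta> x) (at x)" for x
        using DERIV_mult[OF test_functionD(1)[OF assms(1)] test_functionD(1)[OF \<eta>], of x]
        by (simp add: algebra_simps)
    qed (use int assms(2) in auto)
    then show ?thesis
      using int test_functionD(4)[OF \<eta>, of a] test_functionD(4)[OF \<eta>, of b] by simp
  qed
  then show ?thesis
    using test_function_L2[OF assms(1)]
    by (auto simp: has_weak_deriv_def square_integrable_ivl set_integral_ivl)
qed

text \<open>The difference of two weak derivatives is orthogonal to all test functions. Without
  this, nothing could be said about the representative that \<open>weak_deriv\<close> selects.\<close>

lemma weak_deriv_unique:
  assumes "has_weak_deriv a b f d" "has_weak_deriv a b f d'"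
  shows "AE x in ivl a b. d x = d' x"
proof -
  note D = has_weak_derivD[OF assms(1)] and D' = has_weak_derivD[OF assms(2)]
  have "AE x in ivl a b. d x - d' x = 0"
  proof (rule orthogonal_test_functions_AE_zero)
    show "L2 (ivl a b) (\<lambda>x. d x - d' x)" by (intro L2_diff D D')
    fix \<eta> assume \<eta>: "test_function a b \<eta>"
    have "integrable (ivl a b) (\<lambda>x. d x * \<eta> x)" "integrable (ivl a b) (\<lambda>x. d' x * \<eta> x)"
      by (intro L2_integrable_mult D D' test_function_L2 \<eta>)+
    then show "(\<integral>x. (d x - d' x) * \<eta> x \<partial>ivl a b) = 0"
      using D(3)[OF \<eta>] D'(3)[OF \<eta>] by (simp add: left_diff_distrib)
  qed
  then show ?thesis by simp
qed

lemma has_weak_deriv_weak_deriv: "f \<in> H1 a b \<Longrightarrow> has_weak_deriv a b f (weak_deriv a b f)"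
proof -
  assume "f \<in> H1 a b"
  then have "\<exists>d. has_weak_deriv a b f d" by (simp add: H1_def)
  then show ?thesis unfolding weak_deriv_def by (rule someI_ex)
qed

lemma test_function_H01:
  assumes f: "test_function a b f" and ab: "a < b"
  shows "f \<in> H01 a b" "AE x in ivl a b. weak_deriv a b f x = deriv f x"
proof -
  have H1: "f \<in> H1 a b" using test_function_has_weak_deriv[OF assms] by (auto simp: H1_def)
  show AE: "AE x in ivl a b. weak_deriv a b f x = deriv f x"
    by (rule weak_deriv_unique[OF has_weak_deriv_weak_deriv[OF H1] test_function_has_weak_deriv[OF assms]])
  have "(\<integral>x. (deriv f x - weak_deriv a b f x)\<^sup>2 \<partial>ivl a b) = (\<integral>x. 0 \<partial>ivl a b)"
  proof (rule integral_cong_AE)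
    show "(\<lambda>x. (deriv f x - weak_deriv a b f x)\<^sup>2) \<in> borel_measurable (ivl a b)"
      by (intro borel_measurable_integrable L2_integrable_square L2_diff test_function_L2(2)[OF f]
          has_weak_derivD(2)[OF has_weak_deriv_weak_deriv[OF H1]])
    show "AE x in ivl a b. (deriv f x - weak_deriv a b f x)\<^sup>2 = 0"
      using AE by (rule eventually_mono) simp
  qed simp
  then have "(\<lambda>n::nat. (LBINT x:{a<..<b}. (f x - f x)\<^sup>2) +
             (LBINT x:{a<..<b}. (deriv f x - weak_deriv a b f x)\<^sup>2)) \<longlonglongrightarrow> 0"
    by (simp add: set_integral_ivl)
  moreover have "continuous_on {a..b} f"
    using test_functionD(2)[OF f] by (intro continuous_at_imp_continuous_on) auto
  ultimately show "f \<in> H01 a b"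
    using H1 f by (auto simp: H01_def intro!: exI[of _ "\<lambda>_. f"])
qed

text \<open>Both terms of the null sequence in \<open>H01\<close> are nonnegative, so each tends to zero.\<close>

lemma H01_approximation:
  assumes "f \<in> H01 a b"
  shows "\<exists>\<eta>. (\<forall>n. test_function a b (\<eta> n)) \<and> L2_tendsto (ivl a b) \<eta> f \<and>
    L2_tendsto (ivl a b) (\<lambda>n. deriv (\<eta> n)) (weak_deriv a b f)"
proof -
  obtain \<eta> where \<eta>: "\<And>n. test_function a b (\<eta> n)"
    and lim: "(\<lambda>n. (\<integral>x. (\<eta> n x - f x)\<^sup>2 \<partial>ivl a b) +
             (\<integral>x. (deriv (\<eta> n) x - weak_deriv a b f x)\<^sup>2 \<partial>ivl a b)) \<longlonglongrightarrow> 0"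
    and H1: "f \<in> H1 a b"
    using assms unfolding H01_def by (auto simp: set_integral_ivl)
  note W = has_weak_derivD[OF has_weak_deriv_weak_deriv[OF H1]]
  have lims: "(\<lambda>n. \<integral>x. (\<eta> n x - f x)\<^sup>2 \<partial>ivl a b) \<longlonglongrightarrow> 0"
    "(\<lambda>n. \<integral>x. (deriv (\<eta> n) x - weak_deriv a b f x)\<^sup>2 \<partial>ivl a b) \<longlonglongrightarrow> 0"
    by (rule tendsto_sandwich[OF always_eventually always_eventually tendsto_const lim]; simp)+
  show ?thesis
    by (rule exI[of _ \<eta>])
       (simp only: \<eta> L2_tendsto_def test_function_L2[OF \<eta>] W lims simp_thms)
qed

lemma H01_D:
  assumes "f \<in> H01 a b"
  shows "L2 (ivl a b) f" "L2 (ivl a b) (weak_deriv a b f)" "continuous_on {a..b} f"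
    "has_weak_deriv a b f (weak_deriv a b f)"
proof -
  show w: "has_weak_deriv a b f (weak_deriv a b f)"
    using assms by (intro has_weak_deriv_weak_deriv) (auto simp: H01_def)
  show "L2 (ivl a b) f" "L2 (ivl a b) (weak_deriv a b f)"
    using has_weak_derivD[OF w] by auto
  show "continuous_on {a..b} f" using assms by (auto simp: H01_def)
qed

text \<open>For a test function in place of \<open>f\<close> this is the definition of the weak derivative of \<open>h\<close>;
  both sides are continuous in \<open>f\<close> and its derivative.\<close>

lemma H01_integration_by_parts:
  assumes "f \<in> H01 a b" "h \<in> H01 a b"
  shows "(\<integral>x. weak_deriv a b f x * h x \<partial>ivl a b) = - (\<integral>x. f x * weak_deriv a b h x \<partial>ivl a b)"
proof -
  obtain \<eta> where \<eta>': "\<forall>n. test_function a b (\<eta> n)" "L2_tendsto (ivl a b) \<eta> f"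
    "L2_tendsto (ivl a b) (\<lambda>n. deriv (\<eta> n)) (weak_deriv a b f)"
    using H01_approximation[OF assms(1)] by blast
  note \<eta> = \<eta>'(1)[rule_format] \<eta>'(2,3)
  note h = H01_D[OF assms(2)]
  have "(\<lambda>n. \<integral>x. h x * deriv (\<eta> n) x \<partial>ivl a b) \<longlonglongrightarrow> (\<integral>x. h x * weak_deriv a b f x \<partial>ivl a b)"
    by (intro L2_tendsto_inner L2_tendsto_const h \<eta>)
  moreover have "(\<integral>x. h x * deriv (\<eta> n) x \<partial>ivl a b) = - (\<integral>x. weak_deriv a b h x * \<eta> n x \<partial>ivl a b)" for n
    by (rule has_weak_derivD(3)[OF h(4) \<eta>(1)])
  moreover have "(\<lambda>n. - (\<integral>x. weak_deriv a b h x * \<eta> n x \<partial>ivl a b)) \<longlonglongrightarrow> - (\<integral>x. weak_deriv a b h x * f x \<partial>ivl a b)"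
    by (intro tendsto_minus L2_tendsto_inner L2_tendsto_const h \<eta>)
  ultimately show ?thesis
    by (simp add: mult.commute LIMSEQ_unique)
qed

lemma integral_ivl_square_le:
  assumes u: "L2 (ivl a b) u" and "a \<le> c" "c \<le> d" "d \<le> b"
  shows "(\<integral>x. u x \<partial>ivl c d)\<^sup>2 \<le> (b - a) * (\<integral>x. (u x)\<^sup>2 \<partial>ivl a b)"
proof -
  have ucd: "L2 (ivl c d) u" by (rule L2_ivl_subinterval[OF u assms(2,4)])
  have one: "L2 (ivl c d) (\<lambda>_. 1)" by (rule L2_ivl_bounded[where C = 1]) simp_all
  have "(\<integral>x. u x * 1 \<partial>ivl c d)\<^sup>2 \<le> (\<integral>x. (u x)\<^sup>2 \<partial>ivl c d) * (\<integral>x. 1\<^sup>2 \<partial>ivl c d)"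
    by (rule Cauchy_Schwarz_L2[OF ucd one])
  also have "(\<integral>x. 1\<^sup>2 \<partial>ivl c d) = d - c"
    using integral_ivl_const[OF \<open>c \<le> d\<close>, of 1] by simp
  also have "(\<integral>x. (u x)\<^sup>2 \<partial>ivl c d) \<le> (\<integral>x. (u x)\<^sup>2 \<partial>ivl a b)"
    unfolding integral_ivl_indicator[OF assms(2,4), symmetric]
  proof (rule integral_mono')
    show "integrable (ivl a b) (\<lambda>x. (u x)\<^sup>2)" by (rule L2_integrable_square[OF u])
  qed (auto simp: indicator_def)
  then have "(\<integral>x. (u x)\<^sup>2 \<partial>ivl c d) * (d - c) \<le> (\<integral>x. (u x)\<^sup>2 \<partial>ivl a b) * (b - a)"
    using assms by (intro mult_mono) auto
  finally show ?thesis by (simp add: mult.commute)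
qed

lemma test_function_integral:
  assumes "test_function a b \<eta>" "a \<le> x"
  shows "(\<integral>t. deriv \<eta> t \<partial>ivl a x) = \<eta> x"
proof -
  have "(\<integral>t. deriv \<eta> t \<partial>ivl a x) = \<eta> x - \<eta> a"
  proof (rule integral_ivl_FTC[OF assms(2)])
    show "continuous_on {a..x} \<eta>"
      using test_functionD(2)[OF assms(1)] by (intro continuous_at_imp_continuous_on) auto
    have "continuous_on {a..x} (deriv \<eta>)"
      using test_functionD(3)[OF assms(1)] by (intro continuous_at_imp_continuous_on) auto
    then show "integrable (ivl a x) (deriv \<eta>)" by (intro L2_ivl_integrable L2_ivl_continuous)
  qed (rule test_functionD(1)[OF assms(1)])
  then show ?thesis using test_functionD(4)[OF assms(1), of a] by simp
qed

text \<open>Convergence of derivatives in \<open>L\<^sup>2\<close> implies uniform convergence of the functions, because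
  they vanish at \<open>a\<close>.\<close>

lemma test_function_pointwise_error:
  assumes \<eta>: "test_function a b \<eta>" and d: "L2 (ivl a b) d" and x: "a \<le> x" "x \<le> b"
  shows "(\<eta> x - (\<integral>t. d t \<partial>ivl a x))\<^sup>2 \<le> (b - a) * (\<integral>t. (deriv \<eta> t - d t)\<^sup>2 \<partial>ivl a b)"
proof -
  have L: "L2 (ivl a x) (deriv \<eta>)" "L2 (ivl a x) d"
    using L2_ivl_subinterval[OF test_function_L2(2)[OF \<eta>] order_refl x(2)]
      L2_ivl_subinterval[OF d order_refl x(2)] .
  have "\<eta> x - (\<integral>t. d t \<partial>ivl a x) = (\<integral>t. deriv \<eta> t - d t \<partial>ivl a x)"
    using L2_ivl_integrable[OF L(1)] L2_ivl_integrable[OF L(2)] test_function_integral[OF \<eta> x(1)]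
    by simp
  also have "\<dots>\<^sup>2 \<le> (b - a) * (\<integral>t. (deriv \<eta> t - d t)\<^sup>2 \<partial>ivl a b)"
    by (intro integral_ivl_square_le L2_diff test_function_L2(2)[OF \<eta>] d order_refl x)
  finally show ?thesis .
qed

text \<open>The primitive \<open>F\<close> of the weak derivative is the uniform limit of the approximating test
  functions, whose limit in \<open>L\<^sup>2\<close> is \<open>f\<close>. Hence \<open>f = F\<close> almost everywhere, and everywhere
  since both are continuous.\<close>

lemma H01_eq_integral:
  assumes f: "f \<in> H01 a b" and ab: "a < b" and x: "x \<in> {a..b}"
  shows "f x = (\<integral>t. weak_deriv a b f t \<partial>ivl a x)"
proof -
  let ?d = "weak_deriv a b f"
  define F where "F x = (\<integral>t. ?d t \<partial>ivl a x)" for x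
  note f' = H01_D[OF f]
  obtain \<eta> where \<eta>': "\<forall>n. test_function a b (\<eta> n)" "L2_tendsto (ivl a b) \<eta> f"
    "L2_tendsto (ivl a b) (\<lambda>n. deriv (\<eta> n)) ?d"
    using H01_approximation[OF f] by blast
  note \<eta> = \<eta>'(1)[rule_format] \<eta>'(2,3)
  have int: "integrable (ivl a y) ?d" if "y \<le> b" for y
    by (rule integrable_ivl_subinterval[OF L2_ivl_integrable[OF f'(2)] order_refl that])
  have "continuous_on {a..b} (\<lambda>y. integral {a..y} ?d)"
    by (intro indefinite_integral_continuous_1 integral_ivl_HK(1) int) simp
  then have contF: "continuous_on {a..b} F"
    by (rule continuous_on_eq) (simp add: F_def integral_ivl_HK(2)[OF int])
  define A where "A n = (\<integral>x. (\<eta> n x - f x)\<^sup>2 \<partial>ivl a b)" for n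
  define B where "B n = (\<integral>x. (deriv (\<eta> n) x - ?d x)\<^sup>2 \<partial>ivl a b)" for n
  have L: "L2 (ivl a b) (\<lambda>x. f x - F x)"
    by (intro L2_diff f' L2_ivl_continuous contF)
  have le: "(\<integral>x. (f x - F x)\<^sup>2 \<partial>ivl a b) \<le> 2 * A n + 2 * ((b - a) * B n) * (b - a)" for n
  proof -
    have int: "integrable (ivl a b) (\<lambda>x. 2 * (\<eta> n x - f x)\<^sup>2)"
      using L2_integrable_square[OF L2_diff[OF test_function_L2(1)[OF \<eta>(1)] f'(1)]] by simp
    have const: "integrable (ivl a b) (\<lambda>x. 2 * ((b - a) * B n))"
      by (rule finite_measure.integrable_const[OF finite_measure_ivl])
    have "(\<integral>x. (f x - F x)\<^sup>2 \<partial>ivl a b) \<le> (\<integral>x. 2 * (\<eta> n x - f x)\<^sup>2 + 2 * ((b - a) * B n) \<partial>ivl a b)"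
    proof (rule integral_mono[OF L2_integrable_square[OF L] Bochner_Integration.integrable_add[OF int const]])
      fix x assume x: "x \<in> space (ivl a b)"
      have "(\<eta> n x - F x)\<^sup>2 \<le> (b - a) * B n"
        unfolding F_def B_def using x by (intro test_function_pointwise_error \<eta> f') auto
      moreover have "(f x - F x)\<^sup>2 \<le> 2 * (\<eta> n x - f x)\<^sup>2 + 2 * (\<eta> n x - F x)\<^sup>2"
      proof -
        have "0 \<le> ((\<eta> n x - f x) + (\<eta> n x - F x))\<^sup>2" by simp
        then show ?thesis by (simp add: power2_eq_square algebra_simps)
      qed
      ultimately show "(f x - F x)\<^sup>2 \<le> 2 * (\<eta> n x - f x)\<^sup>2 + 2 * ((b - a) * B n)" by simp
    qed
    also have "\<dots> = (\<integral>x. 2 * (\<eta> n x - f x)\<^sup>2 \<partial>ivl a b) + (\<integral>x. 2 * ((b - a) * B n) \<partial>ivl a b)"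
      by (rule Bochner_Integration.integral_add[OF int const])
    also have "(\<integral>x. 2 * ((b - a) * B n) \<partial>ivl a b) = 2 * ((b - a) * B n) * (b - a)"
      using ab by (intro integral_ivl_const) simp
    finally show ?thesis by (simp add: A_def)
  qed
  have "A \<longlonglongrightarrow> 0" "B \<longlonglongrightarrow> 0" using \<eta>(2,3) unfolding L2_tendsto_def A_def B_def by auto
  then have "(\<lambda>n. 2 * A n + 2 * ((b - a) * B n) * (b - a)) \<longlonglongrightarrow> 2 * 0 + 2 * ((b - a) * 0) * (b - a)"
    by (intro tendsto_add tendsto_mult tendsto_const)
  then have "(\<integral>x. (f x - F x)\<^sup>2 \<partial>ivl a b) \<le> 0"
    using LIMSEQ_le_const[of _ "2 * 0 + 2 * ((b - a) * 0) * (b - a)" "\<integral>x. (f x - F x)\<^sup>2 \<partial>ivl a b"] le by fastforce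
  moreover have "0 \<le> (\<integral>x. (f x - F x)\<^sup>2 \<partial>ivl a b)"
    by (rule Bochner_Integration.integral_nonneg) simp
  ultimately have "integral {a..b} (\<lambda>x. (f x - F x)\<^sup>2) = 0"
    using integral_ivl_HK(2)[OF L2_integrable_square[OF L]] by simp
  moreover have "continuous_on {a..b} (\<lambda>x. (f x - F x)\<^sup>2)"
    by (intro continuous_intros f' contF)
  ultimately have "(f x - F x)\<^sup>2 = 0"
    using integral_eq_0_iff[of a b "\<lambda>x. (f x - F x)\<^sup>2"] ab x by simp
  then show ?thesis by (simp add: F_def)
qed

lemma H01_pointwise_square_le:
  assumes "f \<in> H01 a b" "a < b" "x \<in> {a..b}"
  shows "(f x)\<^sup>2 \<le> (b - a) * (\<integral>t. (weak_deriv a b f t)\<^sup>2 \<partial>ivl a b)"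
  unfolding H01_eq_integral[OF assms]
  using assms by (intro integral_ivl_square_le H01_D) auto

text \<open>Pointwise convergence is what carries the interface value \<open>\<psi> 0\<close> through the limit.\<close>

lemma H01_approximation_pointwise:
  assumes "f \<in> H01 a b" "a < b"
  shows "\<exists>\<eta>. (\<forall>n. test_function a b (\<eta> n)) \<and> L2_tendsto (ivl a b) \<eta> f \<and>
    L2_tendsto (ivl a b) (\<lambda>n. deriv (\<eta> n)) (weak_deriv a b f) \<and>
    (\<forall>x\<in>{a..b}. (\<lambda>n. \<eta> n x) \<longlonglongrightarrow> f x)"
proof -
  let ?d = "weak_deriv a b f"
  obtain \<eta> where \<eta>': "\<forall>n. test_function a b (\<eta> n)" "L2_tendsto (ivl a b) \<eta> f"
    "L2_tendsto (ivl a b) (\<lambda>n. deriv (\<eta> n)) ?d"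
    using H01_approximation[OF assms(1)] by blast
  note \<eta> = \<eta>'(1)[rule_format] \<eta>'(2,3)
  have "(\<lambda>n. \<eta> n x) \<longlonglongrightarrow> f x" if x: "x \<in> {a..b}" for x
  proof -
    have "(\<lambda>n. \<integral>t. (deriv (\<eta> n) t - ?d t)\<^sup>2 \<partial>ivl a b) \<longlonglongrightarrow> 0"
      using \<eta>(3) unfolding L2_tendsto_def by blast
    then have lim: "(\<lambda>n. (b - a) * (\<integral>t. (deriv (\<eta> n) t - ?d t)\<^sup>2 \<partial>ivl a b)) \<longlonglongrightarrow> 0"
      by (rule tendsto_mult_right_zero)
    have bound: "norm ((\<eta> n x - f x)\<^sup>2) \<le> (b - a) * (\<integral>t. (deriv (\<eta> n) t - ?d t)\<^sup>2 \<partial>ivl a b)" for n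
      using test_function_pointwise_error[OF \<eta>(1) H01_D(2)[OF assms(1)], of x n] x
      by (simp add: H01_eq_integral[OF assms x])
    from lim have "(\<lambda>n. (\<eta> n x - f x)\<^sup>2) \<longlonglongrightarrow> 0"
      by (rule Lim_null_comparison[rotated]) (simp only: bound eventually_True)
    then have "(\<lambda>n. \<eta> n x - f x) \<longlonglongrightarrow> 0" by simp
    then show ?thesis by (simp add: LIM_zero_iff)
  qed
  with \<eta> show ?thesis by (intro exI[of _ \<eta>]) simp
qed


section \<open>The steady state\<close>

lemma smooth_on_Ioi_D:
  assumes "smooth_on {0<..} f" "z > 0"
  shows "(f has_real_derivative deriv f z) (at z)" "isCont f z" "isCont (deriv f) z"
proof -
  have "(deriv ^^ 0) f differentiable (at z)" using assms unfolding smooth_on_def by blast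
  then have "f differentiable (at z)" by simp
  then show "(f has_real_derivative deriv f z) (at z)" "isCont f z"
    by (auto simp: DERIV_deriv_iff_real_differentiable differentiable_imp_continuous_within)
  have "(deriv ^^ 1) f differentiable (at z)" using assms unfolding smooth_on_def by blast
  then show "isCont (deriv f) z" by (simp add: differentiable_imp_continuous_within)
qed

text \<open>At a zero of the continuous function \<open>P'\<close>, its reciprocal would exceed any given bound
  on a whole interval around the point, against local essential boundedness.\<close>

lemma pressure_law_deriv_pos:
  assumes P: "pressure_law P" and z: "z > 0"
  shows "deriv P z > 0"
proof -
  have smooth: "smooth_on {0<..} P" and mono: "strict_mono_on {0<..} P"
    and nz: "AE z in lborel. z > 0 \<longrightarrow> deriv P z \<noteq> 0"
    and loc: "Linfty_loc {0<..} (\<lambda>z. 1 / deriv P z)"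
    using P by (auto simp: pressure_law_def)
  have "interior {0<..} = {0::real<..}" by (rule interior_open) simp
  then have nonneg: "deriv P z \<ge> 0"
    by (intro mono_on_imp_deriv_nonneg[OF strict_mono_on_imp_mono_on[OF mono] smooth_on_Ioi_D(1)[OF smooth z]])
       (use z in simp)
  have "deriv P z \<noteq> 0"
  proof
    assume zero: "deriv P z = 0"
    have "compact {z/2..2*z}" "{z/2..2*z} \<subseteq> {0<..}" using z by auto
    then obtain C where C: "AE x in lborel. x \<in> {z/2..2*z} \<longrightarrow> \<bar>1 / deriv P x\<bar> \<le> C"
      using loc unfolding Linfty_loc_def by blast
    have "isCont (deriv P) z" by (rule smooth_on_Ioi_D[OF smooth z])
    \<comment> \<open>Where \<open>P'\<close> is this small and nonzero, \<open>1 / P'\<close> exceeds \<open>\<bar>C\<bar> + 1\<close> in modulus.\<close>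
    then obtain d where d: "d > 0" "\<And>x. \<bar>x - z\<bar> < d \<Longrightarrow> \<bar>deriv P x\<bar> < 1 / (\<bar>C\<bar> + 1)"
      using zero unfolding continuous_at_eps_delta dist_real_def
      by (metis add_pos_nonneg abs_ge_zero diff_zero divide_pos_pos zero_less_one add.commute)
    define u v where "u = max (z/2) (z - d)" and "v = min (2*z) (z + d)"
    have uv: "u < v" using d z by (auto simp: u_def v_def)
    have "AE x in lborel. \<not> (u < x \<and> x < v)"
      using C nz
    proof eventually_elim
      case (elim x)
      show ?case
      proof
        assume x: "u < x \<and> x < v"
        then have "\<bar>x - z\<bar> < d" "x \<in> {z/2..2*z}" "x > 0" using z by (auto simp: u_def v_def)
        then have "\<bar>deriv P x\<bar> < 1 / (\<bar>C\<bar> + 1)" "\<bar>1 / deriv P x\<bar> \<le> C" "deriv P x \<noteq> 0"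
          using d elim by auto
        then have "\<bar>deriv P x\<bar> * (\<bar>C\<bar> + 1) < 1" "1 \<le> C * \<bar>deriv P x\<bar>"
          by (auto simp: field_simps abs_divide)
        moreover have "C * \<bar>deriv P x\<bar> \<le> \<bar>deriv P x\<bar> * (\<bar>C\<bar> + 1)"
          by (subst mult.commute) (intro mult_left_mono; simp)
        ultimately show False by linarith
      qed
    qed
    then have "emeasure lborel {x \<in> space lborel. u < x \<and> x < v} = 0"
      by (rule emeasure_eq_0_AE)
    moreover have "{x \<in> space lborel. u < x \<and> x < v} = {u<..<v}" by auto
    ultimately show False using uv by simp
  qed
  with nonneg show ?thesis by simp
qed

text \<open>Fundamental theorem of calculus on an interval inside \<open>{0<..}\<close> that contains both the base
  point 1 and, in its interior, the point \<open>z\<close>.\<close>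

lemma enthalpy_has_derivative:
  assumes P: "pressure_law P" and z: "z > 0"
  shows "(enthalpy P has_real_derivative deriv P z / z) (at z)"
proof -
  have smooth: "smooth_on {0<..} P" using P by (simp add: pressure_law_def)
  define a b where "a = min 1 z / 2" and "b = max 1 z + 1"
  have ab: "0 < a" "a < 1" "1 < b" "a < z" "z < b" using z by (auto simp: a_def b_def)
  have "continuous_on {a..b} (\<lambda>r. deriv P r / r)"
    using ab by (intro continuous_at_imp_continuous_on ballI continuous_intros smooth_on_Ioi_D(3)[OF smooth]) auto
  then have "((\<lambda>u. LBINT r=1..u. deriv P r / r) has_vector_derivative (deriv P z / z)) (at z within {a..b})"
    using interval_integral_FTC2[of a 1 b "\<lambda>r. deriv P r / r" z] ab by (simp add: one_ereal_def)
  moreover have "at z within {a..b} = at z" using ab by (simp add: at_within_Icc_at)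
  moreover have "enthalpy P = (\<lambda>u. LBINT r=1..u. deriv P r / r)" by (auto simp: enthalpy_def)
  ultimately show ?thesis by (simp add: has_real_derivative_iff_has_vector_derivative)
qed

lemma enthalpy_strict_mono:
  assumes P: "pressure_law P" "0 < y" "y < z"
  shows "enthalpy P y < enthalpy P z"
  by (rule DERIV_pos_imp_increasing[OF assms(3)])
     (use assms in \<open>auto intro!: exI enthalpy_has_derivative divide_pos_pos pressure_law_deriv_pos\<close>)

lemma enthalpy_inj: "pressure_law P \<Longrightarrow> inj_on (enthalpy P) {0<..}"
  using enthalpy_strict_mono[of P]
  by (intro linorder_inj_onI') (metis greaterThan_iff less_irrefl)

text \<open>The enthalpy \<open>h\<close> has positive derivative \<open>P'(z) / z\<close>, so its range is an interval and contains
  \<open>k - g x\<close> for all \<open>x\<close> between the two ends. The density \<open>r\<close> solves \<open>h(r x) = k - g x\<close>;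
  differentiating this equation gives the hydrostatic balance \<open>r' = - g r / P'(r)\<close>.\<close>

lemma hydrostatic_layer:
  assumes P: "pressure_law P" and g: "g > 0" and uv: "u < v"
    and ends: "k - g * u \<in> enthalpy P ` {0<..}" "k - g * v \<in> enthalpy P ` {0<..}"
  defines "r \<equiv> \<lambda>x. inv_into {0<..} (enthalpy P) (k - g * x)"
  shows "\<And>x. x \<in> {u..v} \<Longrightarrow> r x > 0" "continuous_on {u..v} r"
    "\<And>x. u < x \<Longrightarrow> x < v \<Longrightarrow> (r has_real_derivative - (g * r x / deriv P (r x))) (at x)"
proof -
  let ?h = "enthalpy P"
  have cont: "continuous_on A ?h" if "A \<subseteq> {0<..}" for A
    using that by (intro continuous_at_imp_continuous_on ballI DERIV_isCont[OF enthalpy_has_derivative[OF P]]) auto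
  have "connected (?h ` {0<..})"
    by (intro connected_continuous_image cont connected_Ioi) simp
  then have "{k - g * v..k - g * u} \<subseteq> ?h ` {0<..}"
    using ends connected_contains_Icc by blast
  moreover have "k - g * x \<in> {k - g * v..k - g * u}" if "x \<in> {u..v}" for x
    using that g by auto
  ultimately have range: "k - g * x \<in> ?h ` {0<..}" if "x \<in> {u..v}" for x
    using that by blast
  show pos: "r x > 0" if "x \<in> {u..v}" for x
    using inv_into_into[OF range[OF that]] by (simp add: r_def)
  have hr: "?h (r x) = k - g * x" if "x \<in> {u..v}" for x
    using f_inv_into_f[OF range[OF that]] by (simp add: r_def)
  let ?S = "{r v..r u}"
  have S: "?S \<subseteq> {0<..}" using pos[of v] uv by auto
  have rS: "r x \<in> ?S" if x: "x \<in> {u..v}" for x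
  proof -
    have "?h (r v) \<le> ?h (r x)" "?h (r x) \<le> ?h (r u)"
      using hr[OF x] hr[of u] hr[of v] uv x g by auto
    then show ?thesis
      using enthalpy_strict_mono[OF P, of "r x" "r v"] enthalpy_strict_mono[OF P, of "r u" "r x"]
        pos[OF x] pos[of u] uv by (auto simp: not_less[symmetric])
  qed
  have "continuous_on (?h ` ?S) (inv_into {0<..} ?h)"
    using S by (intro continuous_on_inv cont compact_Icc ballI inv_into_f_f enthalpy_inj[OF P]) auto
  moreover have "(\<lambda>x. k - g * x) ` {u..v} \<subseteq> ?h ` ?S"
  proof (rule image_subsetI)
    fix x assume x: "x \<in> {u..v}"
    show "k - g * x \<in> ?h ` ?S" unfolding hr[OF x, symmetric] by (rule imageI[OF rS[OF x]])
  qed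
  moreover have "continuous_on {u..v} (\<lambda>x. k - g * x)" by (intro continuous_intros)
  ultimately have "continuous_on {u..v} (\<lambda>x. inv_into {0<..} ?h (k - g * x))"
    using continuous_on_compose2 by blast
  then show cont_r: "continuous_on {u..v} r" by (simp only: r_def)
  show "(r has_real_derivative - (g * r x / deriv P (r x))) (at x)" if x: "u < x" "x < v" for x
  proof -
    have x': "x \<in> {u..v}" using x by simp
    let ?f = "\<lambda>w. (k - ?h w) / g"
    have D: "(?f has_real_derivative - (deriv P (r x) / r x) / g) (at (r x))"
      using g by (auto intro!: derivative_eq_intros enthalpy_has_derivative[OF P] pos[OF x'])
    have "(r has_real_derivative inverse (- (deriv P (r x) / r x) / g)) (at x)"
    proof (rule DERIV_inverse_function[where f = ?f and g = r and x = x, OF D _ x])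
      show "- (deriv P (r x) / r x) / g \<noteq> 0"
        using pressure_law_deriv_pos[OF P pos[OF x']] pos[OF x'] g by simp
      show "?f (r y) = y" if "u < y" "y < v" for y
        using hr[of y] that g by simp
      show "isCont r x"
        using cont_r x by (intro continuous_on_interior[of "{u..v}"]) auto
    qed
    then show ?thesis
      using pressure_law_deriv_pos[OF P pos[OF x']] pos[OF x'] g by (simp add: field_simps)
  qed
qed

text \<open>The coefficients jump at the interface, but each side extends continuously to it. This
  yields bounds on both sides up to the interface.\<close>

lemma piecewise_continuous_ivl:
  fixes A B :: "real \<Rightarrow> real"
  assumes "a < 0" "0 < b" "continuous_on {a..0} A" "continuous_on {0..b} B"
    and F: "\<And>x. a < x \<Longrightarrow> x < b \<Longrightarrow> F x = (if x < 0 then A x else B x)"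
  shows "F \<in> borel_measurable (ivl a b)" "\<exists>C. \<forall>x. a < x \<and> x < b \<longrightarrow> \<bar>F x\<bar> \<le> C"
    "(\<And>x. x \<in> {a..0} \<Longrightarrow> A x > 0) \<Longrightarrow> (\<And>x. x \<in> {0..b} \<Longrightarrow> B x > 0) \<Longrightarrow>
      \<exists>c>0. \<forall>x. a < x \<and> x < b \<longrightarrow> c \<le> F x"
proof -
  let ?G = "\<lambda>x. indicator {a<..<0} x * A x + indicator {0<..<b} x * B x + indicator {0} x * B 0"
  have "(\<lambda>x. indicator {a<..<0} x * A x) \<in> borel_measurable (ivl a b)"
    "(\<lambda>x. indicator {0<..<b} x * B x) \<in> borel_measurable (ivl a b)"
    using L2_ivl_indicator L2_ivl_continuous assms(3,4) unfolding L2_def by blast+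
  moreover have "(\<lambda>x. indicator {0} x * B 0) \<in> borel_measurable (ivl a b)"
    by (rule measurable_ivl) simp
  ultimately have "?G \<in> borel_measurable (ivl a b)" by (intro borel_measurable_add)
  moreover have "F x = ?G x" if "x \<in> space (ivl a b)" for x
    using that F[of x] by (auto simp: indicator_def)
  ultimately show "F \<in> borel_measurable (ivl a b)"
    by (subst measurable_cong[where g = ?G])
  have "bounded (A ` {a..0})" "bounded (B ` {0..b})"
    using assms by (auto intro!: compact_imp_bounded compact_continuous_image)
  then obtain C1 C2 where "\<forall>x\<in>{a..0}. \<bar>A x\<bar> \<le> C1" "\<forall>x\<in>{0..b}. \<bar>B x\<bar> \<le> C2"
    by (auto simp: bounded_iff)
  then have "\<bar>F x\<bar> \<le> max C1 C2" if "a < x \<and> x < b" for x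
    using that F[of x] by (auto simp: le_max_iff_disj)
  then show "\<exists>C. \<forall>x. a < x \<and> x < b \<longrightarrow> \<bar>F x\<bar> \<le> C" by blast
  assume pos: "\<And>x. x \<in> {a..0} \<Longrightarrow> A x > 0" "\<And>x. x \<in> {0..b} \<Longrightarrow> B x > 0"
  obtain y where y: "y \<in> {a..0}" "\<forall>x\<in>{a..0}. A y \<le> A x"
    using continuous_attains_inf[OF compact_Icc _ assms(3)] assms(1) by auto
  obtain z where z: "z \<in> {0..b}" "\<forall>x\<in>{0..b}. B z \<le> B x"
    using continuous_attains_inf[OF compact_Icc _ assms(4)] assms(2) by auto
  have "min (A y) (B z) \<le> F x" if "a < x \<and> x < b" for x
    using that F[of x] y z by (auto simp: min_le_iff_disj)
  moreover have "min (A y) (B z) > 0" using pos y z by auto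
  ultimately show "\<exists>c>0. \<forall>x. a < x \<and> x < b \<longrightarrow> c \<le> F x" by blast
qed

context compressible_RT
begin

text \<open>The density of the lower layer, extended continuously to the interface; \<open>rp\<close> plays the
  same role above.\<close>

definition rm :: "real \<Rightarrow> real" where
  "rm x = inv_into {0<..} (enthalpy Pm) (enthalpy Pm \<rho>m - g * x)"

definition rp :: "real \<Rightarrow> real" where
  "rp x = inv_into {0<..} (enthalpy Pp) (enthalpy Pp \<rho>p - g * x)"

lemma rho_m_pos: "\<rho>m > 0" using rho_m_in_Z by simp

lemma rho_p: "\<rho>p > 0" "Pp \<rho>p = Pm \<rho>m"
proof -
  have "Pm \<rho>m \<in> Pp ` {0<..}" using rho_m_in_Z by simp
  then show "\<rho>p > 0" "Pp \<rho>p = Pm \<rho>m"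
    unfolding \<rho>p_def using inv_into_into[of "Pm \<rho>m" Pp "{0<..}"] f_inv_into_f[of "Pm \<rho>m" Pp "{0<..}"] by auto
qed

lemma jump_pos: "jump > 0"
proof -
  have "Pp \<rho>m < Pp \<rho>p" using rho_m_in_Z rho_p by simp
  moreover have "strict_mono_on {0<..} Pp" using pressure by (simp add: pressure_law_def)
  ultimately have "\<rho>m < \<rho>p"
    using rho_m_pos rho_p(1) by (meson greaterThan_iff strict_mono_on_less)
  then show ?thesis by (simp add: jump_def)
qed

lemma rm_facts:
  shows "\<And>x. x \<in> {-m..0} \<Longrightarrow> rm x > 0" "continuous_on {-m..0} rm"
    "\<And>x. - m < x \<Longrightarrow> x < 0 \<Longrightarrow> (rm has_real_derivative - (g * rm x / deriv Pm (rm x))) (at x)"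
    "rm 0 = \<rho>m"
proof -
  have ends: "enthalpy Pm \<rho>m - g * (- m) \<in> enthalpy Pm ` {0<..}" "enthalpy Pm \<rho>m - g * 0 \<in> enthalpy Pm ` {0<..}"
    using enthalpy_range_m rho_m_pos by auto
  have "- m < 0" using m_pos by simp
  note H = hydrostatic_layer[OF pressure(2) g_pos this ends, folded rm_def]
  show "\<And>x. x \<in> {-m..0} \<Longrightarrow> rm x > 0" "continuous_on {-m..0} rm"
    "\<And>x. - m < x \<Longrightarrow> x < 0 \<Longrightarrow> (rm has_real_derivative - (g * rm x / deriv Pm (rm x))) (at x)"
    using H by auto
  show "rm 0 = \<rho>m"
    using inv_into_f_f[OF enthalpy_inj[OF pressure(2)], of \<rho>m] rho_m_pos by (simp add: rm_def)
qed

lemma rp_facts: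
  shows "\<And>x. x \<in> {0..l} \<Longrightarrow> rp x > 0" "continuous_on {0..l} rp"
    "\<And>x. 0 < x \<Longrightarrow> x < l \<Longrightarrow> (rp has_real_derivative - (g * rp x / deriv Pp (rp x))) (at x)"
    "rp 0 = \<rho>p"
proof -
  have ends: "enthalpy Pp \<rho>p - g * 0 \<in> enthalpy Pp ` {0<..}" "enthalpy Pp \<rho>p - g * l \<in> enthalpy Pp ` {0<..}"
    using enthalpy_range_p rho_p by (auto simp: \<rho>p_def)
  note H = hydrostatic_layer[OF pressure(1) g_pos l_pos ends, folded rp_def]
  show "\<And>x. x \<in> {0..l} \<Longrightarrow> rp x > 0" "continuous_on {0..l} rp"
    "\<And>x. 0 < x \<Longrightarrow> x < l \<Longrightarrow> (rp has_real_derivative - (g * rp x / deriv Pp (rp x))) (at x)"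
    using H by auto
  show "rp 0 = \<rho>p"
    using inv_into_f_f[OF enthalpy_inj[OF pressure(1)], of \<rho>p] rho_p by (simp add: rp_def)
qed

lemma rho0_eq: "\<rho>0 x = (if x < 0 then rm x else rp x)"
  by (simp add: \<rho>0_def rm_def rp_def)

lemma at_steady_eq: "at_steady fp fm x = (if x < 0 then fm (rm x) else fp (rp x))"
  by (simp add: at_steady_def rho0_eq)

lemma continuous_on_layers:
  assumes "\<And>z. z > 0 \<Longrightarrow> isCont fm z" "\<And>z. z > 0 \<Longrightarrow> isCont fp z"
  shows "continuous_on {-m..0} (\<lambda>x. fm (rm x))" "continuous_on {0..l} (\<lambda>x. fp (rp x))"
proof -
  have "continuous_on {0<..} fm" "continuous_on {0<..} fp"
    using assms by (auto intro!: continuous_at_imp_continuous_on)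
  then show "continuous_on {-m..0} (\<lambda>x. fm (rm x))" "continuous_on {0..l} (\<lambda>x. fp (rp x))"
    using rm_facts(1,2) rp_facts(1,2) by (auto intro!: continuous_on_compose2[where t = "{0<..}"])
qed

lemma at_steady_facts:
  assumes "\<And>z. z > 0 \<Longrightarrow> isCont fm z" "\<And>z. z > 0 \<Longrightarrow> isCont fp z"
  shows "at_steady fp fm \<in> borel_measurable (ivl (-m) l)"
    "\<exists>C. \<forall>x. - m < x \<and> x < l \<longrightarrow> \<bar>at_steady fp fm x\<bar> \<le> C"
    "(\<And>z. z > 0 \<Longrightarrow> fm z > 0) \<Longrightarrow> (\<And>z. z > 0 \<Longrightarrow> fp z > 0) \<Longrightarrow>
      \<exists>c>0. \<forall>x. - m < x \<and> x < l \<longrightarrow> c \<le> at_steady fp fm x"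
proof -
  have "- m < 0" using m_pos by simp
  note P = piecewise_continuous_ivl[where F = "at_steady fp fm", OF this l_pos
      continuous_on_layers(1)[where fm = fm, OF assms] continuous_on_layers(2)[where fp = fp, OF assms] at_steady_eq]
  show "at_steady fp fm \<in> borel_measurable (ivl (-m) l)"
    "\<exists>C. \<forall>x. - m < x \<and> x < l \<longrightarrow> \<bar>at_steady fp fm x\<bar> \<le> C" using P(1,2) by blast+
  assume "\<And>z. z > 0 \<Longrightarrow> fm z > 0" "\<And>z. z > 0 \<Longrightarrow> fp z > 0"
  then show "\<exists>c>0. \<forall>x. - m < x \<and> x < l \<longrightarrow> c \<le> at_steady fp fm x"
    using rm_facts(1) rp_facts(1) by (intro P(3)) auto
qed

lemma continuity_of_laws:
  assumes "z > 0"
  shows "isCont \<epsilon>p z" "isCont \<epsilon>m z" "isCont \<delta>p z" "isCont \<delta>m z" "isCont (deriv Pp) z" "isCont (deriv Pm) z"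
    "deriv Pp z > 0" "deriv Pm z > 0"
  using assms viscosity_smooth pressure smooth_on_Ioi_D pressure_law_deriv_pos
  unfolding pressure_law_def by auto

lemma rho0_at_steady: "\<rho>0 = at_steady (\<lambda>z. z) (\<lambda>z. z)"
  by (auto simp: at_steady_def)

lemma coefficients_measurable:
  "\<rho>0 \<in> borel_measurable (ivl (-m) l)" "dP0 \<in> borel_measurable (ivl (-m) l)"
  "\<epsilon>0 \<in> borel_measurable (ivl (-m) l)" "\<delta>0 \<in> borel_measurable (ivl (-m) l)"
  unfolding rho0_at_steady dP0_def \<epsilon>0_def \<delta>0_def
  by (intro at_steady_facts continuity_of_laws continuous_ident | assumption)+

lemma coefficients_lower:
  "\<exists>c>0. \<forall>x. - m < x \<and> x < l \<longrightarrow> c \<le> \<rho>0 x \<and> c \<le> dP0 x \<and> c \<le> \<epsilon>0 x"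
proof -
  have "\<exists>c>0. \<forall>x. - m < x \<and> x < l \<longrightarrow> c \<le> \<rho>0 x"
    unfolding rho0_at_steady by (rule at_steady_facts(3)) auto
  moreover have "\<exists>c>0. \<forall>x. - m < x \<and> x < l \<longrightarrow> c \<le> dP0 x"
    unfolding dP0_def by (rule at_steady_facts(3)) (auto intro: continuity_of_laws)
  moreover have "\<exists>c>0. \<forall>x. - m < x \<and> x < l \<longrightarrow> c \<le> \<epsilon>0 x"
    unfolding \<epsilon>0_def by (rule at_steady_facts(3)) (auto intro: continuity_of_laws viscosity_sign)
  ultimately obtain c1 c2 c3 where c: "c1 > 0" "c2 > 0" "c3 > 0" 
    "\<forall>x. - m < x \<and> x < l \<longrightarrow> c1 \<le> \<rho>0 x" "\<forall>x. - m < x \<and> x < l \<longrightarrow> c2 \<le> dP0 x"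
    "\<forall>x. - m < x \<and> x < l \<longrightarrow> c3 \<le> \<epsilon>0 x" by blast
  then show ?thesis
    by (intro exI[of _ "min c1 (min c2 c3)"]) (auto simp: min_le_iff_disj)
qed

lemma coefficients_upper:
  "\<exists>C>0. \<forall>x. - m < x \<and> x < l \<longrightarrow> \<rho>0 x \<le> C \<and> dP0 x \<le> C \<and> \<epsilon>0 x \<le> C \<and> \<delta>0 x \<le> C"
proof -
  have "\<exists>C. \<forall>x. - m < x \<and> x < l \<longrightarrow> \<bar>\<rho>0 x\<bar> \<le> C"
    unfolding rho0_at_steady by (rule at_steady_facts(2)) auto
  moreover have "\<exists>C. \<forall>x. - m < x \<and> x < l \<longrightarrow> \<bar>dP0 x\<bar> \<le> C"
    unfolding dP0_def by (rule at_steady_facts(2)) (auto intro: continuity_of_laws)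
  moreover have "\<exists>C. \<forall>x. - m < x \<and> x < l \<longrightarrow> \<bar>\<epsilon>0 x\<bar> \<le> C"
    unfolding \<epsilon>0_def by (rule at_steady_facts(2)) (auto intro: continuity_of_laws)
  moreover have "\<exists>C. \<forall>x. - m < x \<and> x < l \<longrightarrow> \<bar>\<delta>0 x\<bar> \<le> C"
    unfolding \<delta>0_def by (rule at_steady_facts(2)) (auto intro: continuity_of_laws)
  ultimately obtain c1 c2 c3 c4 where c: 
    "\<forall>x. - m < x \<and> x < l \<longrightarrow> \<bar>\<rho>0 x\<bar> \<le> c1" "\<forall>x. - m < x \<and> x < l \<longrightarrow> \<bar>dP0 x\<bar> \<le> c2"
    "\<forall>x. - m < x \<and> x < l \<longrightarrow> \<bar>\<epsilon>0 x\<bar> \<le> c3" "\<forall>x. - m < x \<and> x < l \<longrightarrow> \<bar>\<delta>0 x\<bar> \<le> c4" by blast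
  then have "\<rho>0 x \<le> \<bar>c1\<bar> + \<bar>c2\<bar> + \<bar>c3\<bar> + \<bar>c4\<bar> + 1 \<and> dP0 x \<le> \<bar>c1\<bar> + \<bar>c2\<bar> + \<bar>c3\<bar> + \<bar>c4\<bar> + 1 \<and>
      \<epsilon>0 x \<le> \<bar>c1\<bar> + \<bar>c2\<bar> + \<bar>c3\<bar> + \<bar>c4\<bar> + 1 \<and> \<delta>0 x \<le> \<bar>c1\<bar> + \<bar>c2\<bar> + \<bar>c3\<bar> + \<bar>c4\<bar> + 1"
    if "- m < x \<and> x < l" for x
    using that c[rule_format, OF that] by (auto simp: abs_le_iff)
  then show ?thesis by (intro exI[of _ "\<bar>c1\<bar> + \<bar>c2\<bar> + \<bar>c3\<bar> + \<bar>c4\<bar> + 1"]) auto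
qed

lemma delta0_nonneg: "- m < x \<Longrightarrow> x < l \<Longrightarrow> \<delta>0 x \<ge> 0"
  using rm_facts(1)[of x] rp_facts(1)[of x] viscosity_sign by (auto simp: \<delta>0_def at_steady_eq)

end


section \<open>Estimates for the energy\<close>

context compressible_RT
begin

abbreviation dom :: "real measure" where "dom \<equiv> ivl (- m) l"

definition lower :: real where
  "lower = (SOME c. c > 0 \<and> (\<forall>x. - m < x \<and> x < l \<longrightarrow> c \<le> \<rho>0 x \<and> c \<le> dP0 x \<and> c \<le> \<epsilon>0 x))"

definition upper :: real where
  "upper = (SOME C. C > 0 \<and> (\<forall>x. - m < x \<and> x < l \<longrightarrow> \<rho>0 x \<le> C \<and> dP0 x \<le> C \<and> \<epsilon>0 x \<le> C \<and> \<delta>0 x \<le> C))"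

lemma lower: "lower > 0"
  "- m < x \<Longrightarrow> x < l \<Longrightarrow> lower \<le> \<rho>0 x" "- m < x \<Longrightarrow> x < l \<Longrightarrow> lower \<le> dP0 x"
  "- m < x \<Longrightarrow> x < l \<Longrightarrow> lower \<le> \<epsilon>0 x"
  using someI_ex[OF coefficients_lower] unfolding lower_def by blast+

lemma upper: "upper > 0"
  "- m < x \<Longrightarrow> x < l \<Longrightarrow> \<rho>0 x \<le> upper" "- m < x \<Longrightarrow> x < l \<Longrightarrow> dP0 x \<le> upper"
  "- m < x \<Longrightarrow> x < l \<Longrightarrow> \<epsilon>0 x \<le> upper" "- m < x \<Longrightarrow> x < l \<Longrightarrow> \<delta>0 x \<le> upper"
  using someI_ex[OF coefficients_upper] unfolding upper_def by blast+

lemma coefficients_pos: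
  assumes "- m < x" "x < l"
  shows "\<rho>0 x > 0" "dP0 x > 0" "\<epsilon>0 x > 0" "\<delta>0 x \<ge> 0"
  using lower(1) lower(2-4)[OF assms] delta0_nonneg[OF assms] by auto

text \<open>Multiplication by such a function preserves square integrability and convergence in \<open>L\<^sup>2\<close>.\<close>

definition coefficient :: "(real \<Rightarrow> real) \<Rightarrow> bool" where
  "coefficient w \<longleftrightarrow> w \<in> borel_measurable dom \<and> (\<exists>C. \<forall>x. - m < x \<and> x < l \<longrightarrow> \<bar>w x\<bar> \<le> C)"

lemma coefficient_basic: "coefficient \<rho>0" "coefficient dP0" "coefficient \<epsilon>0" "coefficient \<delta>0"
    "coefficient (\<lambda>_. k)" "coefficient (\<lambda>x. inverse (dP0 x))"
proof -
  have "\<bar>inverse (dP0 x)\<bar> \<le> inverse lower" if "- m < x \<and> x < l" for x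
    using coefficients_pos(2)[of x] lower(3)[of x] lower(1) that by (simp add: le_imp_inverse_le)
  then show "coefficient (\<lambda>x. inverse (dP0 x))"
    using borel_measurable_inverse[OF coefficients_measurable(2)] unfolding coefficient_def by blast
  have bounded: "coefficient w"
    if "w \<in> borel_measurable dom" "\<And>x. - m < x \<Longrightarrow> x < l \<Longrightarrow> 0 \<le> w x \<and> w x \<le> upper" for w
    unfolding coefficient_def using that by (auto intro!: exI[of _ upper])
  show "coefficient \<rho>0" "coefficient dP0" "coefficient \<epsilon>0" "coefficient \<delta>0"
    by (intro bounded coefficients_measurable conjI upper coefficients_pos less_imp_le[OF coefficients_pos(1)]
        less_imp_le[OF coefficients_pos(2)] less_imp_le[OF coefficients_pos(3)]; assumption)+
  show "coefficient (\<lambda>_. k)" unfolding coefficient_def by auto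
qed

lemma coefficient_mult:
  assumes "coefficient v" "coefficient w" shows "coefficient (\<lambda>x. v x * w x)"
proof -
  obtain A B where AB: "\<forall>x. - m < x \<and> x < l \<longrightarrow> \<bar>v x\<bar> \<le> A" "\<forall>x. - m < x \<and> x < l \<longrightarrow> \<bar>w x\<bar> \<le> B"
    and "v \<in> borel_measurable dom" "w \<in> borel_measurable dom"
    using assms unfolding coefficient_def by blast
  moreover have "\<bar>v x * w x\<bar> \<le> A * B" if "- m < x \<and> x < l" for x
    using AB[rule_format, OF that] unfolding abs_mult by (intro mult_mono) auto
  ultimately show ?thesis unfolding coefficient_def by (auto intro!: exI[of _ "A * B"])
qed

lemma L2_coefficient:
  assumes "coefficient w" "L2 dom u" shows "L2 dom (\<lambda>x. w x * u x)"
  using assms L2_mult_bounded[of dom u w] unfolding coefficient_def by fastforce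

lemma integrable_coefficient:
  assumes "coefficient w" "L2 dom u" "L2 dom v"
  shows "integrable dom (\<lambda>x. w x * (u x * v x))"
  using L2_integrable_mult[OF L2_coefficient[OF assms(1,2)] assms(3)] by (simp add: mult.assoc)

lemma integrable_coefficient_square:
  "coefficient w \<Longrightarrow> L2 dom u \<Longrightarrow> integrable dom (\<lambda>x. w x * (u x)\<^sup>2)"
  using integrable_coefficient[of w u u] by (simp add: power2_eq_square)

lemma ml: "- m < l" "0 \<in> {- m..l}" "- m < 0"
  using m_pos l_pos by auto

text \<open>The integrand of the energy without surface tension and viscosity.\<close>

definition elastic :: "real \<Rightarrow> (real \<Rightarrow> real) \<Rightarrow> (real \<Rightarrow> real) \<Rightarrow> real \<Rightarrow> real" where
  "elastic \<xi> \<phi> \<psi> x = dP0 x * \<rho>0 x * (D \<psi> x + \<xi> * \<phi> x)\<^sup>2 - 2 * g * \<xi> * \<rho>0 x * (\<phi> x * \<psi> x)"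

definition viscous :: "real \<Rightarrow> (real \<Rightarrow> real) \<Rightarrow> (real \<Rightarrow> real) \<Rightarrow> real \<Rightarrow> real" where
  "viscous \<xi> \<phi> \<psi> x = \<delta>0 x * (D \<psi> x + \<xi> * \<phi> x)\<^sup>2 +
     \<epsilon>0 x * ((D \<phi> x - \<xi> * \<psi> x)\<^sup>2 + (D \<psi> x - \<xi> * \<phi> x)\<^sup>2 + 1/3 * (D \<psi> x + \<xi> * \<phi> x)\<^sup>2)"

definition dissipation :: "real \<Rightarrow> (real \<Rightarrow> real) \<Rightarrow> (real \<Rightarrow> real) \<Rightarrow> real" where
  "dissipation \<xi> \<phi> \<psi> = 1/2 * (\<integral>x. viscous \<xi> \<phi> \<psi> x \<partial>dom)"

lemma J_eq: "J \<phi> \<psi> = 1/2 * (\<integral>x. \<rho>0 x * ((\<phi> x)\<^sup>2 + (\<psi> x)\<^sup>2) \<partial>dom)"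
  by (simp add: J_def set_integral_ivl)

context
  fixes \<phi> \<psi> :: "real \<Rightarrow> real"
  assumes H: "\<phi> \<in> H01 (- m) l" "\<psi> \<in> H01 (- m) l"
begin

lemma L2_fields: "L2 dom \<phi>" "L2 dom \<psi>" "L2 dom (D \<phi>)" "L2 dom (D \<psi>)"
  using H01_D[OF H(1)] H01_D[OF H(2)] by auto

lemma L2_combinations:
  "L2 dom (\<lambda>x. D \<psi> x + \<xi> * \<phi> x)" "L2 dom (\<lambda>x. D \<psi> x - \<xi> * \<phi> x)" "L2 dom (\<lambda>x. D \<phi> x - \<xi> * \<psi> x)"
  by (intro L2_add L2_diff L2_cmult L2_fields)+

lemma integrable_elastic: "integrable dom (elastic \<xi> \<phi> \<psi>)"
  unfolding elastic_def
  by (intro Bochner_Integration.integrable_diff integrable_coefficient_square integrable_coefficient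
      coefficient_mult coefficient_basic L2_combinations L2_fields)

lemma integrable_viscous_parts:
  "integrable dom (\<lambda>x. \<delta>0 x * (D \<psi> x + \<xi> * \<phi> x)\<^sup>2)"
  "integrable dom (\<lambda>x. \<epsilon>0 x * ((D \<phi> x - \<xi> * \<psi> x)\<^sup>2 + (D \<psi> x - \<xi> * \<phi> x)\<^sup>2 + 1/3 * (D \<psi> x + \<xi> * \<phi> x)\<^sup>2))"
proof -
  show "integrable dom (\<lambda>x. \<delta>0 x * (D \<psi> x + \<xi> * \<phi> x)\<^sup>2)"
    by (intro integrable_coefficient_square coefficient_basic L2_combinations)
  have "integrable dom (\<lambda>x. \<epsilon>0 x * (D \<phi> x - \<xi> * \<psi> x)\<^sup>2 + \<epsilon>0 x * (D \<psi> x - \<xi> * \<phi> x)\<^sup>2 +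
      1/3 * (\<epsilon>0 x * (D \<psi> x + \<xi> * \<phi> x)\<^sup>2))"
    by (intro Bochner_Integration.integrable_add integrable_mult_right integrable_coefficient_square
        coefficient_basic L2_combinations)
  then show "integrable dom (\<lambda>x. \<epsilon>0 x * ((D \<phi> x - \<xi> * \<psi> x)\<^sup>2 + (D \<psi> x - \<xi> * \<phi> x)\<^sup>2 + 1/3 * (D \<psi> x + \<xi> * \<phi> x)\<^sup>2))"
    by (simp add: algebra_simps)
qed

lemma integrable_viscous: "integrable dom (viscous \<xi> \<phi> \<psi>)"
  unfolding viscous_def by (intro Bochner_Integration.integrable_add integrable_viscous_parts)

lemma integrable_J: "integrable dom (\<lambda>x. \<rho>0 x * ((\<phi> x)\<^sup>2 + (\<psi> x)\<^sup>2))"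
  unfolding distrib_left
  by (intro Bochner_Integration.integrable_add integrable_coefficient_square coefficient_basic L2_fields)

lemma energy_eq:
  "energy \<xi> s \<phi> \<psi> = \<sigma> * \<xi>\<^sup>2 / 2 * (\<psi> 0)\<^sup>2 + 1/2 * (\<integral>x. elastic \<xi> \<phi> \<psi> x \<partial>dom) + s * dissipation \<xi> \<phi> \<psi>"
proof -
  let ?a = "\<lambda>x. \<delta>0 x * (D \<psi> x + \<xi> * \<phi> x)\<^sup>2"
  let ?b = "\<lambda>x. \<epsilon>0 x * ((D \<phi> x - \<xi> * \<psi> x)\<^sup>2 + (D \<psi> x - \<xi> * \<phi> x)\<^sup>2 + 1/3 * (D \<psi> x + \<xi> * \<phi> x)\<^sup>2)"
  have "(\<integral>x. (s * \<delta>0 x + dP0 x * \<rho>0 x) * (D \<psi> x + \<xi> * \<phi> x)\<^sup>2 - 2 * g * \<rho>0 x * \<xi> * \<phi> x * \<psi> x \<partial>dom)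
      = (\<integral>x. elastic \<xi> \<phi> \<psi> x + s * ?a x \<partial>dom)"
    by (intro Bochner_Integration.integral_cong) (auto simp: elastic_def algebra_simps)
  also have "\<dots> = (\<integral>x. elastic \<xi> \<phi> \<psi> x \<partial>dom) + s * (\<integral>x. ?a x \<partial>dom)"
    by (subst Bochner_Integration.integral_add[OF integrable_elastic integrable_mult_right[OF integrable_viscous_parts(1)]]) simp
  finally have 1: "(\<integral>x. (s * \<delta>0 x + dP0 x * \<rho>0 x) * (D \<psi> x + \<xi> * \<phi> x)\<^sup>2 - 2 * g * \<rho>0 x * \<xi> * \<phi> x * \<psi> x \<partial>dom)
    = (\<integral>x. elastic \<xi> \<phi> \<psi> x \<partial>dom) + s * (\<integral>x. ?a x \<partial>dom)" .
  have 2: "(\<integral>x. s * \<epsilon>0 x * ((D \<phi> x - \<xi> * \<psi> x)\<^sup>2 + (D \<psi> x - \<xi> * \<phi> x)\<^sup>2 + 1/3 * (D \<psi> x + \<xi> * \<phi> x)\<^sup>2) \<partial>dom)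
    = s * (\<integral>x. ?b x \<partial>dom)"
    by (simp only: mult.assoc integral_mult_right_zero)
  have 3: "(\<integral>x. viscous \<xi> \<phi> \<psi> x \<partial>dom) = (\<integral>x. ?a x \<partial>dom) + (\<integral>x. ?b x \<partial>dom)"
    unfolding viscous_def by (rule Bochner_Integration.integral_add[OF integrable_viscous_parts])
  show ?thesis
    unfolding energy_def set_integral_ivl 1 2 dissipation_def 3 by (simp add: algebra_simps)
qed

lemma energy_affine: "energy \<xi> s \<phi> \<psi> = energy \<xi> 0 \<phi> \<psi> + s * dissipation \<xi> \<phi> \<psi>"
  by (simp add: energy_eq)

lemma dissipation_nonneg: "dissipation \<xi> \<phi> \<psi> \<ge> 0"
  unfolding dissipation_def viscous_def
  by (auto intro!: mult_nonneg_nonneg Bochner_Integration.integral_nonneg add_nonneg_nonneg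
      coefficients_pos(4) less_imp_le[OF coefficients_pos(3)])

text \<open>Only the gravity term can be negative, and \<open>2 \<phi> \<psi> \<le> \<phi>\<^sup>2 + \<psi>\<^sup>2\<close>.\<close>

lemma energy_lower_bound:
  assumes "\<xi> \<ge> 0" shows "energy \<xi> 0 \<phi> \<psi> \<ge> - (g * \<xi>) * J \<phi> \<psi>"
proof -
  have "(\<integral>x. - (g * \<xi>) * (\<rho>0 x * ((\<phi> x)\<^sup>2 + (\<psi> x)\<^sup>2)) \<partial>dom) \<le> (\<integral>x. elastic \<xi> \<phi> \<psi> x \<partial>dom)"
  proof (rule integral_mono[OF integrable_mult_right[OF integrable_J] integrable_elastic])
    fix x assume "x \<in> space dom"
    then have x: "- m < x" "x < l" by auto
    have "0 \<le> g * \<xi> * \<rho>0 x * (\<phi> x - \<psi> x)\<^sup>2" "0 \<le> dP0 x * \<rho>0 x * (D \<psi> x + \<xi> * \<phi> x)\<^sup>2"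
      using coefficients_pos[OF x] g_pos assms by simp_all
    then show "- (g * \<xi>) * (\<rho>0 x * ((\<phi> x)\<^sup>2 + (\<psi> x)\<^sup>2)) \<le> elastic \<xi> \<phi> \<psi> x"
      unfolding elastic_def power2_diff by (simp add: algebra_simps)
  qed
  moreover have "0 \<le> \<sigma> * \<xi>\<^sup>2 / 2 * (\<psi> 0)\<^sup>2" using sigma_nonneg by simp
  ultimately show ?thesis by (simp add: energy_eq J_eq)
qed

text \<open>Pointwise, the viscous integrand does not control all of \<open>\<phi>', \<psi>', \<xi> \<phi>, \<xi> \<psi>\<close>. However,
  \<open>\<integral> (\<phi>' \<psi> + \<phi> \<psi>')\<close> vanishes by integration by parts, and adding the right multiple of it
  cancels the mixed products up to a square. This is possible only with a constant
  weight, so \<open>\<epsilon>\<^sub>0\<close> is first replaced by its lower bound.\<close>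

lemma dissipation_coercive:
  "dissipation \<xi> \<phi> \<psi> \<ge> lower / 2 * (\<integral>x. (D \<phi> x)\<^sup>2 + (D \<psi> x)\<^sup>2 + \<xi>\<^sup>2 * ((\<phi> x)\<^sup>2 + (\<psi> x)\<^sup>2) \<partial>dom)"
proof -
  have int: "integrable dom (\<lambda>x. D \<phi> x * \<psi> x)" "integrable dom (\<lambda>x. \<phi> x * D \<psi> x)"
    by (intro L2_integrable_mult L2_fields)+
  have cross: "(\<integral>x. 2 * lower * \<xi> * (D \<phi> x * \<psi> x + \<phi> x * D \<psi> x) \<partial>dom) = 0"
    using int H01_integration_by_parts[OF H] by simp
  have "lower * (\<integral>x. (D \<phi> x)\<^sup>2 + (D \<psi> x)\<^sup>2 + \<xi>\<^sup>2 * ((\<phi> x)\<^sup>2 + (\<psi> x)\<^sup>2) \<partial>dom)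
      = (\<integral>x. lower * ((D \<phi> x)\<^sup>2 + (D \<psi> x)\<^sup>2 + \<xi>\<^sup>2 * ((\<phi> x)\<^sup>2 + (\<psi> x)\<^sup>2)) \<partial>dom)"
    by simp
  also have "\<dots> \<le> (\<integral>x. viscous \<xi> \<phi> \<psi> x + 2 * lower * \<xi> * (D \<phi> x * \<psi> x + \<phi> x * D \<psi> x) \<partial>dom)"
  proof (rule integral_mono)
    show "integrable dom (\<lambda>x. lower * ((D \<phi> x)\<^sup>2 + (D \<psi> x)\<^sup>2 + \<xi>\<^sup>2 * ((\<phi> x)\<^sup>2 + (\<psi> x)\<^sup>2)))"
      by (intro integrable_mult_right Bochner_Integration.integrable_add L2_integrable_square L2_fields)
    show "integrable dom (\<lambda>x. viscous \<xi> \<phi> \<psi> x + 2 * lower * \<xi> * (D \<phi> x * \<psi> x + \<phi> x * D \<psi> x))"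
      by (intro integrable_mult_right Bochner_Integration.integrable_add integrable_viscous int)
    fix x assume "x \<in> space dom"
    then have x: "- m < x" "x < l" by auto
    define p q r t where "p = D \<phi> x" and "q = D \<psi> x" and "r = \<xi> * \<phi> x" and "t = \<xi> * \<psi> x"
    let ?Q = "(p - t)\<^sup>2 + (q - r)\<^sup>2 + 1/3 * (q + r)\<^sup>2"
    have "p\<^sup>2 + q\<^sup>2 + r\<^sup>2 + t\<^sup>2 \<le> ?Q + 2 * (p * t + r * q)"
    proof -
      have "?Q + 2 * (p * t + r * q) - (p\<^sup>2 + q\<^sup>2 + r\<^sup>2 + t\<^sup>2) = 1/3 * (q + r)\<^sup>2"
        by (simp add: power2_eq_square algebra_simps)
      then show ?thesis using zero_le_power2[of "q + r"] by linarith
    qed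
    then have "lower * (p\<^sup>2 + q\<^sup>2 + r\<^sup>2 + t\<^sup>2) \<le> lower * (?Q + 2 * (p * t + r * q))"
      using lower(1) by (intro mult_left_mono) auto
    moreover have "lower * ?Q \<le> \<epsilon>0 x * ?Q"
      using lower(4)[OF x] by (intro mult_right_mono) auto
    moreover have "0 \<le> \<delta>0 x * (q + r)\<^sup>2" using coefficients_pos(4)[OF x] by simp
    ultimately have "lower * (p\<^sup>2 + q\<^sup>2 + r\<^sup>2 + t\<^sup>2) \<le> \<delta>0 x * (q + r)\<^sup>2 + \<epsilon>0 x * ?Q + 2 * lower * (p * t + r * q)"
      unfolding distrib_left[of lower ?Q] by linarith
    then show "lower * ((D \<phi> x)\<^sup>2 + (D \<psi> x)\<^sup>2 + \<xi>\<^sup>2 * ((\<phi> x)\<^sup>2 + (\<psi> x)\<^sup>2))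
        \<le> viscous \<xi> \<phi> \<psi> x + 2 * lower * \<xi> * (D \<phi> x * \<psi> x + \<phi> x * D \<psi> x)"
      unfolding viscous_def p_def q_def r_def t_def by (simp add: power_mult_distrib algebra_simps)
  qed
  also have "\<dots> = (\<integral>x. viscous \<xi> \<phi> \<psi> x \<partial>dom)"
    by (subst Bochner_Integration.integral_add[OF integrable_viscous], unfold cross)
       (intro integrable_mult_right Bochner_Integration.integrable_add int | simp)+
  finally show ?thesis by (simp add: dissipation_def)
qed

lemma integrable_gradients: "integrable dom (\<lambda>x. (D \<phi> x)\<^sup>2 + (D \<psi> x)\<^sup>2)"
  by (intro Bochner_Integration.integrable_add L2_integrable_square L2_fields)

lemma integrable_values: "integrable dom (\<lambda>x. (\<phi> x)\<^sup>2 + (\<psi> x)\<^sup>2)"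
  by (intro Bochner_Integration.integrable_add L2_integrable_square L2_fields)

lemma dissipation_gradients:
  "(\<integral>x. (D \<phi> x)\<^sup>2 + (D \<psi> x)\<^sup>2 \<partial>dom) \<le> 2 / lower * dissipation \<xi> \<phi> \<psi>"
proof -
  have "(\<integral>x. (D \<phi> x)\<^sup>2 + (D \<psi> x)\<^sup>2 \<partial>dom) \<le> (\<integral>x. (D \<phi> x)\<^sup>2 + (D \<psi> x)\<^sup>2 + \<xi>\<^sup>2 * ((\<phi> x)\<^sup>2 + (\<psi> x)\<^sup>2) \<partial>dom)"
    by (intro integral_mono integrable_gradients Bochner_Integration.integrable_add integrable_mult_right
        L2_integrable_square L2_fields) simp
  from mult_left_mono[OF this, of "lower / 2"]
  have "lower / 2 * (\<integral>x. (D \<phi> x)\<^sup>2 + (D \<psi> x)\<^sup>2 \<partial>dom) \<le> dissipation \<xi> \<phi> \<psi>"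
    using dissipation_coercive[of \<xi>] lower(1) by linarith
  then show ?thesis using lower(1) by (simp add: field_simps)
qed

lemma dissipation_frequency:
  "lower / upper * \<xi>\<^sup>2 * J \<phi> \<psi> \<le> dissipation \<xi> \<phi> \<psi>"
proof -
  have "(\<integral>x. \<xi>\<^sup>2 / upper * (\<rho>0 x * ((\<phi> x)\<^sup>2 + (\<psi> x)\<^sup>2)) \<partial>dom)
      \<le> (\<integral>x. (D \<phi> x)\<^sup>2 + (D \<psi> x)\<^sup>2 + \<xi>\<^sup>2 * ((\<phi> x)\<^sup>2 + (\<psi> x)\<^sup>2) \<partial>dom)"
  proof (rule integral_mono[OF integrable_mult_right[OF integrable_J]])
    show "integrable dom (\<lambda>x. (D \<phi> x)\<^sup>2 + (D \<psi> x)\<^sup>2 + \<xi>\<^sup>2 * ((\<phi> x)\<^sup>2 + (\<psi> x)\<^sup>2))"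
      by (intro Bochner_Integration.integrable_add integrable_mult_right L2_integrable_square L2_fields)
    fix x assume "x \<in> space dom"
    then have x: "- m < x" "x < l" by auto
    have "\<rho>0 x * ((\<phi> x)\<^sup>2 + (\<psi> x)\<^sup>2) \<le> upper * ((\<phi> x)\<^sup>2 + (\<psi> x)\<^sup>2)"
      using upper(2)[OF x] by (intro mult_right_mono) auto
    then have "\<xi>\<^sup>2 / upper * (\<rho>0 x * ((\<phi> x)\<^sup>2 + (\<psi> x)\<^sup>2)) \<le> \<xi>\<^sup>2 / upper * (upper * ((\<phi> x)\<^sup>2 + (\<psi> x)\<^sup>2))"
      using upper(1) by (intro mult_left_mono) auto
    also have "\<dots> = \<xi>\<^sup>2 * ((\<phi> x)\<^sup>2 + (\<psi> x)\<^sup>2)" using upper(1) by simp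
    finally show "\<xi>\<^sup>2 / upper * (\<rho>0 x * ((\<phi> x)\<^sup>2 + (\<psi> x)\<^sup>2)) \<le> (D \<phi> x)\<^sup>2 + (D \<psi> x)\<^sup>2 + \<xi>\<^sup>2 * ((\<phi> x)\<^sup>2 + (\<psi> x)\<^sup>2)"
      by (smt (verit) zero_le_power2)
  qed
  from mult_left_mono[OF this, of "lower / 2"]
  have "lower / 2 * (\<integral>x. \<xi>\<^sup>2 / upper * (\<rho>0 x * ((\<phi> x)\<^sup>2 + (\<psi> x)\<^sup>2)) \<partial>dom) \<le> dissipation \<xi> \<phi> \<psi>"
    using dissipation_coercive[of \<xi>] lower(1) by linarith
  then show ?thesis by (simp add: J_eq)
qed

text \<open>Written with both gradients, the form in which the dissipation bounds it.\<close>

lemma interface_square_le: "(\<psi> 0)\<^sup>2 \<le> (l + m) * (\<integral>x. (D \<phi> x)\<^sup>2 + (D \<psi> x)\<^sup>2 \<partial>dom)"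
proof -
  have "(\<psi> 0)\<^sup>2 \<le> (l + m) * (\<integral>x. (D \<psi> x)\<^sup>2 \<partial>dom)"
    using H01_pointwise_square_le[OF H(2) ml(1,2)] by simp
  also have "\<dots> \<le> (l + m) * (\<integral>x. (D \<phi> x)\<^sup>2 + (D \<psi> x)\<^sup>2 \<partial>dom)"
    using ml by (intro mult_left_mono integral_mono integrable_gradients L2_integrable_square L2_fields) auto
  finally show ?thesis .
qed

lemma values_le_J: "(\<integral>x. (\<phi> x)\<^sup>2 + (\<psi> x)\<^sup>2 \<partial>dom) \<le> 2 / lower * J \<phi> \<psi>"
proof -
  have "lower * (\<integral>x. (\<phi> x)\<^sup>2 + (\<psi> x)\<^sup>2 \<partial>dom) = (\<integral>x. lower * ((\<phi> x)\<^sup>2 + (\<psi> x)\<^sup>2) \<partial>dom)" by simp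
  also have "\<dots> \<le> (\<integral>x. \<rho>0 x * ((\<phi> x)\<^sup>2 + (\<psi> x)\<^sup>2) \<partial>dom)"
    using lower(2) by (intro integral_mono integrable_mult_right integrable_values integrable_J mult_right_mono) auto
  finally show ?thesis using lower(1) by (simp add: J_eq field_simps)
qed

end

end


section \<open>The destabilising interface term\<close>

context compressible_RT
begin

lemma L2_tendsto_coefficient:
  assumes "coefficient w" "L2_tendsto dom u v"
  shows "L2_tendsto dom (\<lambda>n x. w x * u n x) (\<lambda>x. w x * v x)"
proof -
  obtain C where "w \<in> borel_measurable dom" "\<forall>x. - m < x \<and> x < l \<longrightarrow> \<bar>w x\<bar> \<le> C"
    using assms(1) unfolding coefficient_def by blast
  then show ?thesis by (intro L2_tendsto_mult_bounded[OF assms(2), where C = C]) auto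
qed

lemma coefficient_interface:
  "coefficient (\<lambda>x. 2 * \<rho>0 x)" "coefficient (\<lambda>x. g * \<rho>0 x * inverse (dP0 x))"
  by (intro coefficient_mult coefficient_basic)+

text \<open>Within each layer the integrand is the derivative of \<open>\<rho>\<^sub>0 \<eta>\<^sup>2\<close>, by the hydrostatic balance.
  The layers contribute \<open>\<rho>\<^sub>0(0-) \<eta>(0)\<^sup>2\<close> and \<open>- \<rho>\<^sub>0(0+) \<eta>(0)\<^sup>2\<close>.\<close>

lemma interface_identity_test:
  assumes \<eta>: "test_function (- m) l \<eta>"
  shows "(\<integral>x. (2 * \<rho>0 x * \<eta> x) * deriv \<eta> x \<partial>dom) - (\<integral>x. (g * \<rho>0 x * inverse (dP0 x) * \<eta> x) * \<eta> x \<partial>dom)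
    = - jump * (\<eta> 0)\<^sup>2"
proof -
  note L = test_function_L2[OF \<eta>]
  have int: "integrable dom (\<lambda>x. (2 * \<rho>0 x * \<eta> x) * deriv \<eta> x)"
    "integrable dom (\<lambda>x. (g * \<rho>0 x * inverse (dP0 x) * \<eta> x) * \<eta> x)"
    by (intro L2_integrable_mult L2_coefficient coefficient_interface L)+
  let ?f = "\<lambda>x. (2 * \<rho>0 x * \<eta> x) * deriv \<eta> x - (g * \<rho>0 x * inverse (dP0 x) * \<eta> x) * \<eta> x"
  have f: "integrable dom ?f" using int by simp
  have cont: "continuous_on A \<eta>" for A
    using test_functionD(2)[OF \<eta>] by (intro continuous_at_imp_continuous_on) auto
  have D: "((\<lambda>x. r x * (\<eta> x)\<^sup>2) has_real_derivative 2 * r x * \<eta> x * deriv \<eta> x - q * \<eta> x * \<eta> x) (at x)"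
    if "(r has_real_derivative - q) (at x)" for r q x
    by (rule derivative_eq_intros that test_functionD(1)[OF \<eta>] refl)+
       (simp add: power2_eq_square algebra_simps)
  have "(\<integral>x. ?f x \<partial>ivl (- m) 0) = rm 0 * (\<eta> 0)\<^sup>2 - rm (- m) * (\<eta> (- m))\<^sup>2"
  proof (rule integral_ivl_FTC)
    show "continuous_on {- m..0} (\<lambda>x. rm x * (\<eta> x)\<^sup>2)"
      by (intro continuous_intros rm_facts cont)
    show "integrable (ivl (- m) 0) ?f"
      by (rule integrable_ivl_subinterval[OF f]) (use l_pos in auto)
    fix x assume x: "- m < x" "x < 0"
    show "((\<lambda>x. rm x * (\<eta> x)\<^sup>2) has_real_derivative ?f x) (at x)"
      using D[OF rm_facts(3)[OF x]] x by (simp add: rho0_eq dP0_def at_steady_eq divide_inverse)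
  qed (use m_pos in simp)
  moreover have "(\<integral>x. ?f x \<partial>ivl 0 l) = rp l * (\<eta> l)\<^sup>2 - rp 0 * (\<eta> 0)\<^sup>2"
  proof (rule integral_ivl_FTC)
    show "continuous_on {0..l} (\<lambda>x. rp x * (\<eta> x)\<^sup>2)"
      by (intro continuous_intros rp_facts cont)
    show "integrable (ivl 0 l) ?f"
      by (rule integrable_ivl_subinterval[OF f]) (use m_pos in auto)
    fix x assume x: "0 < x" "x < l"
    show "((\<lambda>x. rp x * (\<eta> x)\<^sup>2) has_real_derivative ?f x) (at x)"
      using D[OF rp_facts(3)[OF x]] x by (simp add: rho0_eq dP0_def at_steady_eq divide_inverse)
  qed (use l_pos in simp)
  moreover have "\<eta> (- m) = 0" "\<eta> l = 0" using test_functionD(4)[OF \<eta>] by auto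
  ultimately have "(\<integral>x. ?f x \<partial>dom) = - jump * (\<eta> 0)\<^sup>2"
    using integral_ivl_split[OF f, of 0] m_pos l_pos
    by (simp add: rm_facts(4) rp_facts(4) jump_def algebra_simps)
  then show ?thesis by (subst (asm) Bochner_Integration.integral_diff[OF int]) simp
qed

lemma interface_identity:
  assumes \<psi>: "\<psi> \<in> H01 (- m) l"
  shows "(\<integral>x. (2 * \<rho>0 x * \<psi> x) * D \<psi> x \<partial>dom) - (\<integral>x. (g * \<rho>0 x * inverse (dP0 x) * \<psi> x) * \<psi> x \<partial>dom)
    = - jump * (\<psi> 0)\<^sup>2"
proof -
  obtain \<eta> where \<eta>: "\<forall>n. test_function (- m) l (\<eta> n)" "L2_tendsto dom \<eta> \<psi>"
    "L2_tendsto dom (\<lambda>n. deriv (\<eta> n)) (D \<psi>)" "\<forall>x\<in>{- m..l}. (\<lambda>n. \<eta> n x) \<longlonglongrightarrow> \<psi> x"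
    using H01_approximation_pointwise[OF \<psi> ml(1)] by blast
  let ?L = "\<lambda>n. (\<integral>x. (2 * \<rho>0 x * \<eta> n x) * deriv (\<eta> n) x \<partial>dom)
    - (\<integral>x. (g * \<rho>0 x * inverse (dP0 x) * \<eta> n x) * \<eta> n x \<partial>dom)"
  have lim: "?L \<longlonglongrightarrow> (\<integral>x. (2 * \<rho>0 x * \<psi> x) * D \<psi> x \<partial>dom) - (\<integral>x. (g * \<rho>0 x * inverse (dP0 x) * \<psi> x) * \<psi> x \<partial>dom)"
    by (intro tendsto_diff L2_tendsto_inner L2_tendsto_coefficient coefficient_interface \<eta>)
  have eq: "?L n = - jump * (\<eta> n 0)\<^sup>2" for n
    by (rule interface_identity_test) (use \<eta>(1) in blast)
  have "(\<lambda>n. \<eta> n 0) \<longlonglongrightarrow> \<psi> 0" using \<eta>(4) ml(2) by blast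
  then have "(\<lambda>n. - jump * (\<eta> n 0)\<^sup>2) \<longlonglongrightarrow> - jump * (\<psi> 0)\<^sup>2"
    by (intro tendsto_mult tendsto_const tendsto_power)
  with lim[unfolded eq] show ?thesis by (rule LIMSEQ_unique)
qed

text \<open>With \<open>w = \<psi>' + \<xi> \<phi>\<close>, the elastic integrand is
  \<open>P' \<rho>\<^sub>0 (w - g \<psi> / P')\<^sup>2 + g (2 \<rho>\<^sub>0 \<psi> \<psi>' - g \<rho>\<^sub>0 \<psi>\<^sup>2 / P')\<close>, and \<open>interface_identity\<close> evaluates the
  integral of the second term.\<close>

lemma energy_completed_square:
  assumes H: "\<phi> \<in> H01 (- m) l" "\<psi> \<in> H01 (- m) l"
  shows "energy \<xi> 0 \<phi> \<psi> = (\<sigma> * \<xi>\<^sup>2 - g * jump) / 2 * (\<psi> 0)\<^sup>2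
    + 1/2 * (\<integral>x. dP0 x * \<rho>0 x * (D \<psi> x + \<xi> * \<phi> x - g * inverse (dP0 x) * \<psi> x)\<^sup>2 \<partial>dom)"
    (is "_ = _ + 1/2 * (\<integral>x. ?S x \<partial>dom)")
proof -
  let ?a = "\<lambda>x. (2 * \<rho>0 x * \<psi> x) * D \<psi> x"
  let ?b = "\<lambda>x. (g * \<rho>0 x * inverse (dP0 x) * \<psi> x) * \<psi> x"
  note L = L2_fields[OF H]
  have int: "integrable dom ?a" "integrable dom ?b"
    by (intro L2_integrable_mult L2_coefficient coefficient_interface L)+
  have S: "integrable dom ?S"
    by (intro integrable_coefficient_square coefficient_mult coefficient_basic L2_diff
        L2_combinations[OF H] L2_coefficient L)
  have "(\<integral>x. elastic \<xi> \<phi> \<psi> x \<partial>dom) = (\<integral>x. ?S x + g * (?a x - ?b x) \<partial>dom)"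
  proof (rule Bochner_Integration.integral_cong[OF refl])
    fix x assume "x \<in> space dom"
    then have "dP0 x \<noteq> 0" using coefficients_pos(2)[of x] by auto
    then show "elastic \<xi> \<phi> \<psi> x = ?S x + g * (?a x - ?b x)"
      unfolding elastic_def by (simp add: field_simps power2_eq_square)
  qed
  also have "\<dots> = (\<integral>x. ?S x \<partial>dom) + g * ((\<integral>x. ?a x \<partial>dom) - (\<integral>x. ?b x \<partial>dom))"
    by (subst Bochner_Integration.integral_add[OF S integrable_mult_right[OF Bochner_Integration.integrable_diff[OF int]]])
       (simp only: integral_mult_right_zero Bochner_Integration.integral_diff[OF int])
  finally show ?thesis
    unfolding energy_eq[OF H] interface_identity[OF H(2)] by (simp add: field_simps)
qed

lemma energy_interface_bound:
  assumes H: "\<phi> \<in> H01 (- m) l" "\<psi> \<in> H01 (- m) l"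
  shows "energy \<xi> 0 \<phi> \<psi> \<ge> (\<sigma> * \<xi>\<^sup>2 - g * jump) / 2 * (\<psi> 0)\<^sup>2"
proof -
  have "0 \<le> (\<integral>x. dP0 x * \<rho>0 x * (D \<psi> x + \<xi> * \<phi> x - g * inverse (dP0 x) * \<psi> x)\<^sup>2 \<partial>dom)"
  proof (rule Bochner_Integration.integral_nonneg)
    fix x assume "x \<in> space dom"
    then have "dP0 x > 0" "\<rho>0 x > 0" using coefficients_pos[of x] by auto
    then show "0 \<le> dP0 x * \<rho>0 x * (D \<psi> x + \<xi> * \<phi> x - g * inverse (dP0 x) * \<psi> x)\<^sup>2" by simp
  qed
  then show ?thesis unfolding energy_completed_square[OF H] by simp
qed

lemma test_function_scale:
  assumes "test_function (- m) l f"
  shows "test_function (- m) l (\<lambda>x. t * f x)"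
    "AE x in dom. D (\<lambda>x. t * f x) x = t * D f x"
proof -
  show tf: "test_function (- m) l (\<lambda>x. t * f x)"
    using test_function_lincomb[OF assms assms, of t 0] by simp
  have "deriv (\<lambda>x. t * f x) x = t * deriv f x" for x
    by (rule DERIV_imp_deriv) (rule DERIV_cmult[OF test_functionD(1)[OF assms]])
  with test_function_H01(2)[OF tf ml(1)] test_function_H01(2)[OF assms ml(1)]
  show "AE x in dom. D (\<lambda>x. t * f x) x = t * D f x"
    by (auto elim!: eventually_elim2)
qed

text \<open>Needed to normalise a competitor to \<open>J = 1\<close>. For test functions the weak derivative is the
  classical one, which is homogeneous.\<close>

lemma energy_scale:
  assumes \<phi>: "test_function (- m) l \<phi>" and \<psi>: "test_function (- m) l \<psi>"
  shows "energy \<xi> 0 (\<lambda>x. t * \<phi> x) (\<lambda>x. t * \<psi> x) = t\<^sup>2 * energy \<xi> 0 \<phi> \<psi>"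
    "J (\<lambda>x. t * \<phi> x) (\<lambda>x. t * \<psi> x) = t\<^sup>2 * J \<phi> \<psi>"
proof -
  note H = test_function_H01(1)[OF \<phi> ml(1)] test_function_H01(1)[OF \<psi> ml(1)]
  note T = test_function_H01(1)[OF test_function_scale(1)[OF \<phi>] ml(1), of t]
    test_function_H01(1)[OF test_function_scale(1)[OF \<psi>] ml(1), of t]
  have "(\<integral>x. elastic \<xi> (\<lambda>x. t * \<phi> x) (\<lambda>x. t * \<psi> x) x \<partial>dom) = (\<integral>x. t\<^sup>2 * elastic \<xi> \<phi> \<psi> x \<partial>dom)"
  proof (rule integral_cong_AE)
    show "elastic \<xi> (\<lambda>x. t * \<phi> x) (\<lambda>x. t * \<psi> x) \<in> borel_measurable dom"
      by (rule borel_measurable_integrable[OF integrable_elastic[OF T]])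
    show "(\<lambda>x. t\<^sup>2 * elastic \<xi> \<phi> \<psi> x) \<in> borel_measurable dom"
      by (rule borel_measurable_integrable[OF integrable_mult_right[OF integrable_elastic[OF H]]])
    show "AE x in dom. elastic \<xi> (\<lambda>x. t * \<phi> x) (\<lambda>x. t * \<psi> x) x = t\<^sup>2 * elastic \<xi> \<phi> \<psi> x"
      using test_function_scale(2)[OF \<psi>, of t]
      by (rule eventually_mono) (simp add: elastic_def power2_eq_square algebra_simps)
  qed
  then show "energy \<xi> 0 (\<lambda>x. t * \<phi> x) (\<lambda>x. t * \<psi> x) = t\<^sup>2 * energy \<xi> 0 \<phi> \<psi>"
    unfolding energy_eq[OF T] energy_eq[OF H] by (simp add: power_mult_distrib algebra_simps)
  have "(\<lambda>x. \<rho>0 x * ((t * \<phi> x)\<^sup>2 + (t * \<psi> x)\<^sup>2)) = (\<lambda>x. t\<^sup>2 * (\<rho>0 x * ((\<phi> x)\<^sup>2 + (\<psi> x)\<^sup>2)))"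
    by (auto simp: power_mult_distrib algebra_simps)
  then show "J (\<lambda>x. t * \<phi> x) (\<lambda>x. t * \<psi> x) = t\<^sup>2 * J \<phi> \<psi>"
    unfolding J_eq by simp
qed

text \<open>The target may jump at the interface, so the two sides are approximated separately.\<close>

lemma piecewise_test_approximation:
  assumes A: "continuous_on {- m..0} A" and B: "continuous_on {0..l} B" and e: "e > 0"
  shows "\<exists>\<phi>. test_function (- m) l \<phi> \<and> (\<integral>x. (\<phi> x - (if x < 0 then A x else B x))\<^sup>2 \<partial>dom) < e"
proof -
  let ?f = "\<lambda>x. if x < 0 then A x else B x"
  have e4: "e / 4 > 0" using e by simp
  obtain \<phi>1 where \<phi>1: "test_function (- m) l \<phi>1"
    "(\<integral>x. (\<phi>1 x - indicator {- m<..<0} x * A x)\<^sup>2 \<partial>dom) < e / 4"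
    using test_function_approximation[of "- m" "- m" 0 l A "e / 4"] A e4 m_pos l_pos by auto
  obtain \<phi>2 where \<phi>2: "test_function (- m) l \<phi>2"
    "(\<integral>x. (\<phi>2 x - indicator {0<..<l} x * B x)\<^sup>2 \<partial>dom) < e / 4"
    using test_function_approximation[of "- m" 0 l l B "e / 4"] B e4 m_pos l_pos by auto
  let ?\<phi> = "\<lambda>x. 1 * \<phi>1 x + 1 * \<phi>2 x"
  let ?u = "\<lambda>x. \<phi>1 x - indicator {- m<..<0} x * A x" and ?v = "\<lambda>x. \<phi>2 x - indicator {0<..<l} x * B x"
  have L: "L2 dom ?u" "L2 dom ?v"
    by (intro L2_diff test_function_L2 \<phi>1 \<phi>2 L2_ivl_indicator L2_ivl_continuous A B)+
  have "(\<integral>x. (?\<phi> x - ?f x)\<^sup>2 \<partial>dom) \<le> (\<integral>x. 2 * (?u x)\<^sup>2 + 2 * (?v x)\<^sup>2 \<partial>dom)"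
  proof (rule integral_mono_AE)
    have "?f \<in> borel_measurable dom"
      by (rule piecewise_continuous_ivl(1)[OF ml(3) l_pos A B]) simp
    moreover have "\<exists>C. \<forall>x. - m < x \<and> x < l \<longrightarrow> \<bar>?f x\<bar> \<le> C"
      by (rule piecewise_continuous_ivl(2)[OF ml(3) l_pos A B]) simp
    ultimately have fL2: "L2 dom ?f" using L2_ivl_bounded by blast
    show "integrable dom (\<lambda>x. (?\<phi> x - ?f x)\<^sup>2)"
      by (intro L2_integrable_square L2_diff L2_add L2_cmult fL2
          test_function_L2(1)[OF \<phi>1(1)] test_function_L2(1)[OF \<phi>2(1)])
    show "integrable dom (\<lambda>x. 2 * (?u x)\<^sup>2 + 2 * (?v x)\<^sup>2)"
      by (intro Bochner_Integration.integrable_add integrable_mult_right L2_integrable_square L)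
    have "AE x in dom. x \<in> space dom" by (rule AE_space)
    then show "AE x in dom. (?\<phi> x - ?f x)\<^sup>2 \<le> 2 * (?u x)\<^sup>2 + 2 * (?v x)\<^sup>2"
      using AE_ivl_neq[of 0 "- m" l]
    proof eventually_elim
      case (elim x)
      then have eq: "?\<phi> x - ?f x = ?u x + ?v x" by (auto simp: indicator_def)
      have sq: "(p + q)\<^sup>2 \<le> 2 * p\<^sup>2 + 2 * q\<^sup>2" for p q :: real
        using sum_squares_bound[of p q] by (simp add: power2_sum)
      show ?case unfolding eq by (rule sq)
    qed
  qed
  also have "\<dots> = 2 * (\<integral>x. (?u x)\<^sup>2 \<partial>dom) + 2 * (\<integral>x. (?v x)\<^sup>2 \<partial>dom)"
    by (subst Bochner_Integration.integral_add)
       (intro integrable_mult_right L2_integrable_square L | simp only: integral_mult_right_zero)+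
  also have "\<dots> < e" using \<phi>1(2) \<phi>2(2) by simp
  finally show ?thesis using test_function_lincomb[OF \<phi>1(1) \<phi>2(1)] by blast
qed

text \<open>Fix a bump \<open>\<psi>\<close>, which is positive at the interface. The square in \<open>energy_completed_square\<close> vanishes
  for \<open>\<phi> = (g \<psi> / P' - \<psi>') / \<xi>\<close>. This function jumps at the interface and is not admissible, but test
  functions approximate it in \<open>L\<^sup>2\<close>, the only norm of \<open>\<phi>\<close> that enters.\<close>

lemma negative_energy:
  assumes \<xi>: "\<xi> > 0" and sub: "\<sigma> * \<xi>\<^sup>2 < g * jump"
  shows "\<exists>(\<phi>, \<psi>)\<in>admissible. energy \<xi> 0 \<phi> \<psi> < 0"
proof -
  \<comment> \<open>This makes the argument of \<open>flat 0\<close> in the bump positive at \<open>0\<close>.\<close>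
  obtain n :: nat where n: "1 / (m * l) < real n" using reals_Archimedean2 by blast
  define \<psi> where "\<psi> = bump (- m) l n"
  have "real_polynomial_function (\<lambda>x::real. 1)" by (rule real_polynomial_function.intros)
  from test_function_bump[OF order_refl ml(1) order_refl this, of n]
  have \<psi>: "test_function (- m) l \<psi>" by (simp add: \<psi>_def)
  have "real n * (m * l) > 1" using n m_pos l_pos by (simp add: field_simps)
  then have \<psi>0: "\<psi> 0 > 0" by (simp add: \<psi>_def bump_def flat_def)
  define A where "A x = (g * inverse (deriv Pm (rm x)) * \<psi> x - deriv \<psi> x) / \<xi>" for x
  define B where "B x = (g * inverse (deriv Pp (rp x)) * \<psi> x - deriv \<psi> x) / \<xi>" for x
  define f where "f x = (if x < 0 then A x else B x)" for x
  have cont: "continuous_on S \<psi>" "continuous_on S (deriv \<psi>)" for S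
    using test_functionD(2,3)[OF \<psi>] by (auto intro!: continuous_at_imp_continuous_on)
  have inv: "isCont (\<lambda>z. inverse (deriv Pm z)) z" "isCont (\<lambda>z. inverse (deriv Pp z)) z" if "z > 0" for z
    using continuity_of_laws[OF that] by (auto intro!: continuous_intros)
  have AB: "continuous_on {- m..0} A" "continuous_on {0..l} B"
    unfolding A_def B_def using \<xi>
    by (intro continuous_intros cont continuous_on_layers(1)[where fm = "\<lambda>z. inverse (deriv Pm z)" and fp = "\<lambda>z. inverse (deriv Pp z)"]
       continuous_on_layers(2)[where fm = "\<lambda>z. inverse (deriv Pm z)" and fp = "\<lambda>z. inverse (deriv Pp z)"] inv; simp)+
  define K where "K = (g * jump - \<sigma> * \<xi>\<^sup>2) * (\<psi> 0)\<^sup>2"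
  have K: "K > 0" using sub \<psi>0 by (simp add: K_def)
  define e where "e = K / (upper * upper * \<xi>\<^sup>2)"
  have e: "e > 0" using K upper(1) \<xi> by (simp add: e_def)
  obtain \<phi> where \<phi>: "test_function (- m) l \<phi>" and small: "(\<integral>x. (\<phi> x - f x)\<^sup>2 \<partial>dom) < e"
    using piecewise_test_approximation[OF AB e] unfolding f_def by blast
  note H = test_function_H01(1)[OF \<phi> ml(1)] test_function_H01(1)[OF \<psi> ml(1)]
  let ?S = "\<lambda>x. dP0 x * \<rho>0 x * (D \<psi> x + \<xi> * \<phi> x - g * inverse (dP0 x) * \<psi> x)\<^sup>2"
  have "f \<in> borel_measurable dom"
    by (rule piecewise_continuous_ivl(1)[OF ml(3) l_pos AB]) (simp add: f_def)
  moreover have "\<exists>C. \<forall>x. - m < x \<and> x < l \<longrightarrow> \<bar>f x\<bar> \<le> C"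
    by (rule piecewise_continuous_ivl(2)[OF ml(3) l_pos AB]) (simp add: f_def)
  ultimately have fL2: "L2 dom f" using L2_ivl_bounded by blast
  have intf: "integrable dom (\<lambda>x. upper * upper * \<xi>\<^sup>2 * (\<phi> x - f x)\<^sup>2)"
    by (intro integrable_mult_right L2_integrable_square L2_diff fL2 test_function_L2(1)[OF \<phi>])
  have "(\<integral>x. ?S x \<partial>dom) \<le> (\<integral>x. upper * upper * \<xi>\<^sup>2 * (\<phi> x - f x)\<^sup>2 \<partial>dom)"
  proof (rule integral_mono_AE[OF _ intf])
    show "integrable dom ?S"
      by (intro integrable_coefficient_square coefficient_mult coefficient_basic L2_diff
        L2_combinations[OF H] L2_coefficient L2_fields[OF H])
    have "AE x in dom. x \<in> space dom" by (rule AE_space)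
    then show "AE x in dom. ?S x \<le> upper * upper * \<xi>\<^sup>2 * (\<phi> x - f x)\<^sup>2"
      using test_function_H01(2)[OF \<psi> ml(1)]
    proof eventually_elim
      case (elim x)
      then have x: "- m < x" "x < l" by auto
      have "\<xi> * f x = g * inverse (dP0 x) * \<psi> x - deriv \<psi> x"
        using \<xi> by (simp add: f_def A_def B_def dP0_def at_steady_eq)
      then have "D \<psi> x + \<xi> * \<phi> x - g * inverse (dP0 x) * \<psi> x = \<xi> * (\<phi> x - f x)"
        using elim by (simp add: algebra_simps)
      then have "?S x = dP0 x * \<rho>0 x * (\<xi>\<^sup>2 * (\<phi> x - f x)\<^sup>2)" by (simp add: power_mult_distrib)
      also have "\<dots> \<le> upper * upper * (\<xi>\<^sup>2 * (\<phi> x - f x)\<^sup>2)"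
        using upper(1) upper(2,3)[OF x] coefficients_pos[OF x] x by (intro mult_right_mono mult_mono) auto
      finally show ?case by (simp add: mult.assoc)
    qed
  qed
  also have "\<dots> = upper * upper * \<xi>\<^sup>2 * (\<integral>x. (\<phi> x - f x)\<^sup>2 \<partial>dom)"
    by (rule integral_mult_right_zero)
  also have "\<dots> < upper * upper * \<xi>\<^sup>2 * e"
    using small upper(1) \<xi> by (intro mult_strict_left_mono) auto
  also have "\<dots> = K" using upper(1) \<xi> by (simp add: e_def)
  finally have "(\<integral>x. ?S x \<partial>dom) < K" .
  moreover have "(\<sigma> * \<xi>\<^sup>2 - g * jump) / 2 * (\<psi> 0)\<^sup>2 = - K / 2"
    by (simp add: K_def field_simps)
  ultimately have neg: "energy \<xi> 0 \<phi> \<psi> < 0"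
    unfolding energy_completed_square[OF H] by linarith
  \<comment> \<open>The lower bound for the energy excludes \<open>J = 0\<close>, so the pair can be normalised.\<close>
  have "- (g * \<xi>) * J \<phi> \<psi> < 0"
    using energy_lower_bound[OF H, of \<xi>] neg \<xi> by simp
  moreover have "g * \<xi> > 0" using g_pos \<xi> by simp
  ultimately have J: "J \<phi> \<psi> > 0" by (simp add: zero_less_mult_iff)
  define t where "t = 1 / sqrt (J \<phi> \<psi>)"
  have t: "t\<^sup>2 * J \<phi> \<psi> = 1" "t\<^sup>2 > 0" using J by (simp_all add: t_def power_divide)
  have "energy \<xi> 0 (\<lambda>x. t * \<phi> x) (\<lambda>x. t * \<psi> x) < 0"
    unfolding energy_scale[OF \<phi> \<psi>] using neg t(2) by (simp add: mult_pos_neg)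
  moreover have "(\<lambda>x. t * \<phi> x, \<lambda>x. t * \<psi> x) \<in> admissible"
    unfolding admissible_def using energy_scale(2)[OF \<phi> \<psi>, of t] t(1)
      test_function_H01(1)[OF test_function_scale(1)[OF \<phi>] ml(1)]
      test_function_H01(1)[OF test_function_scale(1)[OF \<psi>] ml(1)] by simp
  ultimately show ?thesis by blast
qed

section \<open>Dependence of the energy on the frequency\<close>

lemma shear_square_le:
  fixes p q \<xi> \<eta> \<beta> :: real
  assumes "0 \<le> \<xi>" "\<xi> \<le> \<beta>" "0 \<le> \<eta>" "\<eta> \<le> \<beta>"
  shows "(p + \<eta> * q)\<^sup>2 \<le> (p + \<xi> * q)\<^sup>2 + \<bar>\<eta> - \<xi>\<bar> * (1 + 2 * \<beta>) * (p\<^sup>2 + q\<^sup>2)"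
proof -
  have "(p + \<eta> * q)\<^sup>2 - (p + \<xi> * q)\<^sup>2 = (\<eta> - \<xi>) * (2 * p * q + (\<eta> + \<xi>) * q\<^sup>2)"
    by (simp add: power2_eq_square algebra_simps)
  also have "\<dots> \<le> \<bar>\<eta> - \<xi>\<bar> * \<bar>2 * p * q + (\<eta> + \<xi>) * q\<^sup>2\<bar>"
    by (metis abs_ge_self abs_mult)
  also have "\<bar>2 * p * q + (\<eta> + \<xi>) * q\<^sup>2\<bar> \<le> (1 + 2 * \<beta>) * (p\<^sup>2 + q\<^sup>2)"
  proof -
    have "\<bar>2 * p * q\<bar> \<le> p\<^sup>2 + q\<^sup>2"
      using sum_squares_bound[of "\<bar>p\<bar>" "\<bar>q\<bar>"] by (simp add: abs_mult)
    moreover have "\<bar>(\<eta> + \<xi>) * q\<^sup>2\<bar> \<le> (2 * \<beta>) * (p\<^sup>2 + q\<^sup>2)"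
      unfolding abs_mult using assms by (intro mult_mono) auto
    ultimately show ?thesis using abs_triangle_ineq[of "2 * p * q" "(\<eta> + \<xi>) * q\<^sup>2"]
      by (simp add: distrib_right)
  qed
  then have "\<bar>\<eta> - \<xi>\<bar> * \<bar>2 * p * q + (\<eta> + \<xi>) * q\<^sup>2\<bar> \<le> \<bar>\<eta> - \<xi>\<bar> * ((1 + 2 * \<beta>) * (p\<^sup>2 + q\<^sup>2))"
    by (rule mult_left_mono) simp
  finally show ?thesis by (simp add: mult.assoc)
qed

text \<open>Changing the frequency by \<open>h\<close> changes the integrands, and the surface energy, by at most
  \<open>K h\<close> times the integral \<open>N\<close> of \<open>\<phi>\<^sup>2 + \<psi>\<^sup>2 + \<phi>'\<^sup>2 + \<psi>'\<^sup>2\<close>. The constraint \<open>J = 1\<close> bounds the first two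
  terms. Coercivity bounds the last two by the dissipation, which is at most
  \<open>(E + g \<beta>) / s\<close>. This is where \<open>s > 0\<close> matters.\<close>

lemma energy_frequency_comparison:
  assumes \<beta>: "\<beta> > 0" and s: "s > 0"
  shows "\<exists>A B. A \<ge> 0 \<and> B \<ge> 0 \<and> (\<forall>\<xi> \<eta> \<phi> \<psi>. 0 < \<xi> \<longrightarrow> \<xi> \<le> \<beta> \<longrightarrow> 0 < \<eta> \<longrightarrow> \<eta> \<le> \<beta> \<longrightarrow> (\<phi>, \<psi>) \<in> admissible \<longrightarrow>
    energy \<eta> s \<phi> \<psi> \<le> energy \<xi> s \<phi> \<psi> + \<bar>\<eta> - \<xi>\<bar> * (A * energy \<xi> s \<phi> \<psi> + B))"
proof -
  define k where "k = 1 + 2 * \<beta>"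
  define K where "K = \<sigma> * \<beta> * (l + m) + (upper * upper * k + g * upper) / 2 + s * (2 * upper * k)"
  have k: "k > 0" using \<beta> by (simp add: k_def)
  have K: "K \<ge> 0" unfolding K_def
    using k \<beta> s sigma_nonneg g_pos upper(1) m_pos l_pos by (intro add_nonneg_nonneg) auto
  have "energy \<eta> s \<phi> \<psi> \<le> energy \<xi> s \<phi> \<psi> + \<bar>\<eta> - \<xi>\<bar> * (2 * K / (lower * s) * energy \<xi> s \<phi> \<psi> + K * (2 / lower + 2 * g * \<beta> / (lower * s)))"
    if \<xi>: "0 < \<xi>" "\<xi> \<le> \<beta>" and \<eta>: "0 < \<eta>" "\<eta> \<le> \<beta>" and adm: "(\<phi>, \<psi>) \<in> admissible" for \<xi> \<eta> \<phi> \<psi>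
  proof -
    have H: "\<phi> \<in> H01 (- m) l" "\<psi> \<in> H01 (- m) l" and J: "J \<phi> \<psi> = 1"
      using adm by (auto simp: admissible_def)
    define h where "h = \<bar>\<eta> - \<xi>\<bar>"
    define n where "n x = ((\<phi> x)\<^sup>2 + (\<psi> x)\<^sup>2) + ((D \<phi> x)\<^sup>2 + (D \<psi> x)\<^sup>2)" for x
    define N where "N = (\<integral>x. n x \<partial>dom)"
    have h: "h \<ge> 0" by (simp add: h_def)
    have int_n: "integrable dom n"
      unfolding n_def by (intro Bochner_Integration.integrable_add[OF integrable_values[OF H] integrable_gradients[OF H]])
    have shear: "(p + \<eta> * q)\<^sup>2 \<le> (p + \<xi> * q)\<^sup>2 + h * k * n x"
      if "p\<^sup>2 + q\<^sup>2 \<le> n x" for p q x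
    proof -
      have "(p + \<eta> * q)\<^sup>2 \<le> (p + \<xi> * q)\<^sup>2 + h * k * (p\<^sup>2 + q\<^sup>2)"
        unfolding h_def k_def by (rule shear_square_le) (use \<xi> \<eta> in auto)
      also have "h * k * (p\<^sup>2 + q\<^sup>2) \<le> h * k * n x"
        using that h k by (intro mult_left_mono) auto
      finally show ?thesis by simp
    qed
    have sh: "(D \<psi> x + \<eta> * \<phi> x)\<^sup>2 \<le> (D \<psi> x + \<xi> * \<phi> x)\<^sup>2 + h * k * n x"
      "(D \<psi> x - \<eta> * \<phi> x)\<^sup>2 \<le> (D \<psi> x - \<xi> * \<phi> x)\<^sup>2 + h * k * n x"
      "(D \<phi> x - \<eta> * \<psi> x)\<^sup>2 \<le> (D \<phi> x - \<xi> * \<psi> x)\<^sup>2 + h * k * n x" for x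
      using shear[of "D \<psi> x" "\<phi> x" x] shear[of "D \<psi> x" "- \<phi> x" x] shear[of "D \<phi> x" "- \<psi> x" x]
      by (auto simp: n_def)
    have n_nonneg: "n x \<ge> 0" for x by (simp add: n_def)
    have "(\<integral>x. elastic \<eta> \<phi> \<psi> x \<partial>dom) \<le> (\<integral>x. elastic \<xi> \<phi> \<psi> x + h * (upper * upper * k + g * upper) * n x \<partial>dom)"
    proof (rule integral_mono[OF integrable_elastic[OF H] Bochner_Integration.integrable_add[OF integrable_elastic[OF H] integrable_mult_right[OF int_n]]])
      fix x assume "x \<in> space dom"
      then have x: "- m < x" "x < l" by auto
      have "dP0 x * \<rho>0 x * (D \<psi> x + \<eta> * \<phi> x)\<^sup>2 \<le> dP0 x * \<rho>0 x * ((D \<psi> x + \<xi> * \<phi> x)\<^sup>2 + h * k * n x)"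
        using sh(1) coefficients_pos[OF x] by (intro mult_left_mono) auto
      also have "\<dots> \<le> dP0 x * \<rho>0 x * (D \<psi> x + \<xi> * \<phi> x)\<^sup>2 + upper * upper * (h * k * n x)"
        unfolding distrib_left using upper(1) upper(2,3)[OF x] coefficients_pos[OF x] x h k n_nonneg[of x]
        by (intro add_left_mono mult_right_mono mult_mono) auto
      finally have 1: "dP0 x * \<rho>0 x * (D \<psi> x + \<eta> * \<phi> x)\<^sup>2
          \<le> dP0 x * \<rho>0 x * (D \<psi> x + \<xi> * \<phi> x)\<^sup>2 + upper * upper * (h * k * n x)" .
      have "- (2 * g * \<rho>0 x * ((\<eta> - \<xi>) * (\<phi> x * \<psi> x))) \<le> g * upper * (h * n x)"
      proof -
        have "2 * \<bar>\<phi> x * \<psi> x\<bar> \<le> n x"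
          using sum_squares_bound[of "\<bar>\<phi> x\<bar>" "\<bar>\<psi> x\<bar>"] by (simp add: n_def abs_mult add_increasing2)
        then have hn: "h * (2 * \<bar>\<phi> x * \<psi> x\<bar>) \<le> h * n x" using h by (rule mult_left_mono)
        have gu: "g * \<rho>0 x \<le> g * upper" using upper(2)[OF x] g_pos by simp
        have "g * \<rho>0 x * (h * (2 * \<bar>\<phi> x * \<psi> x\<bar>)) \<le> g * upper * (h * n x)"
          by (rule mult_mono[OF gu hn]) (use g_pos h upper(1) in simp_all)
        moreover have "- (2 * g * \<rho>0 x * ((\<eta> - \<xi>) * (\<phi> x * \<psi> x))) \<le> \<bar>2 * g * \<rho>0 x * ((\<eta> - \<xi>) * (\<phi> x * \<psi> x))\<bar>"
          by (rule abs_ge_minus_self)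
        moreover have "\<bar>2 * g * \<rho>0 x * ((\<eta> - \<xi>) * (\<phi> x * \<psi> x))\<bar> = g * \<rho>0 x * (h * (2 * \<bar>\<phi> x * \<psi> x\<bar>))"
          using g_pos coefficients_pos[OF x] by (simp add: abs_mult h_def)
        ultimately show ?thesis by linarith
      qed
      with 1 show "elastic \<eta> \<phi> \<psi> x \<le> elastic \<xi> \<phi> \<psi> x + h * (upper * upper * k + g * upper) * n x"
        unfolding elastic_def by (simp add: algebra_simps)
    qed
    then have el: "(\<integral>x. elastic \<eta> \<phi> \<psi> x \<partial>dom) \<le> (\<integral>x. elastic \<xi> \<phi> \<psi> x \<partial>dom) + h * (upper * upper * k + g * upper) * N"
      unfolding N_def Bochner_Integration.integral_add[OF integrable_elastic[OF H] integrable_mult_right[OF int_n]]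
      by simp
    have "(\<integral>x. viscous \<eta> \<phi> \<psi> x \<partial>dom) \<le> (\<integral>x. viscous \<xi> \<phi> \<psi> x + h * (4 * upper * k) * n x \<partial>dom)"
    proof (rule integral_mono[OF integrable_viscous[OF H] Bochner_Integration.integrable_add[OF integrable_viscous[OF H] integrable_mult_right[OF int_n]]])
      fix x assume "x \<in> space dom"
      then have x: "- m < x" "x < l" by auto
      let ?Q = "\<lambda>\<xi>. (D \<phi> x - \<xi> * \<psi> x)\<^sup>2 + (D \<psi> x - \<xi> * \<phi> x)\<^sup>2 + 1/3 * (D \<psi> x + \<xi> * \<phi> x)\<^sup>2"
      let ?r = "h * k * n x"
      have r: "?r \<ge> 0" using h k n_nonneg[of x] by simp
      have "\<delta>0 x * (D \<psi> x + \<eta> * \<phi> x)\<^sup>2 \<le> \<delta>0 x * ((D \<psi> x + \<xi> * \<phi> x)\<^sup>2 + ?r)"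
        using sh(1) coefficients_pos[OF x] by (intro mult_left_mono) auto
      moreover have "\<delta>0 x * ?r \<le> upper * ?r" using upper(5)[OF x] r by (rule mult_right_mono)
      moreover have "?Q \<eta> \<le> ?Q \<xi> + 3 * ?r" using sh[of x] r by linarith
      then have "\<epsilon>0 x * ?Q \<eta> \<le> \<epsilon>0 x * (?Q \<xi> + 3 * ?r)"
        using coefficients_pos[OF x] by (intro mult_left_mono) auto
      moreover have "\<epsilon>0 x * (3 * ?r) \<le> upper * (3 * ?r)" using upper(4)[OF x] r by (intro mult_right_mono) auto
      ultimately have "viscous \<eta> \<phi> \<psi> x \<le> viscous \<xi> \<phi> \<psi> x + (upper * ?r + upper * (3 * ?r))"
        unfolding viscous_def distrib_left[of _ _ ?r] distrib_left[of _ _ "3 * ?r"] by linarith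
      then show "viscous \<eta> \<phi> \<psi> x \<le> viscous \<xi> \<phi> \<psi> x + h * (4 * upper * k) * n x"
        by (simp add: algebra_simps)
    qed
    then have vis: "dissipation \<eta> \<phi> \<psi> \<le> dissipation \<xi> \<phi> \<psi> + h * (2 * upper * k) * N"
      unfolding N_def dissipation_def
        Bochner_Integration.integral_add[OF integrable_viscous[OF H] integrable_mult_right[OF int_n]]
      by simp
    have N: "N = (\<integral>x. (\<phi> x)\<^sup>2 + (\<psi> x)\<^sup>2 \<partial>dom) + (\<integral>x. (D \<phi> x)\<^sup>2 + (D \<psi> x)\<^sup>2 \<partial>dom)"
      unfolding N_def n_def by (rule Bochner_Integration.integral_add[OF integrable_values[OF H] integrable_gradients[OF H]])
    have surf: "\<sigma> * \<eta>\<^sup>2 / 2 * (\<psi> 0)\<^sup>2 \<le> \<sigma> * \<xi>\<^sup>2 / 2 * (\<psi> 0)\<^sup>2 + h * (\<sigma> * \<beta> * (l + m)) * N"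
    proof -
      have "\<eta>\<^sup>2 - \<xi>\<^sup>2 = (\<eta> - \<xi>) * (\<eta> + \<xi>)" by (simp add: power2_eq_square algebra_simps)
      also have "\<dots> \<le> h * (2 * \<beta>)" using \<xi> \<eta> unfolding h_def by (intro mult_mono) auto
      finally have "\<sigma> / 2 * ((\<eta>\<^sup>2 - \<xi>\<^sup>2) * (\<psi> 0)\<^sup>2) \<le> \<sigma> / 2 * (h * (2 * \<beta>) * (\<psi> 0)\<^sup>2)"
        using sigma_nonneg by (intro mult_left_mono mult_right_mono) auto
      moreover have "(\<psi> 0)\<^sup>2 \<le> (l + m) * N"
      proof -
        have "0 \<le> (l + m) * (\<integral>x. (\<phi> x)\<^sup>2 + (\<psi> x)\<^sup>2 \<partial>dom)"
          using m_pos l_pos by (intro mult_nonneg_nonneg Bochner_Integration.integral_nonneg) auto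
        then show ?thesis using interface_square_le[OF H] unfolding N distrib_left by linarith
      qed
      then have "h * (\<sigma> * \<beta>) * (\<psi> 0)\<^sup>2 \<le> h * (\<sigma> * \<beta>) * ((l + m) * N)"
        using h sigma_nonneg \<beta> by (intro mult_left_mono) auto
      ultimately show ?thesis by (simp add: algebra_simps)
    qed
    have "s * dissipation \<eta> \<phi> \<psi> \<le> s * (dissipation \<xi> \<phi> \<psi> + h * (2 * upper * k) * N)"
      using vis s by (intro mult_left_mono) auto
    then have diff: "energy \<eta> s \<phi> \<psi> \<le> energy \<xi> s \<phi> \<psi> + h * (K * N)"
      unfolding energy_eq[OF H] K_def using el surf by (simp add: algebra_simps add_divide_distrib)
    have "- (g * \<xi>) \<le> energy \<xi> 0 \<phi> \<psi>" using energy_lower_bound[OF H, of \<xi>] \<xi> J by simp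
    moreover have "g * \<xi> \<le> g * \<beta>" using \<xi> g_pos by simp
    ultimately have "s * dissipation \<xi> \<phi> \<psi> \<le> energy \<xi> s \<phi> \<psi> + g * \<beta>"
      using energy_affine[OF H, of \<xi> s] by linarith
    then have "dissipation \<xi> \<phi> \<psi> \<le> (energy \<xi> s \<phi> \<psi> + g * \<beta>) / s"
      using s by (simp add: field_simps)
    then have "2 / lower * dissipation \<xi> \<phi> \<psi> \<le> 2 / lower * ((energy \<xi> s \<phi> \<psi> + g * \<beta>) / s)"
      using lower(1) by (intro mult_left_mono) auto
    then have "N \<le> 2 / lower + 2 / lower * ((energy \<xi> s \<phi> \<psi> + g * \<beta>) / s)"
      using values_le_J[OF H, unfolded J mult_1_right] dissipation_gradients[OF H, of \<xi>]
      unfolding N by linarith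
    then have "K * N \<le> K * (2 / lower + 2 / lower * ((energy \<xi> s \<phi> \<psi> + g * \<beta>) / s))"
      using K by (rule mult_left_mono)
    also have "\<dots> = 2 * K / (lower * s) * energy \<xi> s \<phi> \<psi> + K * (2 / lower + 2 * g * \<beta> / (lower * s))"
      using lower(1) s by (simp add: field_simps)
    finally have "h * (K * N) \<le> h * (2 * K / (lower * s) * energy \<xi> s \<phi> \<psi> + K * (2 / lower + 2 * g * \<beta> / (lower * s)))"
      using h by (rule mult_left_mono)
    with diff show ?thesis unfolding h_def by linarith
  qed
  moreover have "2 * K / (lower * s) \<ge> 0" "K * (2 / lower + 2 * g * \<beta> / (lower * s)) \<ge> 0"
    using K lower(1) s \<beta> g_pos by auto
  ultimately show ?thesis by blast
qed

end


section \<open>The growth rate\<close>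

context compressible_RT
begin

lemma admissibleD:
  assumes "(\<phi>, \<psi>) \<in> admissible"
  shows "\<phi> \<in> H01 (- m) l" "\<psi> \<in> H01 (- m) l" "J \<phi> \<psi> = 1"
  using assms by (auto simp: admissible_def)

lemma energy_admissible:
  assumes "(\<phi>, \<psi>) \<in> admissible"
  shows "energy \<xi> s \<phi> \<psi> = energy \<xi> 0 \<phi> \<psi> + s * dissipation \<xi> \<phi> \<psi>" "dissipation \<xi> \<phi> \<psi> \<ge> 0"
    "\<xi> \<ge> 0 \<Longrightarrow> energy \<xi> 0 \<phi> \<psi> \<ge> - (g * \<xi>)"
    "\<xi> \<ge> 0 \<Longrightarrow> s \<ge> 0 \<Longrightarrow> energy \<xi> s \<phi> \<psi> \<ge> - (g * \<xi>)"
proof -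
  note A = admissibleD[OF assms]
  show 1: "energy \<xi> s \<phi> \<psi> = energy \<xi> 0 \<phi> \<psi> + s * dissipation \<xi> \<phi> \<psi>" by (rule energy_affine[OF A(1,2)])
  show 2: "dissipation \<xi> \<phi> \<psi> \<ge> 0" by (rule dissipation_nonneg[OF A(1,2)])
  show 3: "energy \<xi> 0 \<phi> \<psi> \<ge> - (g * \<xi>)" if "\<xi> \<ge> 0"
    using energy_lower_bound[OF A(1,2) that] A(3) by simp
  show "energy \<xi> s \<phi> \<psi> \<ge> - (g * \<xi>)" if "\<xi> \<ge> 0" "s \<ge> 0"
    unfolding 1 using 3[OF that(1)] mult_nonneg_nonneg[OF that(2) 2] by linarith
qed

definition subcritical :: "real \<Rightarrow> bool" where
  "subcritical \<xi> \<longleftrightarrow> \<xi> > 0 \<and> \<sigma> * \<xi>\<^sup>2 < g * jump"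

lemma mu_le:
  assumes "\<xi> \<ge> 0" "s \<ge> 0" "(\<phi>, \<psi>) \<in> admissible"
  shows "\<mu> \<xi> s \<le> energy \<xi> s \<phi> \<psi>"
proof -
  have "bdd_below ((\<lambda>(\<phi>, \<psi>). energy \<xi> s \<phi> \<psi>) ` admissible)"
    by (rule bdd_belowI[of _ "- (g * \<xi>)"]) (auto intro: energy_admissible(4) assms(1,2))
  from cINF_lower[OF this assms(3)] show ?thesis by (simp add: \<mu>_def)
qed

lemma admissible_nonempty: "subcritical \<xi> \<Longrightarrow> admissible \<noteq> {}"
  using negative_energy[of \<xi>] by (auto simp: subcritical_def)

lemma mu_ge:
  assumes "subcritical \<xi>'" "\<And>\<phi> \<psi>. (\<phi>, \<psi>) \<in> admissible \<Longrightarrow> c \<le> energy \<xi> s \<phi> \<psi>"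
  shows "c \<le> \<mu> \<xi> s"
  unfolding \<mu>_def using assms(2) by (intro cINF_greatest[OF admissible_nonempty[OF assms(1)]]) auto

lemma mu_less:
  assumes "subcritical \<xi>'" "\<mu> \<xi> s < c"
  obtains \<phi> \<psi> where "(\<phi>, \<psi>) \<in> admissible" "energy \<xi> s \<phi> \<psi> < c"
  using mu_ge[OF assms(1), of c \<xi> s] assms(2) by (meson not_le)

lemma mu_mono:
  assumes "subcritical \<xi>" "0 \<le> s" "s \<le> t" shows "\<mu> \<xi> s \<le> \<mu> \<xi> t"
proof (rule mu_ge[OF assms(1)])
  fix \<phi> \<psi> assume adm: "(\<phi>, \<psi>) \<in> admissible"
  have "\<mu> \<xi> s \<le> energy \<xi> s \<phi> \<psi>" using assms by (intro mu_le adm) (auto simp: subcritical_def)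
  also have "\<dots> \<le> energy \<xi> t \<phi> \<psi>"
    unfolding energy_admissible(1)[OF adm, of \<xi> s] energy_admissible(1)[OF adm, of \<xi> t]
    using energy_admissible(2)[OF adm] assms(3) by (simp add: mult_right_mono)
  finally show "\<mu> \<xi> s \<le> energy \<xi> t \<phi> \<psi>" .
qed

lemma mu_lower: "subcritical \<xi> \<Longrightarrow> s \<ge> 0 \<Longrightarrow> - (g * \<xi>) \<le> \<mu> \<xi> s"
  by (rule mu_ge, assumption, rule energy_admissible(4)) (auto simp: subcritical_def)

text \<open>A step that is short enough to use up at most half of the available room \<open>q\<close>.\<close>

lemma small_step:
  fixes W q :: real
  assumes "W > 0" "q > 0" obtains e where "0 < e" "e \<le> 1" "e * W \<le> q / 2"
proof -
  have "min 1 (q / (2 * W)) * W \<le> q / (2 * W) * W"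
    using assms by (intro mult_right_mono) auto
  also have "\<dots> = q / 2" using assms by simp
  finally show ?thesis using assms by (intro that[of "min 1 (q / (2 * W))"]) auto
qed

text \<open>Take the supremum \<open>t\<close> of all \<open>s\<close> with \<open>\<mu> \<xi> s < - s\<^sup>2\<close>. A competitor with energy below \<open>- t\<^sup>2\<close> at \<open>t\<close>
  would still be below at a slightly larger value. Conversely, the energy is affine in
  \<open>s\<close> and bounded below at \<open>s = 0\<close>, so \<open>\<mu> \<xi>\<close> cannot jump upwards at \<open>t\<close>.\<close>

lemma fixed_point_exists:
  assumes sub: "subcritical \<xi>"
  shows "\<exists>t>0. \<mu> \<xi> t = - t\<^sup>2"
proof -
  have \<xi>: "\<xi> > 0" using sub by (simp add: subcritical_def)
  have g\<xi>: "g * \<xi> > 0" using g_pos \<xi> by simp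
  define S where "S = {s. s > 0 \<and> \<mu> \<xi> s < - s\<^sup>2}"
  have bound: "s \<le> g * \<xi> + 1" if "s \<in> S" for s
  proof (rule ccontr)
    assume "\<not> s \<le> g * \<xi> + 1"
    then have s: "s > g * \<xi> + 1" by simp
    then have "s * 1 \<le> s * s" using g\<xi> by (intro mult_left_mono) auto
    moreover have "s\<^sup>2 < g * \<xi>" using that mu_lower[OF sub, of s] by (auto simp: S_def)
    ultimately show False using s by (simp add: power2_eq_square)
  qed
  have bdd: "bdd_above S" using bound by (intro bdd_aboveI)
  obtain \<phi> \<psi> where a: "(\<phi>, \<psi>) \<in> admissible" "energy \<xi> 0 \<phi> \<psi> < 0"
    using negative_energy[of \<xi>] sub by (auto simp: subcritical_def)
  define d where "d = - energy \<xi> 0 \<phi> \<psi>"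
  define V where "V = dissipation \<xi> \<phi> \<psi>"
  have d: "d > 0" "V \<ge> 0" using a energy_admissible(2)[OF a(1)] by (auto simp: d_def V_def)
  obtain s0 where s0: "0 < s0" "s0 \<le> 1" "s0 * (V + 1) \<le> d / 2"
    using small_step[of "V + 1" d] d by auto
  have "s0 * s0 \<le> s0 * 1" using s0 by (intro mult_left_mono) auto
  then have "energy \<xi> s0 \<phi> \<psi> < - s0\<^sup>2"
    unfolding energy_admissible(1)[OF a(1), of \<xi> s0] V_def[symmetric] power2_eq_square
    using s0(3) d d_def by (simp add: distrib_left)
  then have "s0 \<in> S"
    using mu_le[of \<xi> s0, OF _ _ a(1)] \<xi> s0(1) by (auto simp: S_def)
  define t where "t = Sup S"
  have t_ge: "s \<le> t" if "s \<in> S" for s unfolding t_def by (rule cSup_upper[OF that bdd])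
  have t: "t > 0" using t_ge[OF \<open>s0 \<in> S\<close>] s0(1) by simp
  have "- t\<^sup>2 \<le> \<mu> \<xi> t"
  proof (rule mu_ge[OF sub], rule ccontr)
    fix \<phi> \<psi> assume a: "(\<phi>, \<psi>) \<in> admissible" and "\<not> - t\<^sup>2 \<le> energy \<xi> t \<phi> \<psi>"
    then have neg: "energy \<xi> t \<phi> \<psi> + t\<^sup>2 < 0" by simp
    define V where "V = dissipation \<xi> \<phi> \<psi>"
    define q where "q = - (energy \<xi> t \<phi> \<psi> + t\<^sup>2)"
    have V: "V \<ge> 0" unfolding V_def by (rule energy_admissible(2)[OF a])
    have W: "V + 2 * t + 1 > 0" "q > 0" using V t neg by (auto simp: q_def)
    obtain e where e: "0 < e" "e \<le> 1" and e2: "e * (V + 2 * t + 1) \<le> q / 2"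
      using small_step[OF W] by blast
    have "e * e \<le> e * 1" using e by (intro mult_left_mono) auto
    moreover have "energy \<xi> (t + e) \<phi> \<psi> + (t + e)\<^sup>2 = (energy \<xi> t \<phi> \<psi> + t\<^sup>2) + e * V + 2 * t * e + e * e"
      unfolding energy_admissible(1)[OF a, of \<xi> "t + e"] energy_admissible(1)[OF a, of \<xi> t] V_def
      by (simp add: power2_eq_square algebra_simps)
    moreover have "e * (V + 2 * t + 1) = e * V + 2 * t * e + e * 1" by (simp add: algebra_simps)
    ultimately have "energy \<xi> (t + e) \<phi> \<psi> < - (t + e)\<^sup>2" using e2 W(2) q_def by linarith
    then have "t + e \<in> S" using mu_le[of \<xi> "t + e", OF _ _ a] \<xi> t e(1) by (auto simp: S_def)
    from t_ge[OF this] e(1) show False by simp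
  qed
  moreover have "\<mu> \<xi> t \<le> - t\<^sup>2"
  proof (rule ccontr)
    assume "\<not> \<mu> \<xi> t \<le> - t\<^sup>2"
    define d where "d = (\<mu> \<xi> t + t\<^sup>2) / 2"
    have d: "d > 0" and mu: "\<mu> \<xi> t = 2 * d - t\<^sup>2" using \<open>\<not> \<mu> \<xi> t \<le> - t\<^sup>2\<close> by (auto simp: d_def field_simps)
    define W where "W = t\<^sup>2 + g * \<xi>"
    have W: "W > 0" using t g\<xi> by (simp add: W_def add_pos_pos)
    \<comment> \<open>Multiplying out, a competitor at \<open>s\<close> within \<open>e\<close> of \<open>t\<close> yields \<open>2 s d < (t - s) W\<close>. The choice of
    \<open>e\<close> makes the right side at most \<open>t d\<close> and keeps \<open>s \<ge> t / 2\<close>.\<close>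
    define e where "e = min (t / 2) (t * d / W)"
    have e: "e > 0" using t d W by (simp add: e_def)
    obtain s where s: "s \<in> S" "t - e < s"
      using less_cSupD[of S "t - e"] \<open>s0 \<in> S\<close> e unfolding t_def by auto
    have st: "0 < s" "s \<le> t" "t / 2 \<le> s" using s t_ge[OF s(1)] by (auto simp: S_def e_def)
    have "\<mu> \<xi> s < - s\<^sup>2" using s(1) by (simp add: S_def)
    then obtain \<phi> \<psi> where a: "(\<phi>, \<psi>) \<in> admissible" and less: "energy \<xi> s \<phi> \<psi> < - s\<^sup>2"
      using mu_less[OF sub] by blast
    define E0 where "E0 = energy \<xi> 0 \<phi> \<psi>"
    define V where "V = dissipation \<xi> \<phi> \<psi>"
    have E0: "E0 \<ge> - (g * \<xi>)" unfolding E0_def using \<xi> by (intro energy_admissible(3)[OF a]) simp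
    have "2 * d - t\<^sup>2 \<le> E0 + t * V"
      using mu_le[of \<xi> t, OF _ _ a] \<xi> t mu energy_admissible(1)[OF a, of \<xi> t] by (simp add: E0_def V_def)
    then have "s * (2 * d - t\<^sup>2) \<le> s * (E0 + t * V)" using st(1) by (intro mult_left_mono) auto
    moreover have "(t - s) * - (g * \<xi>) \<le> (t - s) * E0" using E0 st(2) by (intro mult_left_mono) auto
    moreover have "E0 + s * V < - s\<^sup>2"
      using less energy_admissible(1)[OF a, of \<xi> s] by (simp add: E0_def V_def)
    then have "t * (E0 + s * V) < t * - s\<^sup>2" using t by (rule mult_strict_left_mono)
    ultimately have "2 * (s * d) < (t - s) * (s * t + g * \<xi>)"
      by (simp add: power2_eq_square algebra_simps)
    also have "\<dots> \<le> (t - s) * W"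
      using st t unfolding W_def power2_eq_square by (intro mult_left_mono add_right_mono mult_right_mono) auto
    also have "\<dots> \<le> (t * d / W) * W"
      using s(2) W by (intro mult_right_mono) (auto simp: e_def)
    also have "\<dots> = t * d" using W by simp
    also have "\<dots> \<le> 2 * (s * d)" using st(3) d by (simp add: mult_right_mono mult.assoc[symmetric])
    finally show False by simp
  qed
  ultimately show ?thesis using t by (intro exI[of _ t]) auto
qed

lemma growth_rate:
  assumes sub: "subcritical \<xi>"
  shows "growth_rate \<xi> > 0" "\<mu> \<xi> (growth_rate \<xi>) = - (growth_rate \<xi>)\<^sup>2"
proof -
  have iff: "(s > 0 \<and> \<mu> \<xi> s < 0 \<and> s = sqrt (- \<mu> \<xi> s)) \<longleftrightarrow> s > 0 \<and> \<mu> \<xi> s = - s\<^sup>2" for s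
  proof
    assume s: "s > 0 \<and> \<mu> \<xi> s < 0 \<and> s = sqrt (- \<mu> \<xi> s)"
    then have "s\<^sup>2 = - \<mu> \<xi> s" by (metis less_imp_le neg_0_less_iff_less real_sqrt_pow2)
    with s show "s > 0 \<and> \<mu> \<xi> s = - s\<^sup>2" by simp
  qed (auto simp: real_sqrt_unique)
  obtain t where t: "t > 0 \<and> \<mu> \<xi> t = - t\<^sup>2" using fixed_point_exists[OF sub] by blast
  have unique: "s = t" if s: "s > 0 \<and> \<mu> \<xi> s = - s\<^sup>2" for s
  proof -
    have False if "x > 0 \<and> \<mu> \<xi> x = - x\<^sup>2" "y > 0 \<and> \<mu> \<xi> y = - y\<^sup>2" "x < y" for x y
    proof -
      have "- x\<^sup>2 \<le> - y\<^sup>2" using mu_mono[OF sub, of x y] that by simp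
      moreover have "x\<^sup>2 < y\<^sup>2" using that by (intro power_strict_mono) auto
      ultimately show False by simp
    qed
    from this[OF s t] this[OF t s] show ?thesis by (cases rule: linorder_cases[of s t]) auto
  qed
  have "growth_rate \<xi> = t"
    unfolding growth_rate_def iff by (rule the_equality) (fact t, rule unique)
  then show "growth_rate \<xi> > 0" "\<mu> \<xi> (growth_rate \<xi>) = - (growth_rate \<xi>)\<^sup>2" using t by auto
qed

text \<open>This lemma and the next one locate the growth rate by the sign of \<open>\<mu> \<xi> s + s\<^sup>2\<close>.\<close>

lemma less_growth_rate:
  assumes "subcritical \<xi>" "s > 0" "\<mu> \<xi> s < - s\<^sup>2" shows "s < growth_rate \<xi>"
proof (rule ccontr)
  assume "\<not> s < growth_rate \<xi>"
  then have le: "growth_rate \<xi> \<le> s" by simp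
  note G = growth_rate[OF assms(1)]
  have "- (growth_rate \<xi>)\<^sup>2 \<le> \<mu> \<xi> s"
    using mu_mono[OF assms(1) _ le] G by simp
  moreover have "(growth_rate \<xi>)\<^sup>2 \<le> s\<^sup>2" using le G(1) by (intro power_mono) auto
  ultimately show False using assms(3) by simp
qed

lemma growth_rate_less:
  assumes "subcritical \<xi>" "s > 0" "- s\<^sup>2 < \<mu> \<xi> s" shows "growth_rate \<xi> < s"
proof (rule ccontr)
  assume "\<not> growth_rate \<xi> < s"
  then have le: "s \<le> growth_rate \<xi>" by simp
  note G = growth_rate[OF assms(1)]
  have "\<mu> \<xi> s \<le> - (growth_rate \<xi>)\<^sup>2"
    using mu_mono[OF assms(1) _ le] G assms(2) by simp
  moreover have "s\<^sup>2 \<le> (growth_rate \<xi>)\<^sup>2" using le assms(2) by (intro power_mono) auto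
  ultimately show False using assms(3) by simp
qed

lemma growth_rate_low_frequency:
  assumes "subcritical \<xi>" shows "growth_rate \<xi> \<le> sqrt (g * \<xi>)"
proof (rule real_le_rsqrt)
  show "(growth_rate \<xi>)\<^sup>2 \<le> g * \<xi>"
    using mu_lower[OF assms, of "growth_rate \<xi>"] growth_rate[OF assms] by simp
qed

lemma growth_rate_negative_energy:
  assumes "subcritical \<xi>"
  obtains \<phi> \<psi> where "(\<phi>, \<psi>) \<in> admissible" "energy \<xi> 0 \<phi> \<psi> + growth_rate \<xi> * dissipation \<xi> \<phi> \<psi> < 0"
proof -
  have "\<mu> \<xi> (growth_rate \<xi>) < 0" using growth_rate[OF assms] by simp
  then obtain \<phi> \<psi> where a: "(\<phi>, \<psi>) \<in> admissible" "energy \<xi> (growth_rate \<xi>) \<phi> \<psi> < 0"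
    by (rule mu_less[OF assms])
  then show ?thesis using that energy_admissible(1)[OF a(1), of \<xi> "growth_rate \<xi>"] by simp
qed

text \<open>At high frequency the dissipation, of order \<open>\<xi>\<^sup>2\<close>, outweighs gravity, of order \<open>\<xi>\<close>.\<close>

lemma growth_rate_high_frequency:
  assumes sub: "subcritical \<xi>" shows "growth_rate \<xi> \<le> g * upper / lower / \<xi>"
proof -
  have \<xi>: "\<xi> > 0" using sub by (simp add: subcritical_def)
  obtain \<phi> \<psi> where a: "(\<phi>, \<psi>) \<in> admissible"
    and neg: "energy \<xi> 0 \<phi> \<psi> + growth_rate \<xi> * dissipation \<xi> \<phi> \<psi> < 0"
    by (rule growth_rate_negative_energy[OF sub])
  have "lower / upper * \<xi>\<^sup>2 \<le> dissipation \<xi> \<phi> \<psi>"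
    using dissipation_frequency[OF admissibleD(1,2)[OF a], of \<xi>] admissibleD(3)[OF a] by simp
  then have "growth_rate \<xi> * (lower / upper * \<xi>\<^sup>2) \<le> growth_rate \<xi> * dissipation \<xi> \<phi> \<psi>"
    using growth_rate(1)[OF sub] by (intro mult_left_mono) auto
  then have "growth_rate \<xi> * (lower / upper * \<xi>\<^sup>2) < g * \<xi>"
    using neg energy_admissible(3)[OF a, of \<xi>] \<xi> by linarith
  then have "(growth_rate \<xi> * lower * \<xi>) * \<xi> < (g * upper) * \<xi>"
    using upper(1) by (simp add: field_simps power2_eq_square)
  then have "growth_rate \<xi> * lower * \<xi> < g * upper"
    by (rule mult_right_less_imp_less) (use \<xi> in simp)
  then show ?thesis using lower(1) \<xi> by (simp add: field_simps)
qed

text \<open>The instability is driven by \<open>\<psi> 0\<close> alone, with a strength that vanishes at the critical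
  frequency, and the dissipation controls \<open>\<psi> 0\<close>.\<close>

lemma growth_rate_near_critical:
  assumes sub: "subcritical \<xi>" shows "growth_rate \<xi> \<le> (l + m) / lower * (g * jump - \<sigma> * \<xi>\<^sup>2)"
proof -
  let ?\<kappa> = "g * jump - \<sigma> * \<xi>\<^sup>2"
  have \<kappa>: "?\<kappa> > 0" using sub by (simp add: subcritical_def)
  obtain \<phi> \<psi> where a: "(\<phi>, \<psi>) \<in> admissible"
    and neg: "energy \<xi> 0 \<phi> \<psi> + growth_rate \<xi> * dissipation \<xi> \<phi> \<psi> < 0"
    by (rule growth_rate_negative_energy[OF sub])
  note H = admissibleD(1,2)[OF a]
  define G where "G = (\<integral>x. (D \<phi> x)\<^sup>2 + (D \<psi> x)\<^sup>2 \<partial>dom)"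
  have G: "G \<ge> 0" unfolding G_def by (rule Bochner_Integration.integral_nonneg) simp
  have "?\<kappa> / 2 * (\<psi> 0)\<^sup>2 \<le> ?\<kappa> / 2 * ((l + m) * G)"
    using \<kappa> interface_square_le[OF H] by (intro mult_left_mono) (auto simp: G_def)
  moreover have "- (?\<kappa> / 2 * (\<psi> 0)\<^sup>2) \<le> energy \<xi> 0 \<phi> \<psi>"
    using energy_interface_bound[OF H, of \<xi>] by (simp add: field_simps)
  moreover have "lower / 2 * G \<le> dissipation \<xi> \<phi> \<psi>"
    using dissipation_gradients[OF H, of \<xi>] lower(1) by (simp add: G_def field_simps)
  then have "growth_rate \<xi> * (lower / 2 * G) \<le> growth_rate \<xi> * dissipation \<xi> \<phi> \<psi>"
    using growth_rate(1)[OF sub] by (intro mult_left_mono) auto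
  ultimately have "growth_rate \<xi> * (lower / 2 * G) < ?\<kappa> / 2 * ((l + m) * G)" using neg by linarith
  then have "(growth_rate \<xi> * lower) * G < (?\<kappa> * (l + m)) * G" by (simp add: field_simps)
  then have "growth_rate \<xi> * lower < ?\<kappa> * (l + m)"
    by (rule mult_right_less_imp_less[OF _ G])
  then show ?thesis using lower(1) by (simp add: field_simps)
qed

lemma growth_rate_bounded: "\<exists>C. \<forall>\<xi>. subcritical \<xi> \<longrightarrow> growth_rate \<xi> \<le> C"
proof (intro exI allI impI)
  fix \<xi> assume sub: "subcritical \<xi>"
  then have \<xi>: "\<xi> > 0" by (simp add: subcritical_def)
  show "growth_rate \<xi> \<le> max (sqrt g) (g * upper / lower)"
  proof (cases "\<xi> \<le> 1")
    case True
    then have "g * \<xi> \<le> g * 1" using g_pos by (intro mult_left_mono) auto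
    then have "sqrt (g * \<xi>) \<le> sqrt g" by simp
    then show ?thesis using growth_rate_low_frequency[OF sub] by linarith
  next
    case False
    have "g * upper / lower / \<xi> \<le> g * upper / lower / 1"
      using False g_pos upper(1) lower(1) by (intro divide_left_mono) auto
    then show ?thesis using growth_rate_high_frequency[OF sub] by simp
  qed
qed

text \<open>A single competitor that is good enough at \<open>\<xi>\<^sub>0\<close> remains so nearby.\<close>

lemma growth_rate_lower_semicontinuous:
  assumes sub: "subcritical \<xi>\<^sub>0" and s: "0 < s" "s < growth_rate \<xi>\<^sub>0"
  shows "\<forall>\<^sub>F \<xi> in at \<xi>\<^sub>0 within Collect subcritical. s < growth_rate \<xi>"
proof -
  have \<xi>0: "\<xi>\<^sub>0 > 0" using sub by (simp add: subcritical_def)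
  note G = growth_rate[OF sub]
  have "s\<^sup>2 < (growth_rate \<xi>\<^sub>0)\<^sup>2" using s by (intro power_strict_mono) auto
  then have "\<mu> \<xi>\<^sub>0 s < - s\<^sup>2" using mu_mono[OF sub, of s "growth_rate \<xi>\<^sub>0"] s G by simp
  then obtain \<phi> \<psi> where a: "(\<phi>, \<psi>) \<in> admissible" and E: "energy \<xi>\<^sub>0 s \<phi> \<psi> < - s\<^sup>2"
    by (rule mu_less[OF sub])
  define \<beta> where "\<beta> = \<xi>\<^sub>0 + 1"
  have \<beta>: "\<beta> > 0" using \<xi>0 by (simp add: \<beta>_def)
  obtain A B where AB: "\<And>\<xi> \<eta> \<phi> \<psi>. 0 < \<xi> \<Longrightarrow> \<xi> \<le> \<beta> \<Longrightarrow> 0 < \<eta> \<Longrightarrow> \<eta> \<le> \<beta> \<Longrightarrow> (\<phi>, \<psi>) \<in> admissible \<Longrightarrow>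
    energy \<eta> s \<phi> \<psi> \<le> energy \<xi> s \<phi> \<psi> + \<bar>\<eta> - \<xi>\<bar> * (A * energy \<xi> s \<phi> \<psi> + B)"
    using energy_frequency_comparison[OF \<beta> s(1)] by blast
  let ?R = "\<lambda>\<eta>. energy \<xi>\<^sub>0 s \<phi> \<psi> + \<bar>\<eta> - \<xi>\<^sub>0\<bar> * (A * energy \<xi>\<^sub>0 s \<phi> \<psi> + B)"
  have "(?R \<longlongrightarrow> energy \<xi>\<^sub>0 s \<phi> \<psi> + \<bar>\<xi>\<^sub>0 - \<xi>\<^sub>0\<bar> * (A * energy \<xi>\<^sub>0 s \<phi> \<psi> + B)) (at \<xi>\<^sub>0 within Collect subcritical)"
    by (intro tendsto_intros)
  then have "\<forall>\<^sub>F \<eta> in at \<xi>\<^sub>0 within Collect subcritical. ?R \<eta> < - s\<^sup>2"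
    by (rule order_tendstoD(2)) (use E in simp)
  moreover have "\<forall>\<^sub>F \<eta> in at \<xi>\<^sub>0 within Collect subcritical. \<eta> < \<beta>"
    by (rule order_tendstoD(2)[OF tendsto_ident_at]) (simp add: \<beta>_def)
  moreover have "\<forall>\<^sub>F \<eta> in at \<xi>\<^sub>0 within Collect subcritical. subcritical \<eta>"
    by (simp add: eventually_at_filter)
  ultimately show ?thesis
  proof eventually_elim
    case (elim \<eta>)
    then have \<eta>: "\<eta> > 0" by (simp add: subcritical_def)
    have "\<mu> \<eta> s \<le> energy \<eta> s \<phi> \<psi>" using \<eta> s by (intro mu_le a) auto
    also have "\<dots> \<le> ?R \<eta>" using elim \<eta> \<xi>0 by (intro AB a) (auto simp: \<beta>_def)
    also have "\<dots> < - s\<^sup>2" by fact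
    finally show ?case using elim s by (intro less_growth_rate) auto
  qed
qed

text \<open>All competitors have to be bounded below at once, so the uniformity of
  \<open>energy_frequency_comparison\<close> is used: it bounds every energy at \<open>\<eta>\<close> from below in terms of
  the infimum at \<open>\<xi>\<^sub>0\<close>.\<close>

lemma growth_rate_upper_semicontinuous:
  assumes sub: "subcritical \<xi>\<^sub>0" and s: "growth_rate \<xi>\<^sub>0 < s"
  shows "\<forall>\<^sub>F \<xi> in at \<xi>\<^sub>0 within Collect subcritical. growth_rate \<xi> < s"
proof -
  have \<xi>0: "\<xi>\<^sub>0 > 0" using sub by (simp add: subcritical_def)
  note G = growth_rate[OF sub]
  have s0: "s > 0" using s G by simp
  have less: "(growth_rate \<xi>\<^sub>0)\<^sup>2 < s\<^sup>2" using s G by (intro power_strict_mono) auto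
  have mu0: "- (growth_rate \<xi>\<^sub>0)\<^sup>2 \<le> \<mu> \<xi>\<^sub>0 s" using mu_mono[OF sub, of "growth_rate \<xi>\<^sub>0" s] s G by simp
  define \<beta> where "\<beta> = \<xi>\<^sub>0 + 1"
  have \<beta>: "\<beta> > 0" using \<xi>0 by (simp add: \<beta>_def)
  obtain A B where A0: "A \<ge> 0" and AB: "\<And>\<xi> \<eta> \<phi> \<psi>. 0 < \<xi> \<Longrightarrow> \<xi> \<le> \<beta> \<Longrightarrow> 0 < \<eta> \<Longrightarrow> \<eta> \<le> \<beta> \<Longrightarrow> (\<phi>, \<psi>) \<in> admissible \<Longrightarrow>
    energy \<eta> s \<phi> \<psi> \<le> energy \<xi> s \<phi> \<psi> + \<bar>\<eta> - \<xi>\<bar> * (A * energy \<xi> s \<phi> \<psi> + B)"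
    using energy_frequency_comparison[OF \<beta> s0] by blast
  let ?R = "\<lambda>\<eta>. (- (growth_rate \<xi>\<^sub>0)\<^sup>2 - \<bar>\<xi>\<^sub>0 - \<eta>\<bar> * B) / (1 + \<bar>\<xi>\<^sub>0 - \<eta>\<bar> * A)"
  have "(?R \<longlongrightarrow> (- (growth_rate \<xi>\<^sub>0)\<^sup>2 - \<bar>\<xi>\<^sub>0 - \<xi>\<^sub>0\<bar> * B) / (1 + \<bar>\<xi>\<^sub>0 - \<xi>\<^sub>0\<bar> * A)) (at \<xi>\<^sub>0 within Collect subcritical)"
    by (intro tendsto_intros) simp
  then have "\<forall>\<^sub>F \<eta> in at \<xi>\<^sub>0 within Collect subcritical. - s\<^sup>2 < ?R \<eta>"
    by (rule order_tendstoD(1)) (use less in simp)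
  moreover have "\<forall>\<^sub>F \<eta> in at \<xi>\<^sub>0 within Collect subcritical. \<eta> < \<beta>"
    by (rule order_tendstoD(2)[OF tendsto_ident_at]) (simp add: \<beta>_def)
  moreover have "\<forall>\<^sub>F \<eta> in at \<xi>\<^sub>0 within Collect subcritical. subcritical \<eta>"
    by (simp add: eventually_at_filter)
  ultimately show ?thesis
  proof eventually_elim
    case (elim \<eta>)
    then have \<eta>: "\<eta> > 0" by (simp add: subcritical_def)
    have "?R \<eta> \<le> \<mu> \<eta> s"
    proof (rule mu_ge[OF sub])
      fix \<phi> \<psi> assume a: "(\<phi>, \<psi>) \<in> admissible"
      have "- (growth_rate \<xi>\<^sub>0)\<^sup>2 \<le> energy \<xi>\<^sub>0 s \<phi> \<psi>"
        using mu0 mu_le[of \<xi>\<^sub>0 s, OF _ _ a] \<xi>0 s0 by simp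
      also have "\<dots> \<le> energy \<eta> s \<phi> \<psi> + \<bar>\<xi>\<^sub>0 - \<eta>\<bar> * (A * energy \<eta> s \<phi> \<psi> + B)"
        using elim \<eta> \<xi>0 by (intro AB a) (auto simp: \<beta>_def)
      finally have "- (growth_rate \<xi>\<^sub>0)\<^sup>2 - \<bar>\<xi>\<^sub>0 - \<eta>\<bar> * B \<le> energy \<eta> s \<phi> \<psi> * (1 + \<bar>\<xi>\<^sub>0 - \<eta>\<bar> * A)"
        by (simp add: algebra_simps)
      moreover have "1 + \<bar>\<xi>\<^sub>0 - \<eta>\<bar> * A > 0" using A0 by (simp add: add_pos_nonneg)
      ultimately show "?R \<eta> \<le> energy \<eta> s \<phi> \<psi>" by (simp add: pos_divide_le_eq)
    qed
    with elim s0 show ?case by (intro growth_rate_less) auto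
  qed
qed

lemma continuous_on_growth_rate: "continuous_on (Collect subcritical) growth_rate"
  unfolding continuous_on_def
proof
  fix \<xi> assume "\<xi> \<in> Collect subcritical"
  then have sub: "subcritical \<xi>" by simp
  show "(growth_rate \<longlongrightarrow> growth_rate \<xi>) (at \<xi> within Collect subcritical)"
  proof (rule order_tendstoI)
    fix s assume s: "s < growth_rate \<xi>"
    show "\<forall>\<^sub>F \<eta> in at \<xi> within Collect subcritical. s < growth_rate \<eta>"
    proof (cases "s > 0")
      case True
      then show ?thesis by (rule growth_rate_lower_semicontinuous[OF sub _ s])
    next
      case False
      have "\<forall>\<^sub>F \<eta> in at \<xi> within Collect subcritical. subcritical \<eta>" by (simp add: eventually_at_filter)
      then show ?thesis by (rule eventually_mono) (use False growth_rate(1) in fastforce)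
    qed
  qed (rule growth_rate_upper_semicontinuous[OF sub])
qed

lemma subcritical_iff: "subcritical \<xi> \<longleftrightarrow> 0 < \<xi> \<and> ereal \<xi> < critical_freq"
proof (cases "\<sigma> = 0")
  case True
  then show ?thesis unfolding subcritical_def critical_freq_def using g_pos jump_pos by simp
next
  case False
  then have \<sigma>: "\<sigma> > 0" using sigma_nonneg by simp
  have "\<sigma> * \<xi>\<^sup>2 < g * jump \<longleftrightarrow> \<xi> < sqrt (g * jump / \<sigma>)" if "\<xi> > 0"
  proof -
    have "\<xi> < sqrt (g * jump / \<sigma>) \<longleftrightarrow> sqrt (\<xi>\<^sup>2) < sqrt (g * jump / \<sigma>)" using that by simp
    also have "\<dots> \<longleftrightarrow> \<sigma> * \<xi>\<^sup>2 < g * jump"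
      unfolding real_sqrt_less_iff using \<sigma> by (simp add: field_simps)
    finally show ?thesis by simp
  qed
  then show ?thesis unfolding subcritical_def critical_freq_def using False by auto
qed

lemma growth_rate_tendsto_0:
  assumes "eventually subcritical F" "eventually (\<lambda>\<xi>. growth_rate \<xi> \<le> b \<xi>) F" "(b \<longlongrightarrow> 0) F"
  shows "(growth_rate \<longlongrightarrow> 0) F"
  by (rule tendsto_sandwich[OF _ assms(2) tendsto_const assms(3)])
     (rule eventually_mono[OF assms(1)], rule less_imp_le, rule growth_rate(1))

lemma growth_rate_at_0: "(growth_rate \<longlongrightarrow> 0) (at_right 0)"
proof (rule growth_rate_tendsto_0)
  have "((\<lambda>\<xi>. \<sigma> * \<xi>\<^sup>2) \<longlongrightarrow> \<sigma> * 0\<^sup>2) (at_right 0)" by (intro tendsto_intros)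
  then have "\<forall>\<^sub>F \<xi> in at_right 0. \<sigma> * \<xi>\<^sup>2 < g * jump"
    by (rule order_tendstoD(2)) (use g_pos jump_pos in simp)
  then show ev: "eventually subcritical (at_right 0)"
    using eventually_at_right_less by eventually_elim (simp add: subcritical_def)
  show "\<forall>\<^sub>F \<xi> in at_right 0. growth_rate \<xi> \<le> sqrt (g * \<xi>)"
    by (rule eventually_mono[OF ev growth_rate_low_frequency])
  have "((\<lambda>\<xi>. sqrt (g * \<xi>)) \<longlongrightarrow> sqrt (g * 0)) (at_right 0)" by (intro tendsto_intros)
  then show "((\<lambda>\<xi>. sqrt (g * \<xi>)) \<longlongrightarrow> 0) (at_right 0)" by simp
qed

lemma growth_rate_at_critical: "((growth_rate \<circ> real_of_ereal) \<longlongrightarrow> 0) (at_left critical_freq)"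
proof (cases "\<sigma> = 0")
  case True
  have "(growth_rate \<longlongrightarrow> 0) at_top"
  proof (rule growth_rate_tendsto_0)
    show ev: "eventually subcritical at_top"
      unfolding subcritical_def using eventually_gt_at_top[of 0]
      by (rule eventually_mono) (use True g_pos jump_pos in simp)
    show "\<forall>\<^sub>F \<xi> in at_top. growth_rate \<xi> \<le> g * upper / lower / \<xi>"
      by (rule eventually_mono[OF ev growth_rate_high_frequency])
    show "((\<lambda>\<xi>. g * upper / lower / \<xi>) \<longlongrightarrow> 0) at_top"
      by (intro tendsto_divide_0[OF tendsto_const] filterlim_at_top_imp_at_infinity filterlim_ident)
  qed
  then show ?thesis unfolding critical_freq_def using True by (simp add: ereal_tendsto_simps)
next
  case False
  then have \<sigma>: "\<sigma> > 0" using sigma_nonneg by simp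
  define c where "c = sqrt (g * jump / \<sigma>)"
  have c: "c > 0" "critical_freq = ereal c" using \<sigma> g_pos jump_pos False by (simp_all add: c_def critical_freq_def)
  have c2: "\<sigma> * c\<^sup>2 = g * jump" using \<sigma> g_pos jump_pos by (simp add: c_def)
  have "(growth_rate \<longlongrightarrow> 0) (at_left c)"
  proof (rule growth_rate_tendsto_0)
    have "\<forall>\<^sub>F \<xi> in at_left c. 0 < \<xi> \<and> \<xi> < c"
      using eventually_at_left_real[OF c(1)] by (rule eventually_mono) auto
    then show ev: "eventually subcritical (at_left c)"
      by (rule eventually_mono) (simp add: subcritical_iff c(2))
    show "\<forall>\<^sub>F \<xi> in at_left c. growth_rate \<xi> \<le> (l + m) / lower * (g * jump - \<sigma> * \<xi>\<^sup>2)"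
      by (rule eventually_mono[OF ev growth_rate_near_critical])
    have "((\<lambda>\<xi>. (l + m) / lower * (g * jump - \<sigma> * \<xi>\<^sup>2)) \<longlongrightarrow> (l + m) / lower * (g * jump - \<sigma> * c\<^sup>2)) (at_left c)"
      by (intro tendsto_intros)
    then show "((\<lambda>\<xi>. (l + m) / lower * (g * jump - \<sigma> * \<xi>\<^sup>2)) \<longlongrightarrow> 0) (at_left c)" by (simp add: c2)
  qed
  then show ?thesis by (simp add: c(2) ereal_tendsto_simps)
qed

lemma growth_rate_properties:
  "(\<forall>\<xi>\<in>{\<xi>. 0 < \<xi> \<and> ereal \<xi> < critical_freq}. growth_rate \<xi> > 0)
    \<and> bounded (growth_rate ` {\<xi>. 0 < \<xi> \<and> ereal \<xi> < critical_freq})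
    \<and> continuous_on {\<xi>. 0 < \<xi> \<and> ereal \<xi> < critical_freq} growth_rate
    \<and> (growth_rate \<longlongrightarrow> 0) (at_right 0)
    \<and> ((growth_rate \<circ> real_of_ereal) \<longlongrightarrow> 0) (at_left critical_freq)"
proof -
  have set: "{\<xi>. 0 < \<xi> \<and> ereal \<xi> < critical_freq} = Collect subcritical"
    by (auto simp: subcritical_iff)
  obtain C where C: "\<And>\<xi>. subcritical \<xi> \<Longrightarrow> growth_rate \<xi> \<le> C" using growth_rate_bounded by blast
  have "norm x \<le> C" if "x \<in> growth_rate ` Collect subcritical" for x
    using that C growth_rate(1) by fastforce
  then have "bounded (growth_rate ` Collect subcritical)" by (rule boundedI)
  then show ?thesis
    unfolding set using growth_rate(1) continuous_on_growth_rate growth_rate_at_0 growth_rate_at_critical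
    by simp
qed

end

theorem proposition3p9:
  fixes g \<sigma> m l :: real
    and Pp Pm \<epsilon>p \<epsilon>m \<delta>p \<delta>m :: "real \<Rightarrow> real"
    and \<rho>m :: real
    and lam :: "real \<Rightarrow> real"
    and xc :: ereal
  assumes params: "compressible_RT g \<sigma> m l Pp Pm \<epsilon>p \<epsilon>m \<delta>p \<delta>m \<rho>m"
    and lam_eq: "lam = compressible_RT.growth_rate g \<sigma> m l Pp Pm \<epsilon>p \<epsilon>m \<delta>p \<delta>m \<rho>m"
    and xc_eq: "xc = compressible_RT.critical_freq g \<sigma> Pp Pm \<rho>m"
  shows "(\<forall>\<xi>\<in>{\<xi>. 0 < \<xi> \<and> ereal \<xi> < xc}. lam \<xi> > 0)
    \<and> bounded (lam ` {\<xi>. 0 < \<xi> \<and> ereal \<xi> < xc})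
    \<and> continuous_on {\<xi>. 0 < \<xi> \<and> ereal \<xi> < xc} lam
    \<and> (lam \<longlongrightarrow> 0) (at_right 0)
    \<and> ((lam \<circ> real_of_ereal) \<longlongrightarrow> 0) (at_left xc)"
  unfolding lam_eq xc_eq by (rule compressible_RT.growth_rate_properties[OF params])

end
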